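(* Let $\lambda,\mu\ge0$ be real numbers, not both zero, let $c>0$, and let $p=1$. If $\phi\in X^{1/2}$ is a solution of $$\big(-c\,\partial_x\phi+\phi\,\partial_x\phi+\mathcal H(\partial_x^2\phi+\lambda\,\partial_y^2\phi)\big)_x+\mu\,\partial_y^2\phi=0 ,$$ then $\phi\in H^\infty(\mathbb{R}^2)=\bigcap_{n\ge0}H^n(\mathbb{R}^2)$. Moreover, $\phi$ is real analytic on $\mathbb{R}^2$.
   Context: $\mathcal H$ is the Hilbert transform in $x$, $(\mathcal H f)^\wedge=-i\,\mathrm{sgn}(\xi)\hat f$, where hats denote Fourier transform in $(x,y)$ with dual variables $(\xi,\eta)$. $D_x^{s}$ is the Fourier multiplier $|\xi|^{s}$. $X^{1/2}=\{f\in L^2(\mathbb{R}^2): D_x^{1/2}f\in L^2,\ D_x^{-1/2}\partial_y f\in L^2\}$. $H^n(\mathbb{R}^2)$ denotes the usual Sobolev space. The equation is understood in the sense of distributions. *)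

theory Defs
  imports "HOL-Analysis.Analysis"
begin

definition pdx :: "(real \<times> real \<Rightarrow> real) \<Rightarrow> real \<times> real \<Rightarrow> real" where
  "pdx f = (\<lambda>z. deriv (\<lambda>t. f (t, snd z)) (fst z))"

definition pdy :: "(real \<times> real \<Rightarrow> real) \<Rightarrow> real \<times> real \<Rightarrow> real" where
  "pdy f = (\<lambda>z. deriv (\<lambda>t. f (fst z, t)) (snd z))"

definition iter_partial :: "bool list \<Rightarrow> (real \<times> real \<Rightarrow> real) \<Rightarrow> real \<times> real \<Rightarrow> real" where
  "iter_partial ds f = fold (\<lambda>b h. if b then pdx h else pdy h) ds f"

definition smooth2 :: "(real \<times> real \<Rightarrow> real) \<Rightarrow> bool" where
  "smooth2 f \<longleftrightarrow> (\<forall>ds. continuous_on UNIV (iter_partial ds f) \<and>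
     (\<forall>z. (\<lambda>t. iter_partial ds f (t, snd z)) differentiable (at (fst z)) \<and>
          (\<lambda>t. iter_partial ds f (fst z, t)) differentiable (at (snd z))))"

definition test_fn :: "(real \<times> real \<Rightarrow> real) \<Rightarrow> bool" where
  "test_fn f \<longleftrightarrow> smooth2 f \<and> bounded {z. f z \<noteq> 0}"

definition ft :: "(real \<times> real \<Rightarrow> real) \<Rightarrow> real \<times> real \<Rightarrow> complex" where
  "ft g = (\<lambda>\<zeta>. LINT z|lborel. complex_of_real (g z) * exp (- \<i> * complex_of_real (z \<bullet> \<zeta>)))"

definition L2 :: "(real \<times> real \<Rightarrow> real) \<Rightarrow> bool" where
  "L2 f \<longleftrightarrow> f \<in> borel_measurable lborel \<and> integrable lborel (\<lambda>z. (f z)\<^sup>2)"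

definition L2c :: "(real \<times> real \<Rightarrow> complex) \<Rightarrow> bool" where
  "L2c F \<longleftrightarrow> F \<in> borel_measurable lborel \<and> integrable lborel (\<lambda>z. (cmod (F z))\<^sup>2)"

definition fourier_L2 :: "(real \<times> real \<Rightarrow> real) \<Rightarrow> (real \<times> real \<Rightarrow> complex) \<Rightarrow> bool" where
  "fourier_L2 f F \<longleftrightarrow> L2 f \<and> L2c F \<and>
     (\<forall>g. test_fn g \<longrightarrow>
        (LINT z|lborel. complex_of_real (f z) * ft g z) = (LINT z|lborel. F z * complex_of_real (g z)))"

text \<open>X^{1/2}: f, D_x^{1/2} f, D_x^{-1/2} d_y f all in L^2 (via Fourier multipliers).\<close>
definition X_half :: "(real \<times> real \<Rightarrow> real) \<Rightarrow> bool" where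
  "X_half f \<longleftrightarrow> L2 f \<and> (\<exists>F. fourier_L2 f F \<and>
     L2c (\<lambda>(\<xi>,\<eta>). complex_of_real (sqrt \<bar>\<xi>\<bar>) * F (\<xi>,\<eta>)) \<and>
     L2c (\<lambda>(\<xi>,\<eta>). complex_of_real (\<eta> / sqrt \<bar>\<xi>\<bar>) * F (\<xi>,\<eta>)))"

definition sobolev_H :: "nat \<Rightarrow> (real \<times> real \<Rightarrow> real) \<Rightarrow> bool" where
  "sobolev_H n f \<longleftrightarrow> L2 f \<and> (\<exists>F. fourier_L2 f F \<and>
     L2c (\<lambda>\<zeta>. complex_of_real ((1 + (norm \<zeta>)\<^sup>2) powr (real n / 2)) * F \<zeta>))"

definition H_infty :: "(real \<times> real \<Rightarrow> real) \<Rightarrow> bool" where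
  "H_infty f \<longleftrightarrow> (\<forall>n. sobolev_H n f)"

text \<open>Distributional formulation of
  (-c phi_x + phi phi_x + H(phi_xx + lam phi_yy))_x + mu phi_yy = 0  (p = 1),
  with phi phi_x = (phi^2/2)_x, and the Hilbert term acting on psi through its Fourier
  multiplier: the distribution d_x H (d_x^2 + lam d_y^2) phi has Fourier transform
  -|xi| (xi^2 + lam eta^2) hat phi, so its pairing with a real test function psi is
  (2 pi)^{-2} int -|xi|(xi^2+lam eta^2) hat phi conj(hat psi).\<close>
definition weak_solution :: "real \<Rightarrow> real \<Rightarrow> real \<Rightarrow> (real \<times> real \<Rightarrow> real) \<Rightarrow> bool" where
  "weak_solution c lam mu phi \<longleftrightarrow> (\<exists>F. fourier_L2 phi F \<and>
     (\<forall>psi. test_fn psi \<longrightarrow>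
        complex_of_real (LINT z|lborel. (- c * phi z + (phi z)\<^sup>2 / 2) * pdx (pdx psi) z)
      + complex_of_real (mu * (LINT z|lborel. phi z * pdy (pdy psi) z))
      + (LINT \<zeta>|lborel. complex_of_real (- \<bar>fst \<zeta>\<bar> * ((fst \<zeta>)\<^sup>2 + lam * (snd \<zeta>)\<^sup>2) / (4 * pi\<^sup>2))
                         * F \<zeta> * cnj (ft psi \<zeta>)) = 0))"

definition real_analytic_on :: "(real \<times> real) set \<Rightarrow> (real \<times> real \<Rightarrow> real) \<Rightarrow> bool" where
  "real_analytic_on S f \<longleftrightarrow> (\<forall>p\<in>S. \<exists>r>0. \<exists>a :: nat \<Rightarrow> nat \<Rightarrow> real.
     \<forall>z\<in>ball p r. ((\<lambda>(j,k). a j k * (fst z - fst p) ^ j * (snd z - snd p) ^ k) has_sum f z) UNIV)"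

end

theory Submission
  imports Defs "HOL-Probability.Characteristic_Functions" "HOL-Probability.Sinc_Integral"
begin

text \<open>On the Fourier side the equation reads
  \<open>(|\<xi>|\<^sup>3 + lam |\<xi>| \<eta>\<^sup>2 + mu \<eta>\<^sup>2 - c \<xi>\<^sup>2) F = - \<xi>\<^sup>2 (F * F) / (8 \<pi>\<^sup>2)\<close> almost everywhere. For \<open>c > 0\<close> the symbol
  vanishes on a curve, but this curve is bounded, and at high frequency the symbol dominates \<open>\<xi>\<^sup>2 |\<zeta>|\<^bsup>2/3\<^esup>\<close>.
  Hence \<open>f = |F|\<close> satisfies \<open>f \<le> A (1 + |\<zeta>|)\<^bsup>-2/3\<^esup> (f * f)\<close> for large \<open>|\<zeta>|\<close>, while \<open>X\<^bsup>1/2\<^esup>\<close> gives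
  \<open>(1 + |\<zeta>|)\<^bsup>1/2\<^esup> f \<in> L\<^sup>2\<close>. Each pass through this inequality improves the pointwise decay of \<open>f\<close> by a fixed
  power, until \<open>f\<close> is integrable. Then the weighted masses \<open>X(s) = \<integral> exp (s min |\<zeta>| N) f\<close> satisfy a quadratic
  inequality \<open>X \<le> K + \<epsilon> X\<^sup>2\<close> with \<open>\<epsilon>\<close> as small as desired, and a continuity argument in \<open>s\<close> bounds them
  uniformly in \<open>N\<close>. So \<open>exp (\<delta> |\<zeta>|) f\<close> is integrable, which gives both claims.\<close>

section \<open>Translation and mollification in \<open>L\<^sup>2\<close>\<close>

text \<open>The exponent 2/3 comes from the case lam = 0: the leading part of the symbol divided by
  \<xi>^2 is |\<xi>| + mu \<eta>^2 / \<xi>^2, which is smallest at |\<xi>| of order |\<eta>|^(2/3).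
  The obstacle is that the energy space is used only through half an isotropic derivative, whereas
  integrability of |F| in the plane asks for more than one derivative in L^2. At first the
  convolution is merely bounded, so decay has to be bootstrapped. This works because 2/3 exceeds
  1/2, the order of weight that has to be given up to integrate one factor of the convolution.
  Cancellation in F * F is never exploited. On the distributional side, the transform is known only
  through pairings with real test functions. Tensor products of one-variable functions are rich
  enough: their dilates, translates and modulations yield mollifiers, uniqueness of the transform
  and a Parseval identity. The two-dimensional theory thereby rests on a single one-dimensional
  fact, Fourier inversion at the origin, which comes from a Gaussian.\<close>

lemma lborel_distr_reflect: "distr lborel borel (\<lambda>x. a - x) = (lborel :: 'a::euclidean_space measure)"
  by (subst (2) lborel_affine[of "-1" a]) (auto simp: density_1)

lemma integrable_lborel_shift:
  fixes f :: "'a::euclidean_space \<Rightarrow> 'b::{banach,second_countable_topology}"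
  assumes "integrable lborel f"
  shows "integrable lborel (\<lambda>x. f (a + x))"
  using assms by (subst (asm) lborel_distr_plus[symmetric, of a], subst (asm) integrable_distr_eq) auto

lemma integral_lborel_shift:
  fixes f :: "'a::euclidean_space \<Rightarrow> 'b::{banach,second_countable_topology}"
  assumes [measurable]: "f \<in> borel_measurable borel"
  shows "(LINT x|lborel. f (a + x)) = (LINT x|lborel. f x)"
  by (subst lborel_distr_plus[symmetric, of a], subst integral_distr) auto

lemma integrable_lborel_reflect:
  fixes f :: "'a::euclidean_space \<Rightarrow> 'b::{banach,second_countable_topology}"
  assumes "integrable lborel f"
  shows "integrable lborel (\<lambda>x. f (a - x))"
  using assms by (subst (asm) lborel_distr_reflect[symmetric, of a], subst (asm) integrable_distr_eq) auto

lemma integral_lborel_reflect: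
  fixes f :: "'a::euclidean_space \<Rightarrow> 'b::{banach,second_countable_topology}"
  assumes [measurable]: "f \<in> borel_measurable borel"
  shows "(LINT x|lborel. f (a - x)) = (LINT x|lborel. f x)"
  by (subst lborel_distr_reflect[symmetric, of a], subst integral_distr) auto

lemma AE_lborel_reflect:
  assumes "AE x in (lborel :: 'a::euclidean_space measure). P x"
  shows "AE x in lborel. P (a - x)"
proof -
  obtain N where N: "N \<in> null_sets lborel" "{x. \<not> P x} \<subseteq> N"
    using assms by (auto simp: eventually_ae_filter)
  have [measurable]: "N \<in> sets borel" using N by (auto simp: null_sets_def)
  have "AE x in distr lborel borel (\<lambda>x. a - x). x \<notin> N"
    unfolding lborel_distr_reflect using N(1) by (rule AE_not_in)
  then have "AE x in lborel. a - x \<notin> N"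
    by (subst (asm) AE_distr_iff) auto
  then show ?thesis by (rule eventually_mono) (use N(2) in auto)
qed

lemma nn_integral_lborel_scale:
  fixes f :: "'a::euclidean_space \<Rightarrow> ennreal"
  assumes [measurable]: "f \<in> borel_measurable borel" and "c \<noteq> 0"
  shows "(\<integral>\<^sup>+x. f x \<partial>lborel) = ennreal (\<bar>c\<bar> ^ DIM('a)) * (\<integral>\<^sup>+x. f (t + c *\<^sub>R x) \<partial>lborel)"
  by (subst lborel_affine[of c t], fact)
     (simp add: nn_integral_density nn_integral_distr nn_integral_cmult)

lemma integrable_lborel_scale:
  fixes f :: "'a::euclidean_space \<Rightarrow> 'b::{banach,second_countable_topology}"
  assumes f: "integrable lborel f" and c: "c \<noteq> 0"
  shows "integrable lborel (\<lambda>x. f (t + c *\<^sub>R x))"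
proof -
  have [measurable]: "f \<in> borel_measurable borel" using f by auto
  have "ennreal (\<bar>c\<bar> ^ DIM('a)) * (\<integral>\<^sup>+x. norm (f (t + c *\<^sub>R x)) \<partial>lborel) < \<infinity>"
    using f by (subst nn_integral_lborel_scale[symmetric, OF _ c]) (auto simp: integrable_iff_bounded)
  moreover have "0 < \<bar>c\<bar> ^ DIM('a)" using c by simp
  ultimately have "(\<integral>\<^sup>+x. norm (f (t + c *\<^sub>R x)) \<partial>lborel) < \<infinity>"
    by (auto simp: ennreal_mult_less_top ennreal_eq_0_iff)
  then show ?thesis by (auto simp: integrable_iff_bounded)
qed

lemma integral_lborel_scale:
  fixes f :: "'a::euclidean_space \<Rightarrow> 'b::{banach,second_countable_topology}"
  assumes [measurable]: "f \<in> borel_measurable borel" and c: "c \<noteq> 0"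
  shows "(LINT x|lborel. f x) = (\<bar>c\<bar> ^ DIM('a)) *\<^sub>R (LINT x|lborel. f (t + c *\<^sub>R x))"
  by (subst lborel_affine[of c t], fact)
     (simp add: integral_density integral_distr)

text \<open>Off this line the multiplier \<eta> / sqrt |\<xi>| is meaningful and the common factor
  \<xi>^2 of the equation can be cancelled.\<close>

lemma AE_lborel_fst_nonzero: "AE z in (lborel :: (real \<times> real) measure). fst z \<noteq> 0"
proof (rule AE_I')
  have "emeasure (lborel \<Otimes>\<^sub>M lborel :: (real \<times> real) measure) ({0} \<times> UNIV) = 0"
    by (subst lborel.emeasure_pair_measure_Times) auto
  then show "({0} \<times> UNIV) \<in> null_sets (lborel :: (real \<times> real) measure)"
    by (auto simp: null_sets_def lborel_prod intro!: borel_closed closed_Times)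
qed auto

lemma integrable_dominated:
  fixes f :: "'a \<Rightarrow> 'b::{banach,second_countable_topology}" and g :: "'a \<Rightarrow> real"
  assumes "integrable M g" "f \<in> borel_measurable M" "\<And>x. norm (f x) \<le> g x"
  shows "integrable M f"
  by (rule Bochner_Integration.integrable_bound[OF assms(1,2)]) (auto intro!: AE_I2 order_trans[OF assms(3)])

lemma mult_le_sum_squares: "x * y \<le> x\<^sup>2 + y\<^sup>2" if "x \<ge> 0" "y \<ge> 0" for x y :: real
  using sum_squares_bound[of x y] mult_nonneg_nonneg[OF that] by linarith

lemma integrable_mult_L2:
  fixes f g :: "'a \<Rightarrow> 'b::{banach,second_countable_topology,real_normed_algebra}"
  assumes [measurable]: "f \<in> borel_measurable M" "g \<in> borel_measurable M"
    and f: "integrable M (\<lambda>x. (norm (f x))\<^sup>2)" and g: "integrable M (\<lambda>x. (norm (g x))\<^sup>2)"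
  shows "integrable M (\<lambda>x. f x * g x)"
proof (rule integrable_dominated[OF Bochner_Integration.integrable_add[OF f g]])
  show "norm (f x * g x) \<le> (norm (f x))\<^sup>2 + (norm (g x))\<^sup>2" for x
    using order_trans[OF norm_mult_ineq mult_le_sum_squares] by simp
qed measurable

section \<open>Continuity of translations in L^1 and L^2\<close>

definition L1_cont :: "('a::euclidean_space \<Rightarrow> real) \<Rightarrow> bool" where
  "L1_cont f \<longleftrightarrow> (\<forall>h. h \<longlonglongrightarrow> 0 \<longrightarrow> (\<lambda>n. LINT z|lborel. \<bar>f (h n + z) - f z\<bar>) \<longlonglongrightarrow> 0)"

text \<open>A point of an open set stays in it under small shifts, so the part where the shifted
  indicator drops below the original one tends to 0, dominated by the indicator of U. The opposite
  part has no such dominator, but by translation invariance it has the same integral; hence the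
  factor 2.\<close>

lemma L1_cont_open:
  fixes U :: "'a::euclidean_space set"
  assumes U: "open U" "emeasure lborel U < \<infinity>"
  shows "L1_cont (indicator U)"
  unfolding L1_cont_def
proof (intro allI impI)
  fix h :: "nat \<Rightarrow> 'a" assume h: "h \<longlonglongrightarrow> 0"
  let ?i = "indicator U :: 'a \<Rightarrow> real"
  have [measurable]: "U \<in> sets borel" using U by auto
  have int: "integrable lborel ?i" using U by (auto simp: integrable_indicator_iff)
  have ints: "integrable lborel (\<lambda>z. ?i (h n + z))" for n
    by (rule integrable_lborel_shift[OF int])
  have "(\<lambda>n. LINT z|lborel. max 0 (?i z - ?i (h n + z))) \<longlonglongrightarrow> (LINT z|(lborel :: 'a measure). 0 :: real)"
  proof (rule integral_dominated_convergence[where w = ?i])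
    show "AE z in lborel. (\<lambda>n. max 0 (?i z - ?i (h n + z))) \<longlonglongrightarrow> 0"
    proof (rule AE_I2)
      fix z
      show "(\<lambda>n. max 0 (?i z - ?i (h n + z))) \<longlonglongrightarrow> 0"
      proof (cases "z \<in> U")
        case True
        have "(\<lambda>n. h n + z) \<longlonglongrightarrow> 0 + z" by (intro tendsto_intros h)
        then have "\<forall>\<^sub>F n in sequentially. h n + z \<in> U"
          using U(1) True by (simp add: topological_tendstoD)
        then have "\<forall>\<^sub>F n in sequentially. max 0 (?i z - ?i (h n + z)) = 0"
          by eventually_elim (use True in auto)
        then show ?thesis by (rule tendsto_eventually)
      qed (auto simp: indicator_def)
    qed
  qed (use int in \<open>auto simp: indicator_def\<close>)
  then have lim: "(\<lambda>n. 2 * (LINT z|lborel. max 0 (?i z - ?i (h n + z)))) \<longlonglongrightarrow> 0"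
    using tendsto_mult_right_zero by fastforce
  have "(LINT z|lborel. \<bar>?i (h n + z) - ?i z\<bar>) = 2 * (LINT z|lborel. max 0 (?i z - ?i (h n + z)))" for n
  proof -
    have "(LINT z|lborel. \<bar>?i (h n + z) - ?i z\<bar>)
        = (LINT z|lborel. (?i (h n + z) - ?i z) + 2 * max 0 (?i z - ?i (h n + z)))"
      by (intro Bochner_Integration.integral_cong) (auto simp: indicator_def)
    also have "\<dots> = (LINT z|lborel. ?i (h n + z) - ?i z) + (LINT z|lborel. 2 * max 0 (?i z - ?i (h n + z)))"
      by (intro Bochner_Integration.integral_add Bochner_Integration.integrable_diff int ints
          integrable_mult_right integrable_max integrable_zero)
    also have "(LINT z|lborel. ?i (h n + z) - ?i z) = 0"
      by (subst Bochner_Integration.integral_diff[OF ints int], subst integral_lborel_shift) auto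
    finally show ?thesis by simp
  qed
  then show "(\<lambda>n. LINT z|lborel. \<bar>?i (h n + z) - ?i z\<bar>) \<longlonglongrightarrow> 0" using lim by simp
qed

text \<open>Translation invariance makes the error of replacing f by g the same before and after the
  shift, so three terms below r/4 suffice.\<close>

lemma L1_cont_approx:
  fixes f :: "'a::euclidean_space \<Rightarrow> real"
  assumes f: "integrable lborel f"
    and ex: "\<And>e. e > 0 \<Longrightarrow> \<exists>g. integrable lborel g \<and> L1_cont g \<and> (LINT z|lborel. \<bar>f z - g z\<bar>) < e"
  shows "L1_cont f"
  unfolding L1_cont_def
proof (intro allI impI)
  fix h :: "nat \<Rightarrow> 'a" assume h: "h \<longlonglongrightarrow> 0"
  show "(\<lambda>n. LINT z|lborel. \<bar>f (h n + z) - f z\<bar>) \<longlonglongrightarrow> 0"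
  proof (rule LIMSEQ_I)
    fix r :: real assume r: "r > 0"
    obtain g where g: "integrable lborel g" "L1_cont g" "(LINT z|lborel. \<bar>f z - g z\<bar>) < r / 4"
      using ex[of "r/4"] r by auto
    have [measurable]: "f \<in> borel_measurable borel" "g \<in> borel_measurable borel" using f g by auto
    have "(\<lambda>n. LINT z|lborel. \<bar>g (h n + z) - g z\<bar>) \<longlonglongrightarrow> 0"
      using g(2) h by (auto simp: L1_cont_def)
    then obtain N where N: "\<And>n. n \<ge> N \<Longrightarrow> norm ((LINT z|lborel. \<bar>g (h n + z) - g z\<bar>) - 0) < r/4"
      using r by (meson LIMSEQ_D divide_pos_pos zero_less_numeral)
    have i1: "integrable lborel (\<lambda>z. \<bar>f z - g z\<bar>)" using f g by auto
    have i2: "integrable lborel (\<lambda>z. \<bar>f (h n + z) - g (h n + z)\<bar>)" for n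
      using integrable_lborel_shift[OF i1] .
    have i3: "integrable lborel (\<lambda>z. \<bar>g (h n + z) - g z\<bar>)" for n
      using integrable_lborel_shift[OF g(1)] g(1) by auto
    have "norm ((LINT z|lborel. \<bar>f (h n + z) - f z\<bar>) - 0) < r" if "n \<ge> N" for n
    proof -
      have "(LINT z|lborel. \<bar>f (h n + z) - f z\<bar>)
        \<le> (LINT z|lborel. \<bar>f (h n + z) - g (h n + z)\<bar> + (\<bar>g (h n + z) - g z\<bar> + \<bar>f z - g z\<bar>))"
        using integrable_lborel_shift[OF f] f i1 i2 i3 by (intro integral_mono) auto
      also have "\<dots> = (LINT z|lborel. \<bar>f (h n + z) - g (h n + z)\<bar>) + ((LINT z|lborel. \<bar>g (h n + z) - g z\<bar>) + (LINT z|lborel. \<bar>f z - g z\<bar>))"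
        using i1 i2 i3 by (subst Bochner_Integration.integral_add, auto)+
      also have "(LINT z|lborel. \<bar>f (h n + z) - g (h n + z)\<bar>) = (LINT z|lborel. \<bar>f z - g z\<bar>)"
        by (rule integral_lborel_shift) auto
      also have "\<dots> + ((LINT z|lborel. \<bar>g (h n + z) - g z\<bar>) + (LINT z|lborel. \<bar>f z - g z\<bar>)) < r"
        using N[OF that] g(3) r by (simp add: abs_less_iff)
      finally show ?thesis by simp
    qed
    then show "\<exists>no. \<forall>n\<ge>no. norm ((LINT z|lborel. \<bar>f (h n + z) - f z\<bar>) - 0) < r" by blast
  qed
qed

lemma L1_cont_cmult:
  assumes "L1_cont f" shows "L1_cont (\<lambda>z. f z * c)"
proof -
  have "\<bar>f a * c - f b * c\<bar> = \<bar>c\<bar> * \<bar>f a - f b\<bar>" for a b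
    by (simp add: abs_mult[symmetric] algebra_simps)
  then show ?thesis using assms unfolding L1_cont_def by (auto intro: tendsto_mult_right_zero)
qed

lemma L1_cont_add:
  fixes f :: "'a::euclidean_space \<Rightarrow> real"
  assumes i: "integrable lborel f" "integrable lborel g" and "L1_cont f" "L1_cont g"
  shows "L1_cont (\<lambda>z. f z + g z)"
  unfolding L1_cont_def
proof (intro allI impI)
  fix h :: "nat \<Rightarrow> 'a" assume h: "h \<longlonglongrightarrow> 0"
  have l: "(\<lambda>n. (LINT z|lborel. \<bar>f (h n + z) - f z\<bar>) + (LINT z|lborel. \<bar>g (h n + z) - g z\<bar>)) \<longlonglongrightarrow> 0"
    using assms h by (auto simp: L1_cont_def intro!: tendsto_add_zero)
  have "(LINT z|lborel. \<bar>f (h n + z) + g (h n + z) - (f z + g z)\<bar>)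
    \<le> (LINT z|lborel. \<bar>f (h n + z) - f z\<bar>) + (LINT z|lborel. \<bar>g (h n + z) - g z\<bar>)" for n
  proof -
    have j: "integrable lborel (\<lambda>z. \<bar>f (h n + z) - f z\<bar>)" "integrable lborel (\<lambda>z. \<bar>g (h n + z) - g z\<bar>)"
      "integrable lborel (\<lambda>z. \<bar>f (h n + z) + g (h n + z) - (f z + g z)\<bar>)"
      using i integrable_lborel_shift[OF i(1), of "h n"] integrable_lborel_shift[OF i(2), of "h n"] by auto
    show ?thesis
      unfolding Bochner_Integration.integral_add[OF j(1,2), symmetric]
      by (rule integral_mono[OF j(3)]) (use j in auto)
  qed
  then show "(\<lambda>n. LINT z|lborel. \<bar>f (h n + z) + g (h n + z) - (f z + g z)\<bar>) \<longlonglongrightarrow> 0"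
    by (intro tendsto_sandwich[OF _ _ tendsto_const l]) auto
qed

text \<open>Induction over the construction of integrable functions: outer regularity replaces a
  Borel set by an open one, and limits are covered by approximation in L^1.\<close>

lemma L1_cont_integrable:
  fixes f :: "'a::euclidean_space \<Rightarrow> real"
  assumes "integrable lborel f"
  shows "L1_cont f"
  using assms
proof (induction rule: integrable_induct)
  case (base A c)
  have [measurable]: "A \<in> sets borel" using base by auto
  have iA: "integrable lborel (indicator A :: _ \<Rightarrow> real)" using base by (auto simp: integrable_indicator_iff)
  have "L1_cont (indicator A :: 'a \<Rightarrow> real)"
  proof (rule L1_cont_approx[OF iA])
    fix e :: real assume e: "e > 0"
    obtain U where U: "open U" "A \<subseteq> U" "emeasure lborel (U - A) < e"
      using outer_regular_lborel[of A e] e by auto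
    have [measurable]: "U \<in> sets borel" using U by auto
    have "emeasure lborel U \<le> emeasure lborel A + emeasure lborel (U - A)"
      by (metis Diff_partition U(1,2) base.hyps(1) borel_open emeasure_subadditive sets.Diff sets_lborel)
    also have "\<dots> < \<infinity>" using base U(3) by (auto simp: less_top[symmetric])
    finally have fin: "emeasure lborel U < \<infinity>" .
    have iU: "integrable lborel (indicator U :: _ \<Rightarrow> real)" using fin by (auto simp: integrable_indicator_iff)
    have "(LINT z|lborel. \<bar>indicator A z - indicator U z :: real\<bar>) = (LINT z|lborel. indicator (U - A) z)"
      using U(2) by (intro Bochner_Integration.integral_cong) (auto simp: indicator_def)
    also have "\<dots> = measure lborel (U - A)" by simp
    also have "\<dots> < e"
    proof -
      have "emeasure lborel (U - A) = ennreal (measure lborel (U - A))"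
        using U(3) by (intro emeasure_eq_ennreal_measure) auto
      then show ?thesis using U(3) by (simp add: ennreal_less_iff)
    qed
    finally show "\<exists>g. integrable lborel g \<and> L1_cont g \<and> (LINT z|lborel. \<bar>indicator A z - g z\<bar>) < e"
      using iU L1_cont_open[OF U(1) fin] by blast
  qed
  then show ?case using L1_cont_cmult by auto
next
  case (add f g)
  then show ?case by (intro L1_cont_add)
next
  case (lim f s)
  have [measurable]: "f \<in> borel_measurable borel" "\<And>i. s i \<in> borel_measurable borel" using lim by auto
  show ?case
  proof (rule L1_cont_approx[OF lim(4)])
    fix e :: real assume e: "e > 0"
    have "(\<lambda>i. LINT z|lborel. \<bar>f z - s i z\<bar>) \<longlonglongrightarrow> (LINT z|(lborel::'a measure). 0 :: real)"
    \<comment> \<open>The induction rule supplies |s i| <= 2 |f|, and the distance to f adds one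
      more |f|.\<close>
    proof (rule integral_dominated_convergence[where w = "\<lambda>z. 3 * \<bar>f z\<bar>"])
      show "AE x in lborel. (\<lambda>i. \<bar>f x - s i x\<bar>) \<longlonglongrightarrow> 0"
      proof (rule AE_I2)
        fix x
        have "(\<lambda>i. \<bar>f x - s i x\<bar>) \<longlonglongrightarrow> \<bar>f x - f x\<bar>"
          using lim(2)[of x] by (intro tendsto_intros) auto
        then show "(\<lambda>i. \<bar>f x - s i x\<bar>) \<longlonglongrightarrow> 0" by simp
      qed
      fix i show "AE x in lborel. norm \<bar>f x - s i x\<bar> \<le> 3 * \<bar>f x\<bar>"
      proof (rule AE_I2)
        fix x show "norm \<bar>f x - s i x\<bar> \<le> 3 * \<bar>f x\<bar>" using lim(3)[of x i] by simp
      qed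
    qed (use lim in auto)
    then have "\<forall>\<^sub>F i in sequentially. (LINT z|lborel. \<bar>f z - s i z\<bar>) < e"
      using e by (intro order_tendstoD) auto
    then obtain i where "(LINT z|lborel. \<bar>f z - s i z\<bar>) < e"
      using eventually_happens'[OF sequentially_bot] by blast
    then show "\<exists>g. integrable lborel g \<and> L1_cont g \<and> (LINT z|lborel. \<bar>f z - g z\<bar>) < e"
      using lim(1)[of i] lim(5)[of i] by blast
  qed
qed

text \<open>The bound \<open>|a - b|\<^sup>2 \<le> 2 |a|a| - b|b||\<close> reduces translation continuity in \<open>L\<^sup>2\<close> to that in \<open>L\<^sup>1\<close>.\<close>

lemma L2_translation_real:
  fixes f :: "'a::euclidean_space \<Rightarrow> real"
  assumes [measurable]: "f \<in> borel_measurable borel" and f: "integrable lborel (\<lambda>z. (f z)\<^sup>2)"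
    and h: "h \<longlonglongrightarrow> 0"
  shows "(\<lambda>n. LINT z|lborel. (f (h n + z) - f z)\<^sup>2) \<longlonglongrightarrow> 0"
proof -
  define g where "g = (\<lambda>z. f z * \<bar>f z\<bar>)"
  have [measurable]: "g \<in> borel_measurable borel" by (simp add: g_def)
  have g: "integrable lborel g"
    by (rule integrable_dominated[OF f]) (auto simp: g_def abs_mult power2_eq_square)
  have "(\<lambda>n. LINT z|lborel. \<bar>g (h n + z) - g z\<bar>) \<longlonglongrightarrow> 0"
    using L1_cont_integrable[OF g] h by (auto simp: L1_cont_def)
  then have l: "(\<lambda>n. 2 * (LINT z|lborel. \<bar>g (h n + z) - g z\<bar>)) \<longlonglongrightarrow> 0"
    by (rule tendsto_mult_right_zero)
  have sq_le: "(a - b)\<^sup>2 \<le> 2 * \<bar>a * \<bar>a\<bar> - b * \<bar>b\<bar>\<bar>" for a b :: real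
  proof -
    have *: "(a - b)\<^sup>2 \<le> 2 * \<bar>a * \<bar>a\<bar> - b * \<bar>b\<bar>\<bar>" if "a \<ge> b" for a b :: real
    proof -
      \<comment> \<open>For equal signs the right side contains |a^2 - b^2| = |a - b| |a + b|, and
        |a + b| is at least |a - b|. The factor 2 is what opposite signs require.\<close>
      consider "b \<ge> 0" | "a \<le> 0" | "b < 0" "a > 0" by linarith
      then show ?thesis
      proof cases
        case 1
        then have "b * (a - b) \<ge> 0" using that by auto
        moreover have "a * (a-b) \<ge> 0" using that 1 by auto
        ultimately show ?thesis using that 1 by (simp add: power2_eq_square algebra_simps)
      next
        case 2
        then have "(-a) * (a - b) \<ge> 0" using that by (intro mult_nonneg_nonneg) auto
        moreover have "(-b) * (a-b) \<ge> 0" using that 2 by (intro mult_nonneg_nonneg) auto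
        ultimately show ?thesis using that 2 by (simp add: power2_eq_square algebra_simps)
      next
        case 3
        then have "(a + b)\<^sup>2 \<ge> 0" by auto
        then have "(a-b)\<^sup>2 \<le> 2 * (a * a + b * b)" by (simp add: power2_eq_square algebra_simps)
        then show ?thesis using 3 by (simp add: power2_eq_square algebra_simps)
      qed
    qed
    show ?thesis
    proof (cases "a \<ge> b")
      case False
      then have "(b - a)\<^sup>2 \<le> 2 * \<bar>b * \<bar>b\<bar> - a * \<bar>a\<bar>\<bar>" by (intro *) auto
      then show ?thesis by (simp only: power2_commute[of b a] abs_minus_commute)
    qed (rule *)
  qed
  have "(LINT z|lborel. (f (h n + z) - f z)\<^sup>2) \<le> 2 * (LINT z|lborel. \<bar>g (h n + z) - g z\<bar>)" for n
  proof -
    have "integrable lborel (\<lambda>z. 2 * \<bar>g (h n + z) - g z\<bar>)"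
      using integrable_lborel_shift[OF g, of "h n"] g by auto
    moreover from this have "integrable lborel (\<lambda>z. (f (h n + z) - f z)\<^sup>2)"
      by (rule integrable_dominated) (use sq_le in \<open>auto simp: g_def\<close>)
    ultimately have "(LINT z|lborel. (f (h n + z) - f z)\<^sup>2) \<le> (LINT z|lborel. 2 * \<bar>g (h n + z) - g z\<bar>)"
      using sq_le by (intro integral_mono) (auto simp: g_def)
    then show ?thesis by simp
  qed
  then show ?thesis
    by (intro tendsto_sandwich[OF _ _ tendsto_const l]) auto
qed

lemma integrable_cmod_sq_iff:
  fixes f :: "'a \<Rightarrow> complex"
  assumes [measurable]: "f \<in> borel_measurable M"
  shows "integrable M (\<lambda>z. (cmod (f z))\<^sup>2) \<longleftrightarrow> integrable M (\<lambda>z. (Re (f z))\<^sup>2) \<and> integrable M (\<lambda>z. (Im (f z))\<^sup>2)"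
proof safe
  assume *: "integrable M (\<lambda>z. (cmod (f z))\<^sup>2)"
  show "integrable M (\<lambda>z. (Re (f z))\<^sup>2)" "integrable M (\<lambda>z. (Im (f z))\<^sup>2)"
    by (rule integrable_dominated[OF *]; auto simp: cmod_power2)+
qed (auto simp: cmod_power2)

lemma cmod_diff_sq_le: "(cmod (a - b))\<^sup>2 \<le> 2 * (cmod a)\<^sup>2 + 2 * (cmod b)\<^sup>2"
proof -
  have "(cmod (a - b))\<^sup>2 \<le> (cmod a + cmod b)\<^sup>2" by (intro power_mono norm_triangle_ineq4) auto
  also have "\<dots> \<le> 2 * (cmod a)\<^sup>2 + 2 * (cmod b)\<^sup>2"
    using sum_squares_bound[of "cmod a" "cmod b"] by (simp add: power2_sum)
  finally show ?thesis .
qed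

lemma L2_diff_integrable:
  fixes f g :: "'a \<Rightarrow> complex"
  assumes [measurable]: "f \<in> borel_measurable M" "g \<in> borel_measurable M"
    and f: "integrable M (\<lambda>z. (cmod (f z))\<^sup>2)" and g: "integrable M (\<lambda>z. (cmod (g z))\<^sup>2)"
  shows "integrable M (\<lambda>z. (cmod (f z - g z))\<^sup>2)"
proof (rule integrable_dominated)
  show "integrable M (\<lambda>z. 2 * (cmod (f z))\<^sup>2 + 2 * (cmod (g z))\<^sup>2)" using f g by auto
qed (auto simp: cmod_diff_sq_le)

lemma L2_translation:
  fixes f :: "'a::euclidean_space \<Rightarrow> complex"
  assumes [measurable]: "f \<in> borel_measurable borel" and f: "integrable lborel (\<lambda>z. (cmod (f z))\<^sup>2)"
    and h: "h \<longlonglongrightarrow> 0"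
  shows "(\<lambda>n. LINT z|lborel. (cmod (f (h n + z) - f z))\<^sup>2) \<longlonglongrightarrow> 0"
proof -
  have i: "integrable lborel (\<lambda>z. (Re (f z))\<^sup>2)" "integrable lborel (\<lambda>z. (Im (f z))\<^sup>2)"
    using f by (auto simp: integrable_cmod_sq_iff)
  have "integrable lborel (\<lambda>z. (cmod (f (h n + z) - f z))\<^sup>2)" for n
    using integrable_lborel_shift[OF f] f by (intro L2_diff_integrable) auto
  then have j: "integrable lborel (\<lambda>z. (Re (f (h n + z)) - Re (f z))\<^sup>2)"
     "integrable lborel (\<lambda>z. (Im (f (h n + z)) - Im (f z))\<^sup>2)" for n
    by (auto simp: integrable_cmod_sq_iff)
  have "(\<lambda>n. (LINT z|lborel. (Re (f (h n + z)) - Re (f z))\<^sup>2) + (LINT z|lborel. (Im (f (h n + z)) - Im (f z))\<^sup>2)) \<longlonglongrightarrow> 0 + 0"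
    using i h by (intro tendsto_add L2_translation_real[of "\<lambda>z. Re (f z)"] L2_translation_real[of "\<lambda>z. Im (f z)"]) auto
  then show ?thesis using j by (simp add: cmod_power2)
qed

text \<open>Cauchy-Schwarz after writing |g| as sqrt |g| times sqrt |g|, so that |g| acts as a
  measure. A nonintegrable product is harmless because its integral defaults to 0.\<close>

lemma norm_integral_mult_sq_le:
  fixes f g :: "'a \<Rightarrow> complex"
  assumes [measurable]: "f \<in> borel_measurable M" "g \<in> borel_measurable M"
  shows "ennreal ((cmod (LINT x|M. f x * g x))\<^sup>2)
    \<le> (\<integral>\<^sup>+x. cmod (g x) \<partial>M) * (\<integral>\<^sup>+x. ennreal (cmod (g x)) * ennreal ((cmod (f x))\<^sup>2) \<partial>M)"
proof -
  have "ennreal (cmod (LINT x|M. f x * g x)) \<le> (\<integral>\<^sup>+x. cmod (f x * g x) \<partial>M)"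
    by (cases "integrable M (\<lambda>x. f x * g x)")
       (simp_all add: integral_norm_bound_ennreal not_integrable_integral_eq)
  also have "\<dots> = (\<integral>\<^sup>+x. ennreal (sqrt (cmod (g x))) * ennreal (sqrt (cmod (g x)) * cmod (f x)) \<partial>M)"
  proof (rule nn_integral_cong)
    fix x
    have "cmod (f x * g x) = sqrt (cmod (g x)) * (sqrt (cmod (g x)) * cmod (f x))"
      by (simp add: norm_mult mult.assoc[symmetric])
    then show "ennreal (cmod (f x * g x)) = ennreal (sqrt (cmod (g x))) * ennreal (sqrt (cmod (g x)) * cmod (f x))"
      by (simp only: ennreal_mult' norm_ge_zero real_sqrt_ge_0_iff)
  qed
  finally have "(ennreal (cmod (LINT x|M. f x * g x)))\<^sup>2
      \<le> (\<integral>\<^sup>+x. ennreal (sqrt (cmod (g x))) * ennreal (sqrt (cmod (g x)) * cmod (f x)) \<partial>M)\<^sup>2"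
    by (intro power_mono) auto
  also have "\<dots> \<le> (\<integral>\<^sup>+x. (ennreal (sqrt (cmod (g x))))\<^sup>2 \<partial>M) * (\<integral>\<^sup>+x. (ennreal (sqrt (cmod (g x)) * cmod (f x)))\<^sup>2 \<partial>M)"
    by (rule Cauchy_Schwarz_nn_integral) auto
  also have "\<dots> = (\<integral>\<^sup>+x. cmod (g x) \<partial>M) * (\<integral>\<^sup>+x. ennreal (cmod (g x)) * ennreal ((cmod (f x))\<^sup>2) \<partial>M)"
    by (simp add: ennreal_power power_mult_distrib ennreal_mult)
  finally show ?thesis by (simp add: ennreal_power)
qed

text \<open>Minkowski is replaced by Cauchy--Schwarz against \<open>|K|\<close>, so \<open>K\<close> need not be positive.\<close>

lemma L2_mollify:
  fixes h K :: "'a::euclidean_space \<Rightarrow> complex" and e :: "nat \<Rightarrow> real"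
  assumes [measurable]: "h \<in> borel_measurable borel" and h: "integrable lborel (\<lambda>z. (cmod (h z))\<^sup>2)"
    and K1: "integrable lborel K" and K2: "integrable lborel (\<lambda>z. (cmod (K z))\<^sup>2)"
    and e: "e \<longlonglongrightarrow> 0" "\<And>n. e n \<noteq> 0"
  shows "(\<lambda>n. \<integral>\<^sup>+w. ennreal ((cmod ((LINT y|lborel. h (w + e n *\<^sub>R y) * K y) - (LINT y|lborel. K y) * h w))\<^sup>2) \<partial>lborel) \<longlonglongrightarrow> 0"
proof -
  have [measurable]: "K \<in> borel_measurable borel" using K1 by auto
  \<comment> \<open>The squared L^2 modulus of continuity of h. It is bounded by \<open>B\<close>
    and tends to 0 with v, which is what dominated convergence in y needs.\<close>
  define T where "T v = (\<integral>\<^sup>+w. ennreal ((cmod (h (v + w) - h w))\<^sup>2) \<partial>lborel)" for v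
  have [measurable]: "T \<in> borel_measurable borel"
    unfolding T_def by (rule lborel.borel_measurable_nn_integral) simp
  have iT: "integrable lborel (\<lambda>w. (cmod (h (v + w) - h w))\<^sup>2)" for v
    using integrable_lborel_shift[OF h] h by (intro L2_diff_integrable) auto
  have T_eq: "T v = ennreal (LINT w|lborel. (cmod (h (v + w) - h w))\<^sup>2)" for v
    unfolding T_def by (rule nn_integral_eq_integral[OF iT]) auto
  define B where "B = 4 * (LINT w|lborel. (cmod (h w))\<^sup>2)"
  have B0: "B \<ge> 0" unfolding B_def by simp
  have T_le: "T v \<le> ennreal B" for v
  proof -
    have "(LINT w|lborel. (cmod (h (v + w) - h w))\<^sup>2) \<le> (LINT w|lborel. 2 * (cmod (h (v + w)))\<^sup>2 + 2 * (cmod (h w))\<^sup>2)"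
    proof (rule integral_mono[OF iT])
      show "integrable lborel (\<lambda>w. 2 * (cmod (h (v + w)))\<^sup>2 + 2 * (cmod (h w))\<^sup>2)"
        using integrable_lborel_shift[OF h, of v] h by auto
    qed (rule cmod_diff_sq_le)
    also have "\<dots> = 2 * (LINT w|lborel. (cmod (h (v + w)))\<^sup>2) + 2 * (LINT w|lborel. (cmod (h w))\<^sup>2)"
      using integrable_lborel_shift[OF h, of v] h by simp
    also have "(LINT w|lborel. (cmod (h (v + w)))\<^sup>2) = (LINT w|lborel. (cmod (h w))\<^sup>2)"
      by (rule integral_lborel_shift) auto
    finally show ?thesis unfolding T_eq B_def by (intro ennreal_leI) simp
  qed
  define k where "k = (\<integral>\<^sup>+y. cmod (K y) \<partial>lborel)"
  have k: "k < \<infinity>" using K1 by (auto simp: k_def integrable_iff_bounded)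
  have le: "(\<integral>\<^sup>+w. ennreal ((cmod ((LINT y|lborel. h (w + e n *\<^sub>R y) * K y) - (LINT y|lborel. K y) * h w))\<^sup>2) \<partial>lborel)
     \<le> k * (\<integral>\<^sup>+y. ennreal (cmod (K y)) * T (e n *\<^sub>R y) \<partial>lborel)" for n
  proof -
    have eq: "(LINT y|lborel. h (w + e n *\<^sub>R y) * K y) - (LINT y|lborel. K y) * h w
      = (LINT y|lborel. (h (w + e n *\<^sub>R y) - h w) * K y)" for w
    proof -
      \<comment> \<open>Square integrability of K gives integrability for every w, not just almost
        every w, so the difference can be written as one integral pointwise.\<close>
      have "integrable lborel (\<lambda>y. h (w + e n *\<^sub>R y) * K y)"
        using integrable_lborel_scale[OF h e(2)[of n], of w] K2 by (intro integrable_mult_L2) auto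
      then show ?thesis using K1
        by (simp add: left_diff_distrib mult.commute[of _ "h w"])
    qed
    have "(\<integral>\<^sup>+w. ennreal ((cmod ((LINT y|lborel. h (w + e n *\<^sub>R y) * K y) - (LINT y|lborel. K y) * h w))\<^sup>2) \<partial>lborel)
      \<le> (\<integral>\<^sup>+w. k * (\<integral>\<^sup>+y. ennreal (cmod (K y)) * ennreal ((cmod (h (w + e n *\<^sub>R y) - h w))\<^sup>2) \<partial>lborel) \<partial>lborel)"
      unfolding eq k_def by (intro nn_integral_mono norm_integral_mult_sq_le) auto
    also have "\<dots> = k * (\<integral>\<^sup>+w. (\<integral>\<^sup>+y. ennreal (cmod (K y)) * ennreal ((cmod (h (w + e n *\<^sub>R y) - h w))\<^sup>2) \<partial>lborel) \<partial>lborel)"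
      by (rule nn_integral_cmult) measurable
    also have "(\<integral>\<^sup>+w. (\<integral>\<^sup>+y. ennreal (cmod (K y)) * ennreal ((cmod (h (w + e n *\<^sub>R y) - h w))\<^sup>2) \<partial>lborel) \<partial>lborel)
      = (\<integral>\<^sup>+y. (\<integral>\<^sup>+w. ennreal (cmod (K y)) * ennreal ((cmod (h (w + e n *\<^sub>R y) - h w))\<^sup>2) \<partial>lborel) \<partial>lborel)"
      by (rule lborel_pair.Fubini') measurable
    also have "\<dots> = (\<integral>\<^sup>+y. ennreal (cmod (K y)) * T (e n *\<^sub>R y) \<partial>lborel)"
      unfolding T_def by (intro nn_integral_cong) (simp add: nn_integral_cmult add.commute)
    finally show ?thesis .
  qed
  have "(\<lambda>n. \<integral>\<^sup>+y. ennreal (cmod (K y)) * T (e n *\<^sub>R y) \<partial>lborel) \<longlonglongrightarrow> (\<integral>\<^sup>+y. 0 \<partial>(lborel :: 'a measure))"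
  proof (rule nn_integral_dominated_convergence[where w = "\<lambda>y. ennreal (cmod (K y)) * ennreal B"])
    show "(\<integral>\<^sup>+y. ennreal (cmod (K y)) * ennreal B \<partial>lborel) < \<infinity>"
      using k by (simp add: nn_integral_multc k_def ennreal_mult_less_top)
    show "AE y in lborel. (\<lambda>n. ennreal (cmod (K y)) * T (e n *\<^sub>R y)) \<longlonglongrightarrow> 0"
    proof (rule AE_I2)
      fix y :: 'a
      have "(\<lambda>n. e n *\<^sub>R y) \<longlonglongrightarrow> 0 *\<^sub>R y" by (rule tendsto_scaleR[OF e(1) tendsto_const])
      then have "(\<lambda>n. LINT w|lborel. (cmod (h (e n *\<^sub>R y + w) - h w))\<^sup>2) \<longlonglongrightarrow> 0"
        by (intro L2_translation h) auto
      then have "(\<lambda>n. cmod (K y) * (LINT w|lborel. (cmod (h (e n *\<^sub>R y + w) - h w))\<^sup>2)) \<longlonglongrightarrow> 0"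
        by (rule tendsto_mult_right_zero)
      then have "(\<lambda>n. ennreal (cmod (K y) * (LINT w|lborel. (cmod (h (e n *\<^sub>R y + w) - h w))\<^sup>2))) \<longlonglongrightarrow> ennreal 0"
        by (rule tendsto_ennrealI)
      then show "(\<lambda>n. ennreal (cmod (K y)) * T (e n *\<^sub>R y)) \<longlonglongrightarrow> 0"
        by (simp add: T_eq ennreal_mult)
    qed
  qed (use T_le in \<open>auto intro!: mult_left_mono\<close>)
  then have "(\<lambda>n. k * (\<integral>\<^sup>+y. ennreal (cmod (K y)) * T (e n *\<^sub>R y) \<partial>lborel)) \<longlonglongrightarrow> k * 0"
    using k by (intro ennreal_tendsto_cmult) auto
  then have l: "(\<lambda>n. k * (\<integral>\<^sup>+y. ennreal (cmod (K y)) * T (e n *\<^sub>R y) \<partial>lborel)) \<longlonglongrightarrow> 0" by simp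
  show ?thesis
    by (rule tendsto_sandwich[OF _ _ tendsto_const l]) (use le in auto)
qed

section \<open>Test functions on the line and their transforms\<close>

text \<open>Recursion through an existing derivative makes every closure rule a single induction on
  n with the function generalised; holding for all n means smoothness.\<close>

primrec C_diff :: "nat \<Rightarrow> (real \<Rightarrow> complex) \<Rightarrow> bool" where
  "C_diff 0 a \<longleftrightarrow> continuous_on UNIV a"
| "C_diff (Suc n) a \<longleftrightarrow> (\<exists>a'. (\<forall>x. (a has_vector_derivative a' x) (at x)) \<and> C_diff n a')"

lemma C_diff_SucI:
  "(\<And>x. (a has_vector_derivative a' x) (at x)) \<Longrightarrow> C_diff n a' \<Longrightarrow> C_diff (Suc n) a"
  by auto

lemma C_diff_Suc: "C_diff (Suc n) a \<Longrightarrow> C_diff n a"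
proof (induction n arbitrary: a)
  case 0
  then show ?case
    by (auto intro!: continuous_at_imp_continuous_on intro: has_vector_derivative_continuous)
next
  case (Suc n)
  from Suc.prems obtain a' where a': "\<forall>x. (a has_vector_derivative a' x) (at x)" "C_diff (Suc n) a'"
    by (auto simp only: C_diff.simps(2)[of "Suc n"])
  show ?case unfolding C_diff.simps(2)[of n] using a'(1) Suc.IH[OF a'(2)] by blast
qed

lemma C_diff_const: "C_diff n (\<lambda>x. c)"
proof (induction n arbitrary: c)
  case (Suc n)
  have "((\<lambda>x. c) has_vector_derivative 0) (at x)" for x :: real by simp
  then show ?case unfolding C_diff.simps using Suc[of 0] by (intro exI[of _ "\<lambda>x. 0"]) auto
qed simp

lemma C_diff_add: "C_diff n a \<Longrightarrow> C_diff n b \<Longrightarrow> C_diff n (\<lambda>x. a x + b x)"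
proof (induction n arbitrary: a b)
  case 0
  then show ?case by (auto intro: continuous_intros)
next
  case (Suc n)
  then obtain a' b' where "\<forall>x. (a has_vector_derivative a' x) (at x)" "C_diff n a'"
    "\<forall>x. (b has_vector_derivative b' x) (at x)" "C_diff n b'" by auto
  then show ?case using Suc.IH[of a' b']
    by (auto intro!: exI[of _ "\<lambda>x. a' x + b' x"] has_vector_derivative_add)
qed

lemma C_diff_mult: "C_diff n a \<Longrightarrow> C_diff n b \<Longrightarrow> C_diff n (\<lambda>x. a x * b x)"
proof (induction n arbitrary: a b)
  case 0
  then show ?case by (auto intro: continuous_intros)
next
  case (Suc n)
  then obtain a' b' where *: "\<forall>x. (a has_vector_derivative a' x) (at x)" "C_diff n a'"
    "\<forall>x. (b has_vector_derivative b' x) (at x)" "C_diff n b'" by auto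
  have "C_diff n (\<lambda>x. a x * b' x + a' x * b x)"
    using * C_diff_Suc[OF Suc.prems(1)] C_diff_Suc[OF Suc.prems(2)]
    by (intro C_diff_add Suc.IH)
  moreover have "((\<lambda>x. a x * b x) has_vector_derivative (a x * b' x + a' x * b x)) (at x)" for x
    using * by (intro has_vector_derivative_mult) auto
  ultimately show ?case by (rule C_diff_SucI[rotated])
qed

lemma C_diff_affine: "C_diff n a \<Longrightarrow> C_diff n (\<lambda>x. a (p * x + q))"
proof (induction n arbitrary: a)
  case 0
  then show ?case by (auto intro!: continuous_on_compose2[of UNIV a] continuous_intros)
next
  case (Suc n)
  then obtain a' where *: "\<forall>x. (a has_vector_derivative a' x) (at x)" "C_diff n a'" by auto
  have "((a \<circ> (\<lambda>x. p * x + q)) has_vector_derivative p *\<^sub>R a' (p * x + q)) (at x)" for x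
    using * by (intro vector_diff_chain_at) (auto intro!: derivative_eq_intros)
  then have "((\<lambda>x. a (p * x + q)) has_vector_derivative of_real p * a' (p * x + q)) (at x)" for x
    by (simp add: o_def scaleR_conv_of_real)
  moreover have "C_diff n (\<lambda>x. of_real p * a' (p * x + q))"
    using * by (intro C_diff_mult C_diff_const Suc.IH)
  ultimately show ?case by (rule C_diff_SucI)
qed

lemma has_vector_derivative_cis:
  "((\<lambda>x. exp (\<i> * of_real (w * x))) has_vector_derivative (\<i> * of_real w) * exp (\<i> * of_real (w * x))) (at x)"
proof -
  have "((\<lambda>x. exp (\<i> * (of_real w * of_real x))) has_vector_derivative (\<i> * of_real w) * exp (\<i> * (of_real w * of_real x))) (at x)"
    by (rule has_vector_derivative_real_field[of "\<lambda>z. exp (\<i> * (of_real w * z))"])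
       (auto intro!: derivative_eq_intros)
  then show ?thesis by simp
qed

lemma C_diff_cis: "C_diff n (\<lambda>x. exp (\<i> * of_real (w * x)))"
proof (induction n)
  case 0
  then show ?case by (auto intro!: continuous_intros)
next
  case (Suc n)
  have "C_diff n (\<lambda>x. (\<i> * of_real w) * exp (\<i> * of_real (w * x)))"
    by (intro C_diff_mult C_diff_const Suc)
  then show ?case by (rule C_diff_SucI[OF has_vector_derivative_cis])
qed

text \<open>The classical functions vanishing to infinite order at 0. The polynomial factor closes
  the family under differentiation.\<close>

definition flat :: "real poly \<Rightarrow> real \<Rightarrow> real" where
  "flat p x = (if x > 0 then poly p (1 / x) * exp (- (1 / x)) else 0)"

text \<open>The additional power of t carries the induction on the polynomial, since
  \<open>pCons\<close> raises it by one.\<close>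

lemma poly_over_exp: "((\<lambda>t. t ^ k * poly p t * exp (- t)) \<longlongrightarrow> (0::real)) at_top"
proof (induction p arbitrary: k)
  case (pCons a p)
  have "((\<lambda>t. a * (t ^ k / exp t) + t ^ Suc k * poly p t * exp (- t)) \<longlongrightarrow> a * 0 + 0) at_top"
    by (intro tendsto_intros tendsto_power_div_exp_0 pCons)
  then show ?case by (simp add: algebra_simps exp_minus divide_inverse)
qed simp

text \<open>Differentiating p(1/x) exp(-1/x) multiplies by 1/x^2 and replaces p by p - p'. At 0 the
  difference quotient becomes t p(t) exp(-t) with t = 1/h, which vanishes at infinity.\<close>

lemma flat_deriv: "(flat p has_real_derivative flat ([:0,0,1:] * (p - pderiv p)) x) (at x)"
proof -
  let ?q = "[:0,0,1:] * (p - pderiv p)"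
  consider "x > 0" | "x < 0" | "x = 0" by linarith
  then show ?thesis
  proof cases
    case 1
    have "((\<lambda>x. poly p (1 / x) * exp (- (1 / x))) has_real_derivative flat ?q x) (at x)"
      unfolding flat_def using 1
      by (auto intro!: derivative_eq_intros DERIV_chain2[OF poly_DERIV] simp: field_simps power2_eq_square)
    then show ?thesis
      by (rule has_field_derivative_transform_within_open[of _ _ _ "{0<..}"]) (use 1 in \<open>auto simp: flat_def\<close>)
  next
    case 2
    have "((\<lambda>x. 0) has_real_derivative flat ?q x) (at x)" using 2 by (simp add: flat_def)
    then show ?thesis
      by (rule has_field_derivative_transform_within_open[of _ _ _ "{..<0}"]) (use 2 in \<open>auto simp: flat_def\<close>)
  next
    case 3
    have "((\<lambda>h. (1 / h) ^ 1 * poly p (1 / h) * exp (- (1 / h))) \<longlongrightarrow> 0) (at_right 0)"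
      by (rule filterlim_compose[OF poly_over_exp])
         (simp add: filterlim_inverse_at_top_right divide_inverse)
    then have r: "((\<lambda>h. flat p h / h) \<longlongrightarrow> 0) (at_right 0)"
      by (rule Lim_transform_eventually)
         (auto simp: flat_def eventually_at_filter)
    have l: "((\<lambda>h. flat p h / h) \<longlongrightarrow> 0) (at_left 0)"
      by (rule tendsto_eventually) (auto simp: flat_def eventually_at_filter)
    have "((\<lambda>h. flat p h / h) \<longlongrightarrow> 0) (at 0)"
      using l r by (simp add: filterlim_at_split)
    then show ?thesis using 3 by (simp add: DERIV_def flat_def)
  qed
qed

lemma C_diff_flat: "C_diff n (\<lambda>x. of_real (flat p x))"
proof (induction n arbitrary: p)
  case 0
  have "continuous_on UNIV (flat p)"
    by (intro continuous_at_imp_continuous_on ballI DERIV_isCont[OF flat_deriv])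
  then show ?case by (auto intro!: continuous_intros)
next
  case (Suc n)
  have "((\<lambda>x. complex_of_real (flat p x)) has_vector_derivative of_real (flat ([:0,0,1:] * (p - pderiv p)) x)) (at x)" for x
    using bounded_linear.has_vector_derivative[OF bounded_linear_of_real, of "flat p" _ "at x"] flat_deriv[of p x]
    by (simp add: has_real_derivative_iff_has_vector_derivative)
  then show ?case using Suc by (rule C_diff_SucI)
qed

text \<open>Complex values keep the class stable under modulation by \<open>iexp\<close>, which is
  how translations on the Fourier side are produced.\<close>

definition test1 :: "(real \<Rightarrow> complex) \<Rightarrow> bool" where
  "test1 a \<longleftrightarrow> (\<forall>n. C_diff n a) \<and> (\<exists>M. \<forall>x. \<bar>x\<bar> > M \<longrightarrow> a x = 0)"

lemma test1_deriv:
  assumes "test1 a"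
  obtains a' where "\<And>x. (a has_vector_derivative a' x) (at x)" "test1 a'"
proof -
  have "C_diff (Suc 0) a" using assms by (auto simp only: test1_def)
  then obtain a' where a': "\<And>x. (a has_vector_derivative a' x) (at x)" by auto
  obtain M where M: "\<And>x. \<bar>x\<bar> > M \<Longrightarrow> a x = 0" using assms by (auto simp: test1_def)
  \<comment> \<open>\<open>C_diff\<close> may supply a different derivative for each n; uniqueness
    of derivatives identifies them all with a'.\<close>
  have "C_diff n a'" for n
  proof -
    have "C_diff (Suc n) a" using assms by (auto simp only: test1_def)
    then obtain b where b: "\<And>x. (a has_vector_derivative b x) (at x)" "C_diff n b" by auto
    have "a' = b" by (rule ext) (rule vector_derivative_unique_at[OF a' b(1)])
    then show ?thesis using b by simp
  qed
  moreover have "a' x = 0" if "\<bar>x\<bar> > M" for x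
  proof -
    have "((\<lambda>x. 0) has_vector_derivative a' x) (at x)"
      by (rule has_vector_derivative_transform_within_open[OF a', where S = "{x. M < \<bar>x\<bar>}"])
         (use that M in \<open>auto intro!: open_Collect_less continuous_intros\<close>)
    then show ?thesis using vector_derivative_unique_at has_vector_derivative_const by blast
  qed
  ultimately have "test1 a'" by (auto simp: test1_def)
  then show ?thesis using a' that by blast
qed

lemma test1_continuous: "test1 a \<Longrightarrow> continuous_on A a"
  using C_diff.simps(1)[of a] by (auto simp: test1_def simp del: C_diff.simps intro: continuous_on_subset)

lemma test1_measurable [measurable_dest]: "test1 a \<Longrightarrow> a \<in> borel_measurable borel"
  using test1_continuous borel_measurable_continuous_onI by blast

lemma test1_bounded:
  assumes a: "test1 a" obtains B where "\<And>x. cmod (a x) \<le> B"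
proof -
  obtain M where M: "\<And>x. \<bar>x\<bar> > M \<Longrightarrow> a x = 0" using a by (auto simp: test1_def)
  have "bounded (a ` {-M..M})"
    by (intro compact_imp_bounded compact_continuous_image test1_continuous a) auto
  then obtain B where B: "\<And>x. x \<in> {-M..M} \<Longrightarrow> cmod (a x) \<le> B" unfolding bounded_iff by blast
  have "cmod (a x) \<le> \<bar>B\<bar>" for x
  proof (cases "\<bar>x\<bar> > M")
    case False
    then have "cmod (a x) \<le> B" by (intro B) auto
    then show ?thesis by linarith
  qed (use M in auto)
  then show ?thesis using that by blast
qed

lemma integrable_compact_support:
  fixes a :: "real \<Rightarrow> complex"
  assumes "continuous_on UNIV a" and M: "\<And>x. \<bar>x\<bar> > M \<Longrightarrow> a x = 0"
  shows "integrable lborel a"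
proof -
  have "integrable lborel (\<lambda>x. indicator {-M..M} x *\<^sub>R a x)"
    using assms by (intro borel_integrable_compact) (auto intro: continuous_on_subset)
  moreover have "(\<lambda>x. indicator {-M..M} x *\<^sub>R a x) = a"
  proof
    fix x show "indicator {-M..M} x *\<^sub>R a x = a x"
      using M[of x] by (cases "\<bar>x\<bar> > M") (auto simp: indicator_def)
  qed
  ultimately show ?thesis by simp
qed

lemma test1_integrable: "test1 a \<Longrightarrow> integrable lborel a"
  using integrable_compact_support test1_continuous[of a UNIV] by (auto simp: test1_def)

lemma test1_mult: "test1 a \<Longrightarrow> (\<And>n. C_diff n b) \<Longrightarrow> test1 (\<lambda>x. a x * b x)"
  unfolding test1_def by (metis C_diff_mult mult_zero_left)

lemma test1_affine:
  assumes "test1 a" "p \<noteq> 0" shows "test1 (\<lambda>x. a (p * x + q))"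
proof -
  obtain M where M: "\<And>x. \<bar>x\<bar> > M \<Longrightarrow> a x = 0" using assms by (auto simp: test1_def)
  have "a (p * x + q) = 0" if "\<bar>x\<bar> > (\<bar>M\<bar> + \<bar>q\<bar>) / \<bar>p\<bar>" for x
  proof (rule M)
    have "\<bar>p * x\<bar> > \<bar>M\<bar> + \<bar>q\<bar>" using that assms(2) by (simp add: abs_mult divide_less_eq mult.commute)
    then show "\<bar>p * x + q\<bar> > M" by linarith
  qed
  then show ?thesis using assms C_diff_affine[of _ a p q] unfolding test1_def by blast
qed

text \<open>Normalised at 0, so that the dilates bump (e x) tend to 1 as e tends to 0 and serve as
  cutoffs.\<close>

definition bump :: "real \<Rightarrow> real" where
  "bump x = flat 1 (1 + x) * flat 1 (1 - x) / (flat 1 1)\<^sup>2"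

lemma bump_props: "bump 0 = 1" "bump x \<ge> 0" "bump (- x) = bump x" "\<bar>x\<bar> > 1 \<Longrightarrow> bump x = 0"
  by (auto simp: bump_def flat_def power2_eq_square)

lemma test1_bump: "test1 (\<lambda>x. of_real (bump x))"
proof -
  have "C_diff n (\<lambda>x. of_real (flat 1 (1 * x + 1)) * of_real (flat 1 ((- 1) * x + 1)) * of_real (1 / (flat 1 1)\<^sup>2))" for n
    by (intro C_diff_mult C_diff_const C_diff_affine[OF C_diff_flat])
  then have "C_diff n (\<lambda>x. of_real (bump x))" for n
    by (simp add: bump_def add.commute)
  then show ?thesis using bump_props(4) by (auto simp: test1_def)
qed

section \<open>The Fourier transform on the line\<close>

definition ft1 :: "(real \<Rightarrow> complex) \<Rightarrow> real \<Rightarrow> complex" where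
  "ft1 a x = (LINT \<xi>|lborel. a \<xi> * exp (- \<i> * of_real (x * \<xi>)))"

lemma integrable_times_unimodular:
  fixes a :: "'a \<Rightarrow> complex"
  assumes "integrable M a" "b \<in> borel_measurable M" "\<And>x. cmod (b x) = 1"
  shows "integrable M (\<lambda>x. a x * b x)"
  by (rule integrable_dominated[OF integrable_norm[OF assms(1)]]) (use assms in \<open>auto simp: norm_mult\<close>)

lemma test1_deriv_integral:
  assumes a: "test1 a" and a': "\<And>x. (a has_vector_derivative a' x) (at x)" and "test1 a'"
  shows "(LINT x|lborel. a' x) = 0"
proof -
  obtain M where M: "\<And>x. \<bar>x\<bar> > M \<Longrightarrow> a x = 0" using a by (auto simp: test1_def)
  obtain M' where M': "\<And>x. \<bar>x\<bar> > M' \<Longrightarrow> a' x = 0" using assms(3) by (auto simp: test1_def)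
  \<comment> \<open>Beyond both supports: truncating the integral to this interval changes nothing,
    and both boundary values vanish.\<close>
  define N where "N = \<bar>M\<bar> + \<bar>M'\<bar> + 1"
  have "(LINT x|lborel. a' x) = (LINT x|lborel. indicator {-N..N} x *\<^sub>R a' x)"
    using M' by (intro Bochner_Integration.integral_cong) (auto simp: indicator_def N_def)
  also have "\<dots> = a N - a (- N)"
    by (rule integral_FTC_Icc) (auto simp: N_def intro: has_vector_derivative_at_within a' test1_continuous assms)
  also have "\<dots> = 0" using M[of N] M[of "-N"] by (auto simp: N_def)
  finally show ?thesis .
qed

text \<open>Integration by parts: the product of a with the exponential is again a test function, so
  its derivative integrates to 0.\<close>

lemma ft1_deriv:
  assumes a: "test1 a" and a': "\<And>x. (a has_vector_derivative a' x) (at x)" and t: "test1 a'"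
  shows "ft1 a' x = \<i> * of_real x * ft1 a x"
proof -
  let ?e = "\<lambda>\<xi>. exp (\<i> * of_real ((- x) * \<xi>))"
  have t1: "test1 (\<lambda>\<xi>. a \<xi> * ?e \<xi>)" "test1 (\<lambda>\<xi>. a' \<xi> * ?e \<xi>)"
    using a t by (intro test1_mult, simp_all only: C_diff_cis)+
  have d: "((\<lambda>\<xi>. a \<xi> * ?e \<xi>) has_vector_derivative (a \<xi> * ((- \<i> * of_real x) * ?e \<xi>) + a' \<xi> * ?e \<xi>)) (at \<xi>)" for \<xi>
    using has_vector_derivative_mult[OF a'[of \<xi>] has_vector_derivative_cis[of "- x" \<xi>]] by simp
  obtain b where b: "\<And>\<xi>. ((\<lambda>\<xi>. a \<xi> * ?e \<xi>) has_vector_derivative b \<xi>) (at \<xi>)" "test1 b"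
    using test1_deriv[OF t1(1)] by blast
  have beq: "b = (\<lambda>\<xi>. a' \<xi> * ?e \<xi> - \<i> * of_real x * (a \<xi> * ?e \<xi>))"
    by (rule ext) (use vector_derivative_unique_at[OF b(1) d] in simp)
  have "0 = (LINT \<xi>|lborel. b \<xi>)" using test1_deriv_integral[OF t1(1) b] by simp
  also have "\<dots> = (LINT \<xi>|lborel. a' \<xi> * ?e \<xi>) - \<i> * of_real x * (LINT \<xi>|lborel. a \<xi> * ?e \<xi>)"
    unfolding beq using t1[THEN test1_integrable] by simp
  finally show ?thesis by (simp add: ft1_def)
qed

text \<open>One more factor 1 + |x| is paid for by the transform of a', since |x| times
  |\<open>ft1 a x\<close>| is |\<open>ft1 a' x\<close>|.\<close>

lemma ft1_decay:
  assumes "test1 a" shows "\<exists>C. \<forall>x. cmod (ft1 a x) * (1 + \<bar>x\<bar>) ^ k \<le> C"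
  using assms
proof (induction k arbitrary: a)
  case 0
  have "cmod (ft1 a x) \<le> (LINT \<xi>|lborel. cmod (a \<xi> * exp (- \<i> * of_real (x * \<xi>))))" for x
    unfolding ft1_def by (rule integral_norm_bound)
  then show ?case by (auto simp: norm_mult)
next
  case (Suc k)
  obtain a' where a': "\<And>x. (a has_vector_derivative a' x) (at x)" "test1 a'" using test1_deriv[OF Suc.prems] by blast
  obtain C C' where C: "\<And>x. cmod (ft1 a x) * (1 + \<bar>x\<bar>) ^ k \<le> C" "\<And>x. cmod (ft1 a' x) * (1 + \<bar>x\<bar>) ^ k \<le> C'"
    using Suc.IH[OF Suc.prems] Suc.IH[OF a'(2)] by blast
  have "cmod (ft1 a x) * (1 + \<bar>x\<bar>) ^ Suc k \<le> C + C'" for x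
  proof -
    have "cmod (ft1 a x) * (1 + \<bar>x\<bar>) ^ Suc k = cmod (ft1 a x) * (1 + \<bar>x\<bar>) ^ k + cmod (ft1 a' x) * (1 + \<bar>x\<bar>) ^ k"
      unfolding ft1_deriv[OF Suc.prems a'] by (simp add: norm_mult algebra_simps)
    then show ?thesis using C[of x] by linarith
  qed
  then show ?case by blast
qed

lemma ft1_continuous: assumes "test1 a" shows "continuous_on UNIV (ft1 a)"
proof (rule continuous_on_sequentiallyI)
  have [measurable]: "a \<in> borel_measurable borel" using assms by measurable
  fix u :: "nat \<Rightarrow> real" and x assume u: "u \<longlonglongrightarrow> x"
  show "(\<lambda>n. ft1 a (u n)) \<longlonglongrightarrow> ft1 a x"
    unfolding ft1_def
  proof (rule integral_dominated_convergence[where w = "\<lambda>\<xi>. cmod (a \<xi>)"])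
    show "AE \<xi> in lborel. (\<lambda>n. a \<xi> * exp (- \<i> * of_real (u n * \<xi>))) \<longlonglongrightarrow> a \<xi> * exp (- \<i> * of_real (x * \<xi>))"
      using u by (intro AE_I2 tendsto_intros)
  qed (use test1_integrable[OF assms] in \<open>auto simp: norm_mult\<close>)
qed

lemma ft1_measurable [measurable]: "test1 a \<Longrightarrow> ft1 a \<in> borel_measurable borel"
  by (rule borel_measurable_continuous_onI[OF ft1_continuous])

text \<open>Dilation and modulation together, as needed for cutoffs centred at an arbitrary point; e
  = -1 and w = 0 give the reflection rule.\<close>

lemma ft1_modulated:
  assumes "test1 a" "e \<noteq> 0"
  shows "ft1 (\<lambda>\<xi>. a (e * \<xi>) * exp (\<i> * of_real (w * \<xi>))) x = of_real (1 / \<bar>e\<bar>) * ft1 a ((x - w) / e)"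
proof -
  let ?h = "\<lambda>\<xi>. a \<xi> * exp (- \<i> * of_real ((x - w) / e * \<xi>))"
  have "a (e * \<xi>) * exp (\<i> * of_real (w * \<xi>)) * exp (- \<i> * of_real (x * \<xi>)) = ?h (0 + e * \<xi>)" for \<xi>
  proof -
    have "(x - w) / e * (0 + e * \<xi>) = x * \<xi> - w * \<xi>" using assms(2) by (simp add: field_simps)
    then show ?thesis by (simp add: mult.assoc exp_add[symmetric] right_diff_distrib)
  qed
  then have "ft1 (\<lambda>\<xi>. a (e * \<xi>) * exp (\<i> * of_real (w * \<xi>))) x = (LINT \<xi>|lborel. ?h (0 + e * \<xi>))"
    by (simp only: ft1_def)
  moreover have "ft1 a ((x - w) / e) = \<bar>e\<bar> *\<^sub>R (LINT \<xi>|lborel. ?h (0 + e * \<xi>))"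
    unfolding ft1_def by (rule lborel_integral_real_affine[OF assms(2)])
  ultimately show ?thesis using assms(2) by (simp add: scaleR_conv_of_real)
qed

lemma integrable_poly_weight: "integrable lborel (\<lambda>x::real. 1 / (1 + \<bar>x\<bar>)\<^sup>2)"
proof (rule integrable_dominated)
  have "set_integrable lborel (einterval (-\<infinity>) \<infinity>) (\<lambda>x. inverse (1 + x\<^sup>2))"
    using integrable_inverse_1_plus_square by simp
  then show "integrable lborel (\<lambda>x::real. inverse (1 + x\<^sup>2))"
    by (simp add: set_integrable_def)
  show "norm (1 / (1 + \<bar>x\<bar>)\<^sup>2) \<le> inverse (1 + x\<^sup>2)" for x :: real
    by (auto intro!: frac_le add_pos_nonneg simp: inverse_eq_divide power2_sum)
qed auto

lemma ft1_integrable: assumes "test1 a" shows "integrable lborel (ft1 a)"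
proof -
  obtain C where C: "\<And>x. cmod (ft1 a x) * (1 + \<bar>x\<bar>) ^ 2 \<le> C" using ft1_decay[OF assms] by blast
  show ?thesis
  proof (rule integrable_dominated)
    show "integrable lborel (\<lambda>x::real. C * (1 / (1 + \<bar>x\<bar>)\<^sup>2))"
      by (intro integrable_mult_right integrable_poly_weight)
    show "cmod (ft1 a x) \<le> C * (1 / (1 + \<bar>x\<bar>)\<^sup>2)" for x
      using C[of x] by (simp add: field_simps)
  qed (use assms in measurable)
qed

lemma gaussian_integrable: "integrable lborel (\<lambda>v::real. exp (- v\<^sup>2 / 2))"
proof -
  have "integrable lborel (\<lambda>v. sqrt (2 * pi) * std_normal_density v)" by simp
  then show ?thesis by (simp add: std_normal_density_def)
qed

lemma gaussian_fourier:
  "(LINT v|lborel. of_real (exp (- v\<^sup>2 / 2)) * exp (- \<i> * of_real (t * v))) = of_real (sqrt (2 * pi) * exp (- t\<^sup>2 / 2))"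
proof -
  have "complex_of_real (exp (- t\<^sup>2 / 2)) = char std_normal_distribution (- t)"
    by (simp add: char_std_normal_distribution)
  also have "\<dots> = (LINT v|lborel. std_normal_density v *\<^sub>R exp (\<i> * of_real ((- t) * v)))"
    unfolding char_def by (subst integral_density) (auto simp: normal_density_nonneg)
  also have "\<dots> = of_real (1 / sqrt (2 * pi)) * (LINT v|lborel. of_real (exp (- v\<^sup>2 / 2)) * exp (- \<i> * of_real (t * v)))"
    by (subst integral_mult_right_zero[symmetric])
       (simp add: std_normal_density_def scaleR_conv_of_real mult.assoc)
  finally have "of_real (sqrt (2 * pi)) * complex_of_real (exp (- t\<^sup>2 / 2)) = of_real (sqrt (2 * pi)) * (of_real (1 / sqrt (2 * pi)) * (LINT v|lborel. of_real (exp (- v\<^sup>2 / 2)) * exp (- \<i> * of_real (t * v))))"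
    by simp
  then show ?thesis by (simp flip: mult.assoc of_real_mult)
qed

text \<open>Fourier inversion at the origin. The damping factor g(x/m) allows the order of
  integration to be exchanged, its transform is a Gaussian concentrating at 0, and dominated
  convergence removes the damping on both sides.\<close>

lemma ft1_integral:
  assumes a: "test1 a" shows "(LINT x|lborel. ft1 a x) = of_real (2 * pi) * a 0"
proof -
  have [measurable]: "a \<in> borel_measurable borel" "ft1 a \<in> borel_measurable borel" using a by measurable
  define g where "g v = exp (- v\<^sup>2 / 2)" for v :: real
  have [measurable]: "g \<in> borel_measurable borel" by (simp add: g_def[abs_def])
  have g: "integrable lborel g" unfolding g_def by (rule gaussian_integrable)
  define I where "I n = (LINT x|lborel. ft1 a x * of_real (g (x / real (Suc n))))" for n
  have lim: "(\<lambda>n. x / real (Suc n)) \<longlonglongrightarrow> 0" for x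
    using LIMSEQ_inverse_real_of_nat tendsto_mult_right_zero[of _ _ x] by (simp add: divide_inverse)
  have l1: "I \<longlonglongrightarrow> (LINT x|lborel. ft1 a x)"
    unfolding I_def
  proof (rule integral_dominated_convergence[where w = "\<lambda>x. cmod (ft1 a x)"])
    show "AE x in lborel. (\<lambda>n. ft1 a x * of_real (g (x / real (Suc n)))) \<longlonglongrightarrow> ft1 a x"
    proof (rule AE_I2)
      fix x
      have "(\<lambda>n. ft1 a x * of_real (g (x / real (Suc n)))) \<longlonglongrightarrow> ft1 a x * of_real (exp (- 0\<^sup>2 / 2))"
        unfolding g_def by (intro tendsto_intros lim) auto
      then show "(\<lambda>n. ft1 a x * of_real (g (x / real (Suc n)))) \<longlonglongrightarrow> ft1 a x" by simp
    qed
  qed (use ft1_integrable[OF a] in \<open>auto simp: norm_mult g_def mult_left_le\<close>)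
  \<comment> \<open>After Fubini the inner integral is the Gaussian transform at scale m = n + 1;
    rescaling moves the parameter into the argument of a.\<close>
  have Ieq: "I n = of_real (sqrt (2 * pi)) * (LINT v|lborel. a (v / real (Suc n)) * of_real (g v))" for n
  proof -
    define m where "m = real (Suc n)"
    have m: "m > 0" by (simp add: m_def)
    have gm: "integrable lborel (\<lambda>x. g (x / m))"
      using lborel_integrable_real_affine[OF g, of "1/m" 0] m by simp
    have "I n = (LINT x|lborel. (LINT \<xi>|lborel. a \<xi> * exp (- \<i> * of_real (x * \<xi>)) * of_real (g (x / m))))"
      unfolding I_def ft1_def m_def by simp
    also have "\<dots> = (LINT \<xi>|lborel. (LINT x|lborel. a \<xi> * exp (- \<i> * of_real (x * \<xi>)) * of_real (g (x / m))))"
    proof (rule lborel_pair.Fubini_integral[symmetric])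
      show "integrable (lborel \<Otimes>\<^sub>M lborel) (\<lambda>(x, \<xi>). a \<xi> * exp (- \<i> * of_real (x * \<xi>)) * of_real (g (x / m)))"
      proof (rule lborel_pair.Fubini_integrable)
        have "(\<lambda>x. LINT \<xi>|lborel. cmod (a \<xi> * exp (- \<i> * of_real (x * \<xi>)) * of_real (g (x / m))))
            = (\<lambda>x. (LINT \<xi>|lborel. cmod (a \<xi>)) * g (x / m))"
          by (auto simp: norm_mult g_def)
        then show "integrable lborel (\<lambda>x. LINT \<xi>|lborel. cmod (case (x, \<xi>) of (x, \<xi>) \<Rightarrow> a \<xi> * exp (- \<i> * of_real (x * \<xi>)) * of_real (g (x / m))))"
          using gm by simp
        show "AE x in lborel. integrable lborel (\<lambda>\<xi>. case (x, \<xi>) of (x, \<xi>) \<Rightarrow> a \<xi> * exp (- \<i> * of_real (x * \<xi>)) * of_real (g (x / m)))"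
          using test1_integrable[OF a] 
          by (simp only: prod.case) (intro AE_I2 integrable_mult_left integrable_times_unimodular, auto)
      qed measurable
    qed
    also have "\<dots> = (LINT \<xi>|lborel. a \<xi> * (of_real m * of_real (sqrt (2 * pi) * g (m * \<xi>))))"
    proof (intro Bochner_Integration.integral_cong refl)
      fix \<xi>
      have "(LINT x|lborel. a \<xi> * exp (- \<i> * of_real (x * \<xi>)) * of_real (g (x / m)))
        = a \<xi> * (LINT x|lborel. of_real (g (x / m)) * exp (- \<i> * of_real (x * \<xi>)))"
        by (subst integral_mult_right_zero[symmetric]) (simp add: mult_ac)
      also have "(LINT x|lborel. of_real (g (x / m)) * exp (- \<i> * of_real (x * \<xi>)))
         = of_real m * (LINT v|lborel. of_real (g v) * exp (- \<i> * of_real ((m * \<xi>) * v)))"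
        using m by (subst lborel_integral_real_affine[of m _ 0]) (auto simp: scaleR_conv_of_real mult_ac)
      also have "(LINT v|lborel. of_real (g v) * exp (- \<i> * of_real ((m * \<xi>) * v))) = of_real (sqrt (2 * pi) * g (m * \<xi>))"
        unfolding g_def by (rule gaussian_fourier)
      finally show "(LINT x|lborel. a \<xi> * exp (- \<i> * of_real (x * \<xi>)) * of_real (g (x / m))) = a \<xi> * (of_real m * of_real (sqrt (2 * pi) * g (m * \<xi>)))" .
    qed
    also have "\<dots> = of_real (sqrt (2 * pi)) * (LINT v|lborel. a (v / m) * of_real (g v))"
      using m by (subst lborel_integral_real_affine[of "1 / m" _ 0])
        (auto simp: scaleR_conv_of_real mult_ac simp flip: integral_mult_right_zero)
    finally show ?thesis by (simp only: m_def)
  qed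
  have "(\<lambda>n. of_real (sqrt (2 * pi)) * (LINT v|lborel. a (v / real (Suc n)) * of_real (g v)))
     \<longlonglongrightarrow> of_real (sqrt (2 * pi)) * (LINT v|lborel. a 0 * of_real (g v))"
  proof (intro tendsto_mult tendsto_const)
    obtain B where B: "\<And>x. cmod (a x) \<le> B" using test1_bounded[OF a] by blast
    show "(\<lambda>n. LINT v|lborel. a (v / real (Suc n)) * of_real (g v)) \<longlonglongrightarrow> (LINT v|lborel. a 0 * of_real (g v))"
    proof (rule integral_dominated_convergence[where w = "\<lambda>v. B * g v"])
      show "AE v in lborel. (\<lambda>n. a (v / real (Suc n)) * of_real (g v)) \<longlonglongrightarrow> a 0 * of_real (g v)"
      proof (rule AE_I2)
        fix v
        have "(\<lambda>n. a (v / real (Suc n))) \<longlonglongrightarrow> a 0"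
          by (rule continuous_on_tendsto_compose[OF test1_continuous[OF a, of UNIV] lim]) auto
        then show "(\<lambda>n. a (v / real (Suc n)) * of_real (g v)) \<longlonglongrightarrow> a 0 * of_real (g v)"
          by (rule tendsto_mult_right)
      qed
      show "AE v in lborel. norm (a (v / real (Suc n)) * of_real (g v)) \<le> B * g v" for n
        using B by (auto intro!: AE_I2 mult_right_mono simp: norm_mult g_def)
    qed (use g in auto)
  qed
  then have "(\<lambda>n. I n) \<longlonglongrightarrow> of_real (sqrt (2 * pi)) * (LINT v|lborel. a 0 * of_real (g v))"
    by (simp only: Ieq)
  then have l2: "I \<longlonglongrightarrow> of_real (sqrt (2 * pi)) * (LINT v|lborel. a 0 * of_real (g v))" .
  have "(LINT v|lborel. of_real (g v)) = complex_of_real (sqrt (2 * pi))"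
    using gaussian_fourier[of 0] by (simp add: g_def)
  then have "(LINT v|lborel. a 0 * of_real (g v)) = a 0 * of_real (sqrt (2 * pi))" by simp
  then have "of_real (sqrt (2 * pi)) * (LINT v|lborel. a 0 * of_real (g v)) = of_real (sqrt (2 * pi) * sqrt (2 * pi)) * a 0"
    by (simp only: of_real_mult mult_ac)
  also have "sqrt (2 * pi) * sqrt (2 * pi) = 2 * pi" by simp
  finally have "of_real (sqrt (2 * pi)) * (LINT v|lborel. a 0 * of_real (g v)) = of_real (2 * pi) * a 0" .
  with LIMSEQ_unique[OF l1 l2] show ?thesis by simp
qed

section \<open>Tensor test functions and \<open>L\<^sup>2\<close> transforms\<close>

text \<open>Smoothness quantifies over all lists of partial derivatives. A set of functions closed
  under both partials reduces this to checking one derivative at a time.\<close>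

lemma smooth2_coinduct:
  assumes "f \<in> S"
    and S: "\<And>g. g \<in> S \<Longrightarrow> continuous_on UNIV g \<and> (\<forall>z. (\<lambda>t. g (t, snd z)) differentiable (at (fst z)) \<and>
          (\<lambda>t. g (fst z, t)) differentiable (at (snd z))) \<and> pdx g \<in> S \<and> pdy g \<in> S"
  shows "smooth2 f"
proof -
  have "iter_partial ds g \<in> S" if "g \<in> S" for ds g
    using that
  proof (induction ds arbitrary: g)
    case (Cons d ds)
    have "iter_partial (d # ds) g = iter_partial ds (if d then pdx g else pdy g)"
      by (simp add: iter_partial_def)
    then show ?case using Cons.IH[of "pdx g"] Cons.IH[of "pdy g"] S[OF Cons.prems] by auto
  qed (simp add: iter_partial_def)
  then show ?thesis using S assms(1) unfolding smooth2_def by blast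
qed

definition tens :: "(real \<Rightarrow> complex) \<Rightarrow> (real \<Rightarrow> complex) \<Rightarrow> real \<times> real \<Rightarrow> complex" where
  "tens a b z = a (fst z) * b (snd z)"

lemma tens_measurable [measurable]:
  assumes [measurable]: "a \<in> borel_measurable borel" "b \<in> borel_measurable borel"
  shows "tens a b \<in> borel_measurable borel"
  unfolding tens_def[abs_def] borel_prod[symmetric] by measurable

lemma Re_tens_derivs:
  assumes "\<And>x. (a has_vector_derivative a' x) (at x)"
  shows "((\<lambda>t. Re (tens a b (t, y))) has_real_derivative Re (tens a' b (x, y))) (at x)"
    and "((\<lambda>t. Re (tens b a (y, t))) has_real_derivative Re (tens b a' (y, x))) (at x)"
  unfolding has_real_derivative_iff_has_vector_derivative tens_def fst_conv snd_conv
  by (intro bounded_linear.has_vector_derivative[OF bounded_linear_Re]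
      has_vector_derivative_mult_left has_vector_derivative_mult_right assms)+

lemma pd_Re_tens:
  assumes "\<And>x. (a has_vector_derivative a' x) (at x)"
  shows "pdx (\<lambda>z. Re (tens a b z)) = (\<lambda>z. Re (tens a' b z))"
    and "pdy (\<lambda>z. Re (tens b a z)) = (\<lambda>z. Re (tens b a' z))"
  unfolding pdx_def pdy_def using Re_tens_derivs[OF assms, THEN DERIV_imp_deriv] by auto

text \<open>The real parts of tensors of test functions are closed under both partials, because each
  partial differentiates one factor only.\<close>

lemma test_fn_Re_tens:
  assumes "test1 a" "test1 b"
  shows "test_fn (\<lambda>z. Re (tens a b z))"
proof -
  let ?S = "{\<lambda>z. Re (tens a b z) | a b. test1 a \<and> test1 b}"
  have "smooth2 (\<lambda>z. Re (tens a b z))"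
  proof (rule smooth2_coinduct[of _ ?S])
    show "(\<lambda>z. Re (tens a b z)) \<in> ?S" using assms by blast
    fix g assume "g \<in> ?S"
    then obtain a b where g: "g = (\<lambda>z. Re (tens a b z))" and t: "test1 a" "test1 b" by blast
    obtain a' where a': "\<And>x. (a has_vector_derivative a' x) (at x)" "test1 a'" using test1_deriv[OF t(1)] by blast
    obtain b' where b': "\<And>x. (b has_vector_derivative b' x) (at x)" "test1 b'" using test1_deriv[OF t(2)] by blast
    have "continuous_on UNIV g" unfolding g tens_def
      by (intro continuous_intros continuous_on_compose2[OF test1_continuous[OF t(1), of UNIV]]
          continuous_on_compose2[OF test1_continuous[OF t(2), of UNIV]]) auto
    moreover have "pdx g \<in> ?S" "pdy g \<in> ?S"
      using pd_Re_tens(1)[OF a'(1), of b] pd_Re_tens(2)[OF b'(1), of a] a' b' t unfolding g by blast+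
    moreover have "(\<lambda>t. g (t, snd z)) differentiable (at (fst z))" "(\<lambda>t. g (fst z, t)) differentiable (at (snd z))" for z
      unfolding g using Re_tens_derivs[OF a'(1)] Re_tens_derivs[OF b'(1)] real_differentiable_def by blast+
    ultimately show "continuous_on UNIV g \<and> (\<forall>z. (\<lambda>t. g (t, snd z)) differentiable (at (fst z)) \<and>
          (\<lambda>t. g (fst z, t)) differentiable (at (snd z))) \<and> pdx g \<in> ?S \<and> pdy g \<in> ?S" by blast
  qed
  moreover have "bounded {z. Re (tens a b z) \<noteq> 0}"
  proof -
    obtain M where M: "\<And>x. \<bar>x\<bar> > M \<Longrightarrow> a x = 0" using assms(1) by (auto simp: test1_def)
    obtain N where N: "\<And>x. \<bar>x\<bar> > N \<Longrightarrow> b x = 0" using assms(2) by (auto simp: test1_def)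
    have "{z. Re (tens a b z) \<noteq> 0} \<subseteq> {-M..M} \<times> {-N..N}"
    proof
      fix z assume "z \<in> {z. Re (tens a b z) \<noteq> 0}"
      then have "a (fst z) \<noteq> 0" "b (snd z) \<noteq> 0" by (auto simp: tens_def)
      then have "\<not> \<bar>fst z\<bar> > M" "\<not> \<bar>snd z\<bar> > N" using M N by blast+
      then show "z \<in> {-M..M} \<times> {-N..N}" by (cases z) auto
    qed
    then show ?thesis by (rule bounded_subset[rotated]) (intro bounded_Times bounded_closed_interval)
  qed
  ultimately show ?thesis by (simp add: test_fn_def)
qed

lemma tens_integral:
  assumes "integrable lborel a" "integrable lborel b"
  shows "integrable lborel (tens a b)" "(LINT z|lborel. tens a b z) = (LINT x|lborel. a x) * (LINT y|lborel. b y)"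
proof -
  have [measurable]: "a \<in> borel_measurable borel" "b \<in> borel_measurable borel" using assms by auto
  have i: "integrable (lborel \<Otimes>\<^sub>M lborel) (\<lambda>(x, y). a x * b y)"
    by (rule lborel_pair.Fubini_integrable) (use assms in \<open>auto simp: norm_mult\<close>)
  have eq: "(\<lambda>(x, y). a x * b y) = tens a b" by (auto simp: tens_def)
  show "integrable lborel (tens a b)" using i unfolding eq lborel_prod .
  show "(LINT z|lborel. tens a b z) = (LINT x|lborel. a x) * (LINT y|lborel. b y)"
    using lborel_pair.integral_fst[OF i] unfolding eq lborel_prod by simp
qed

lemma inner_real2: "(z::real \<times> real) \<bullet> \<zeta> = fst z * fst \<zeta> + snd z * snd \<zeta>"
  by (simp add: inner_prod_def)

lemma iexp_tens: "iexp (z \<bullet> \<zeta>) = tens (\<lambda>x. iexp (fst z * x)) (\<lambda>y. iexp (snd z * y)) \<zeta>"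
  by (simp add: tens_def inner_real2 exp_add[symmetric] algebra_simps)

lemma tens_mult: "tens a b z * tens c d z = tens (\<lambda>x. a x * c x) (\<lambda>y. b y * d y) z"
  by (simp add: tens_def mult_ac)

lemma test1_iexp: "test1 a \<Longrightarrow> test1 (\<lambda>x. a x * iexp (w * x))"
  by (rule test1_mult[OF _ C_diff_cis])

text \<open>Unnormalised: inversion and Parseval carry the factor 1 / (4 pi^2) explicitly.\<close>

definition inv_ft :: "(real \<times> real \<Rightarrow> complex) \<Rightarrow> real \<times> real \<Rightarrow> complex" where
  "inv_ft u \<zeta> = (LINT z|lborel. u z * iexp (z \<bullet> \<zeta>))"

lemma iexp_inner_measurable [measurable (raw)]:
  assumes "f \<in> borel_measurable M" "g \<in> borel_measurable M"
  shows "(\<lambda>x. iexp (f x \<bullet> (g x :: real \<times> real))) \<in> borel_measurable M"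
  using assms by measurable

lemma inv_ft_tens:
  assumes "integrable lborel a" "integrable lborel b"
  shows "inv_ft (tens a b) \<zeta> = ft1 a (- fst \<zeta>) * ft1 b (- snd \<zeta>)"
proof -
  have "inv_ft (tens a b) \<zeta> = (LINT z|lborel. tens (\<lambda>x. a x * iexp (fst \<zeta> * x)) (\<lambda>y. b y * iexp (snd \<zeta> * y)) z)"
    unfolding inv_ft_def by (subst inner_commute, subst iexp_tens, subst tens_mult) rule
  also have "\<dots> = (LINT x|lborel. a x * iexp (fst \<zeta> * x)) * (LINT y|lborel. b y * iexp (snd \<zeta> * y))"
    using assms by (intro tens_integral integrable_times_unimodular) auto
  finally show ?thesis by (simp add: ft1_def)
qed

lemma ft_Re_tens:
  assumes "integrable lborel a" "integrable lborel b" and "\<And>x. Im (a x) = 0" "\<And>x. Im (b x) = 0"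
  shows "ft (\<lambda>z. Re (tens a b z)) = tens (ft1 a) (ft1 b)"
proof
  fix \<zeta>
  have "complex_of_real (Re (tens a b z)) = tens a b z" for z
    using assms by (simp add: tens_def complex_eq_iff)
  then have "ft (\<lambda>z. Re (tens a b z)) \<zeta> = inv_ft (tens a b) (- \<zeta>)"
    by (simp add: ft_def inv_ft_def)
  then show "ft (\<lambda>z. Re (tens a b z)) \<zeta> = tens (ft1 a) (ft1 b) \<zeta>"
    using inv_ft_tens[OF assms(1,2), of "- \<zeta>"] by (simp add: tens_def)
qed

text \<open>Transforms of test functions decay faster than any power. Order m + 2 in each variable
  absorbs W and leaves a product of integrable weights bounded by 1; a bounded integrable function
  is also square integrable.\<close>

lemma test_ft_weighted:
  fixes W :: "real \<times> real \<Rightarrow> complex"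
  assumes "test1 a" "test1 b" and [measurable]: "W \<in> borel_measurable borel"
    and W: "\<And>\<zeta>. cmod (W \<zeta>) \<le> c * ((1 + \<bar>fst \<zeta>\<bar>) ^ m * (1 + \<bar>snd \<zeta>\<bar>) ^ m)"
  shows "integrable lborel (\<lambda>\<zeta>. W \<zeta> * tens (ft1 a) (ft1 b) \<zeta>)"
    and "integrable lborel (\<lambda>\<zeta>. (cmod (W \<zeta> * tens (ft1 a) (ft1 b) \<zeta>))\<^sup>2)"
    and "\<exists>B. \<forall>\<zeta>. cmod (W \<zeta> * tens (ft1 a) (ft1 b) \<zeta>) \<le> B"
proof -
  have [measurable]: "ft1 a \<in> borel_measurable borel" "ft1 b \<in> borel_measurable borel" using assms by measurable
  let ?w = "\<lambda>x::real. complex_of_real (1 / (1 + \<bar>x\<bar>)\<^sup>2)"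
  have iw: "integrable lborel (tens ?w ?w)"
    using integrable_poly_weight by (intro tens_integral integrable_of_real)
  obtain A where A: "\<And>x. cmod (ft1 a x) * (1 + \<bar>x\<bar>) ^ (m + 2) \<le> A" using ft1_decay[OF assms(1)] by blast
  obtain B where B: "\<And>x. cmod (ft1 b x) * (1 + \<bar>x\<bar>) ^ (m + 2) \<le> B" using ft1_decay[OF assms(2)] by blast
  have A0: "A \<ge> 0" using order_trans[OF _ A[of 0]] by simp
  have B0: "B \<ge> 0" using order_trans[OF _ B[of 0]] by simp
  have c0: "c \<ge> 0" using order_trans[OF norm_ge_zero W[of 0]] by simp
  define K where "K = c * (A * B)"
  have K0: "K \<ge> 0" using A0 B0 c0 by (simp add: K_def)
  have le: "cmod (W \<zeta> * tens (ft1 a) (ft1 b) \<zeta>) \<le> K * cmod (tens ?w ?w \<zeta>)" for \<zeta>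
  proof -
    obtain x y where z: "\<zeta> = (x, y)" by (cases \<zeta>)
    have a: "cmod (ft1 a x) * (1 + \<bar>x\<bar>) ^ m \<le> A * (1 / (1 + \<bar>x\<bar>)\<^sup>2)"
      using A[of x] unfolding power_add by (simp add: pos_le_divide_eq mult.assoc)
    have b: "cmod (ft1 b y) * (1 + \<bar>y\<bar>) ^ m \<le> B * (1 / (1 + \<bar>y\<bar>)\<^sup>2)"
      using B[of y] unfolding power_add by (simp add: pos_le_divide_eq mult.assoc)
    have "cmod (W \<zeta> * tens (ft1 a) (ft1 b) \<zeta>) \<le> c * ((1 + \<bar>x\<bar>) ^ m * (1 + \<bar>y\<bar>) ^ m) * (cmod (ft1 a x) * cmod (ft1 b y))"
      using W[of \<zeta>] by (auto simp: norm_mult tens_def z intro: mult_right_mono)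
    also have "\<dots> = c * ((cmod (ft1 a x) * (1 + \<bar>x\<bar>) ^ m) * (cmod (ft1 b y) * (1 + \<bar>y\<bar>) ^ m))"
      by (simp add: mult_ac)
    also have "\<dots> \<le> c * ((A * (1 / (1 + \<bar>x\<bar>)\<^sup>2)) * (B * (1 / (1 + \<bar>y\<bar>)\<^sup>2)))"
      by (rule mult_left_mono[OF mult_mono[OF a b]]) (use A0 B0 c0 in auto)
    also have "\<dots> = K * cmod (tens ?w ?w \<zeta>)"
      unfolding K_def tens_def z norm_mult norm_of_real by (simp add: abs_mult)
    finally show ?thesis .
  qed
  have w1: "cmod (tens ?w ?w \<zeta>) \<le> 1" for \<zeta>
    unfolding tens_def norm_mult norm_of_real by (intro mult_le_one) (auto simp: abs_mult)
  have le1: "cmod (W \<zeta> * tens (ft1 a) (ft1 b) \<zeta>) \<le> K" for \<zeta>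
    using order_trans[OF le mult_left_le[OF w1 K0]] .
  then show "\<exists>B. \<forall>\<zeta>. cmod (W \<zeta> * tens (ft1 a) (ft1 b) \<zeta>) \<le> B" by blast
  have iK: "integrable lborel (\<lambda>\<zeta>. L * cmod (tens ?w ?w \<zeta>))" for L :: real
    using iw by (intro integrable_mult_right integrable_norm)
  show "integrable lborel (\<lambda>\<zeta>. W \<zeta> * tens (ft1 a) (ft1 b) \<zeta>)"
    by (rule integrable_dominated[OF iK _ le]) measurable
  have "(cmod (W \<zeta> * tens (ft1 a) (ft1 b) \<zeta>))\<^sup>2 \<le> K * K * cmod (tens ?w ?w \<zeta>)" for \<zeta>
  proof -
    have "cmod (W \<zeta> * tens (ft1 a) (ft1 b) \<zeta>) * cmod (W \<zeta> * tens (ft1 a) (ft1 b) \<zeta>) \<le> K * (K * cmod (tens ?w ?w \<zeta>))"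
      by (rule mult_mono[OF le1 le]) (use K0 in auto)
    then show ?thesis by (simp only: power2_eq_square[of "cmod (W \<zeta> * tens (ft1 a) (ft1 b) \<zeta>)"] mult.assoc)
  qed
  then show "integrable lborel (\<lambda>\<zeta>. (cmod (W \<zeta> * tens (ft1 a) (ft1 b) \<zeta>))\<^sup>2)"
    by (intro integrable_dominated[OF iK[of "K * K"]]) auto
qed

lemma test_ft_L2:
  assumes "test1 a" "test1 b"
  shows "integrable lborel (tens (ft1 a) (ft1 b))"
    and "integrable lborel (\<lambda>\<zeta>. (cmod (tens (ft1 a) (ft1 b) \<zeta>))\<^sup>2)"
  using test_ft_weighted[OF assms, of "\<lambda>_. 1" 1 0] by auto

lemma test_tens_L2:
  assumes "test1 a" "test1 b"
  shows "integrable lborel (tens a b)" "integrable lborel (\<lambda>z. (cmod (tens a b z))\<^sup>2)"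
    and "\<exists>B. \<forall>z. cmod (tens a b z) \<le> B"
proof -
  show i: "integrable lborel (tens a b)" using assms by (intro tens_integral test1_integrable)
  obtain A B where AB: "\<And>x. cmod (a x) \<le> A" "\<And>x. cmod (b x) \<le> B"
    using test1_bounded assms by metis
  have A0: "0 \<le> A" using order_trans[OF norm_ge_zero AB(1)[of 0]] .
  have B: "cmod (tens a b z) \<le> A * B" for z
    unfolding tens_def norm_mult using AB A0 by (intro mult_mono) auto
  then show "\<exists>B. \<forall>z. cmod (tens a b z) \<le> B" by blast
  have [measurable]: "tens a b \<in> borel_measurable borel" using i by auto
  show "integrable lborel (\<lambda>z. (cmod (tens a b z))\<^sup>2)"
  proof (rule integrable_dominated)
    show "integrable lborel (\<lambda>z. (A * B) * cmod (tens a b z))" using i by auto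
    show "norm ((cmod (tens a b z))\<^sup>2) \<le> (A * B) * cmod (tens a b z)" for z
      using mult_right_mono[OF B norm_ge_zero[of "tens a b z"]] by (simp add: power2_eq_square)
  qed auto
qed

lemma L2_of_real:
  assumes "L2 f"
  shows "(\<lambda>z. complex_of_real (f z)) \<in> borel_measurable borel"
    "integrable lborel (\<lambda>z. (cmod (complex_of_real (f z)))\<^sup>2)"
  using assms by (auto simp: L2_def)

lemma L2c_D:
  assumes "L2c F"
  shows "F \<in> borel_measurable borel" "integrable lborel (\<lambda>z. (cmod (F z))\<^sup>2)"
  using assms by (auto simp: L2c_def)

lemma fourier_L2_tens_real:
  assumes "fourier_L2 f F" "test1 a" "test1 b" and "\<And>x. Im (a x) = 0" "\<And>x. Im (b x) = 0"
  shows "(LINT z|lborel. complex_of_real (f z) * tens (ft1 a) (ft1 b) z) = (LINT z|lborel. F z * tens a b z)"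
proof -
  have "complex_of_real (Re (tens a b z)) = tens a b z" for z
    using assms by (simp add: tens_def complex_eq_iff)
  moreover have "(LINT z|lborel. complex_of_real (f z) * ft (\<lambda>z. Re (tens a b z)) z) =
     (LINT z|lborel. F z * complex_of_real (Re (tens a b z)))"
    using assms(1) test_fn_Re_tens[OF assms(2,3)] by (simp add: fourier_L2_def)
  ultimately show ?thesis
    using ft_Re_tens[of a b] assms by (simp add: test1_integrable)
qed

lemma C_diff_Re_Im: "C_diff n a \<Longrightarrow> C_diff n (\<lambda>x. of_real (Re (a x))) \<and> C_diff n (\<lambda>x. of_real (Im (a x)))"
proof (induction n arbitrary: a)
  case 0
  then show ?case by (auto intro!: continuous_intros)
next
  case (Suc n)
  then obtain a' where a': "\<And>x. (a has_vector_derivative a' x) (at x)" "C_diff n a'" by auto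
  have "((\<lambda>x. complex_of_real (Re (a x))) has_vector_derivative of_real (Re (a' x))) (at x)"
    "((\<lambda>x. complex_of_real (Im (a x))) has_vector_derivative of_real (Im (a' x))) (at x)" for x
    by (intro bounded_linear.has_vector_derivative[OF bounded_linear_of_real]
        bounded_linear.has_vector_derivative[OF bounded_linear_Re]
        bounded_linear.has_vector_derivative[OF bounded_linear_Im] a')+
  from C_diff_SucI[OF this(1)] C_diff_SucI[OF this(2)] show ?case using Suc.IH[OF a'(2)] by blast
qed

lemma test1_Re_Im:
  assumes "test1 a"
  shows "test1 (\<lambda>x. of_real (Re (a x)))" "test1 (\<lambda>x. of_real (Im (a x)))"
  using assms C_diff_Re_Im[of _ a] unfolding test1_def by (metis complex.sel of_real_0 zero_complex.sel)+

text \<open>The defining pairing is given for real test functions only. Both sides are complex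
  linear in each tensor factor, so splitting the factors into real and imaginary parts extends
  it.\<close>

lemma fourier_L2_tens:
  assumes F: "fourier_L2 f F" and a: "test1 a" and b: "test1 b"
  shows "(LINT z|lborel. complex_of_real (f z) * tens (ft1 a) (ft1 b) z) = (LINT z|lborel. F z * tens a b z)"
proof -
  have L2: "L2 f" "L2c F" using F by (auto simp: fourier_L2_def)
  define P where "P a b \<longleftrightarrow> (LINT z|lborel. complex_of_real (f z) * tens (ft1 a) (ft1 b) z) = (LINT z|lborel. F z * tens a b z)" for a b
  have int: "integrable lborel (\<lambda>z. complex_of_real (f z) * tens (ft1 a) (ft1 b) z)" "integrable lborel (\<lambda>z. F z * tens a b z)"
    if "test1 a" "test1 b" for a b
    using that test_ft_L2[OF that] test_tens_L2[OF that] L2_of_real[OF L2(1)] L2c_D[OF L2(2)]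
    by (auto intro!: integrable_mult_L2)
  have ft1_lin: "ft1 (\<lambda>x. a x + \<i> * b x) = (\<lambda>x. ft1 a x + \<i> * ft1 b x)" if "test1 a" "test1 b" for a b
  proof
    fix x
    have "integrable lborel (\<lambda>\<xi>. a \<xi> * exp (- \<i> * of_real (x * \<xi>)))" "integrable lborel (\<lambda>\<xi>. b \<xi> * exp (- \<i> * of_real (x * \<xi>)))"
      using that[THEN test1_integrable] by (auto intro!: integrable_times_unimodular)
    then show "ft1 (\<lambda>x. a x + \<i> * b x) x = ft1 a x + \<i> * ft1 b x"
      unfolding ft1_def by (simp add: distrib_right mult.assoc)
  qed
  have l: "P (\<lambda>x. a1 x + \<i> * a2 x) b" if t: "test1 a1" "test1 a2" "test1 b" and P: "P a1 b" "P a2 b" for a1 a2 b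
  proof -
    have "tens (\<lambda>x. c1 x + \<i> * c2 x) d z = tens c1 d z + \<i> * tens c2 d z" for c1 c2 d z
      by (simp add: tens_def algebra_simps)
    then show ?thesis
      using P int[OF t(1,3)] int[OF t(2,3)] unfolding P_def ft1_lin[OF t(1,2)]
      by (simp add: distrib_left mult.left_commute[of _ \<i>])
  qed
  have r: "P a (\<lambda>x. b1 x + \<i> * b2 x)" if t: "test1 a" "test1 b1" "test1 b2" and P: "P a b1" "P a b2" for a b1 b2
  proof -
    have "tens d (\<lambda>x. c1 x + \<i> * c2 x) z = tens d c1 z + \<i> * tens d c2 z" for c1 c2 d z
      by (simp add: tens_def algebra_simps)
    then show ?thesis
      using P int[OF t(1,2)] int[OF t(1,3)] unfolding P_def ft1_lin[OF t(2,3)]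
      by (simp add: distrib_left mult.left_commute[of _ \<i>])
  qed
  have re: "P c d" if "test1 c" "test1 d" "\<And>x. Im (c x) = 0" "\<And>x. Im (d x) = 0" for c d
    unfolding P_def by (rule fourier_L2_tens_real[OF F that])
  note ta = test1_Re_Im[OF a] and tb = test1_Re_Im[OF b]
  have "P (\<lambda>x. of_real (Re (a x)) + \<i> * of_real (Im (a x))) (\<lambda>x. of_real (Re (b x)) + \<i> * of_real (Im (b x)))"
    by (intro l r re ta tb) (auto simp: complex_eq[symmetric] b)
  then show ?thesis by (simp add: P_def complex_eq[symmetric])
qed

section \<open>Mollification seen from the Fourier side; uniqueness of the transform\<close>

definition chi :: "real \<times> real \<Rightarrow> complex" where
  "chi = tens (\<lambda>x. of_real (bump x)) (\<lambda>x. of_real (bump x))"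

text \<open>The transform of the cutoff \<open>chi\<close>, used as an unnormalised mollifier of
  total mass 4 pi^2. Its sign is not controlled.\<close>

definition ker :: "real \<times> real \<Rightarrow> complex" where
  "ker = tens (ft1 (\<lambda>x. of_real (bump x))) (ft1 (\<lambda>x. of_real (bump x)))"

lemma ker_props:
  "integrable lborel ker" "integrable lborel (\<lambda>z. (cmod (ker z))\<^sup>2)" "(LINT z|lborel. ker z) = of_real (4 * pi\<^sup>2)"
  "ker \<in> borel_measurable borel"
proof -
  show i: "integrable lborel ker" "integrable lborel (\<lambda>z. (cmod (ker z))\<^sup>2)"
    unfolding ker_def by (intro test_ft_L2 test1_bump)+
  show "(LINT z|lborel. ker z) = of_real (4 * pi\<^sup>2)"
    unfolding ker_def by (simp add: tens_integral ft1_integrable test1_bump ft1_integral bump_props power2_eq_square)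
  show "ker \<in> borel_measurable borel" using i(1) by auto
qed

lemma chi_props:
  "chi \<in> borel_measurable borel" "continuous_on UNIV chi" "chi 0 = 1" "integrable lborel chi"
  "integrable lborel (\<lambda>z. (cmod (chi z))\<^sup>2)" "\<exists>B. \<forall>z. cmod (chi z) \<le> B"
proof -
  show c: "continuous_on UNIV chi" unfolding chi_def tens_def[abs_def]
    by (intro continuous_intros continuous_on_compose2[OF test1_continuous[OF test1_bump, of UNIV]]) auto
  then show "chi \<in> borel_measurable borel" by (rule borel_measurable_continuous_onI)
  show "chi 0 = 1" by (simp add: chi_def tens_def bump_props)
  show "integrable lborel chi" "integrable lborel (\<lambda>z. (cmod (chi z))\<^sup>2)" "\<exists>B. \<forall>z. cmod (chi z) \<le> B"
    unfolding chi_def by (rule test_tens_L2[OF test1_bump test1_bump])+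
qed

lemma chi_ft: "inv_ft chi (- y) = ker y"
  unfolding chi_def ker_def by (subst inv_ft_tens) (auto intro!: test1_integrable test1_bump simp: tens_def)

text \<open>Cutting off frequencies at scale 1/e is averaging in space at scale e. The defining
  pairing is tested with the cutoff modulated by w, whose transform is \<open>ker\<close> rescaled
  by e and centred at w.\<close>

lemma fourier_mollify:
  assumes F: "fourier_L2 f F" and e: "e > 0"
  shows "inv_ft (\<lambda>\<zeta>. F \<zeta> * chi (e *\<^sub>R \<zeta>)) w = (LINT y|lborel. complex_of_real (f (w + e *\<^sub>R y)) * ker y)"
proof -
  let ?a = "\<lambda>w \<xi>. complex_of_real (bump (e * \<xi>)) * iexp (w * \<xi>)"
  have ta: "test1 (?a w)" for w
    using test1_iexp[OF test1_affine[OF test1_bump, of e 0], of w] e by simp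
  have [measurable]: "(\<lambda>z. complex_of_real (f z)) \<in> borel_measurable borel"
    using F L2_of_real by (auto simp: fourier_L2_def)
  have [measurable]: "ker \<in> borel_measurable borel" by (rule ker_props)
  have ftm: "ft1 (?a v) x = of_real (1 / e) * ft1 (\<lambda>x. of_real (bump x)) ((x - v) / e)" for v x
    using ft1_modulated[OF test1_bump, of e v x] e by simp
  have "inv_ft (\<lambda>\<zeta>. F \<zeta> * chi (e *\<^sub>R \<zeta>)) w = (LINT \<zeta>|lborel. F \<zeta> * tens (?a (fst w)) (?a (snd w)) \<zeta>)"
    unfolding inv_ft_def by (subst inner_commute, subst iexp_tens) (simp add: chi_def tens_def mult_ac)
  also have "\<dots> = (LINT z|lborel. complex_of_real (f z) * tens (ft1 (?a (fst w))) (ft1 (?a (snd w))) z)"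
    by (rule fourier_L2_tens[OF F ta ta, symmetric])
  also have "\<dots> = (LINT z|lborel. complex_of_real (f z) * (of_real (1 / e\<^sup>2) * ker ((1/e) *\<^sub>R (z - w))))"
    unfolding tens_def ftm ker_def by (simp add: power2_eq_square)
  also have "\<dots> = e\<^sup>2 *\<^sub>R (LINT y|lborel. complex_of_real (f (w + e *\<^sub>R y)) * (of_real (1 / e\<^sup>2) * ker ((1/e) *\<^sub>R (w + e *\<^sub>R y - w))))"
    using e by (subst integral_lborel_scale[of _ e w]) (auto simp: power2_eq_square)
  also have "\<dots> = (LINT y|lborel. complex_of_real (f (w + e *\<^sub>R y)) * ker y)"
    using e by (simp add: scaleR_conv_of_real mult.left_commute[of _ "inverse _"] divide_inverse flip: integral_mult_right_zero)
       (simp add: mult.assoc[symmetric])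
  finally show ?thesis .
qed

definition eps :: "nat \<Rightarrow> real" where "eps n = 1 / real (Suc n)"

lemma eps: "eps \<longlonglongrightarrow> 0" "eps n > 0" "eps n \<noteq> 0"
  using LIMSEQ_inverse_real_of_nat by (auto simp: eps_def[abs_def] divide_inverse)

text \<open>An approximation of f computed from F alone; it transfers information from F to
  f.\<close>

definition moll :: "(real \<times> real \<Rightarrow> complex) \<Rightarrow> nat \<Rightarrow> real \<times> real \<Rightarrow> complex" where
  "moll F n w = inv_ft (\<lambda>\<zeta>. F \<zeta> * chi (eps n *\<^sub>R \<zeta>)) w / of_real (4 * pi\<^sup>2)"

lemma moll_tendsto:
  assumes F: "fourier_L2 f F"
  shows "(\<lambda>n. \<integral>\<^sup>+w. ennreal ((cmod (moll F n w - f w))\<^sup>2) \<partial>lborel) \<longlonglongrightarrow> 0"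
proof -
  have f: "L2 f" using F by (simp add: fourier_L2_def)
  note [measurable] = L2_of_real(1)[OF f] ker_props(4)
  have [measurable]: "f \<in> borel_measurable borel" using f by (simp add: L2_def)
  let ?I = "\<lambda>n. \<integral>\<^sup>+w. ennreal ((cmod ((LINT y|lborel. complex_of_real (f (w + eps n *\<^sub>R y)) * ker y) - (LINT y|lborel. ker y) * complex_of_real (f w)))\<^sup>2) \<partial>lborel"
  have l: "?I \<longlonglongrightarrow> 0"
    by (rule L2_mollify[OF L2_of_real[OF f] ker_props(1,2) eps(1,3)])
  have "(\<integral>\<^sup>+w. ennreal ((cmod (moll F n w - f w))\<^sup>2) \<partial>lborel) = ennreal ((1 / (4 * pi\<^sup>2))\<^sup>2) * ?I n" for n
  proof -
    have "(cmod (moll F n w - f w))\<^sup>2 = (1 / (4 * pi\<^sup>2))\<^sup>2 * (cmod ((LINT y|lborel. complex_of_real (f (w + eps n *\<^sub>R y)) * ker y) - (LINT y|lborel. ker y) * complex_of_real (f w)))\<^sup>2" for w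
    proof -
      have "moll F n w - f w = of_real (1 / (4 * pi\<^sup>2)) * ((LINT y|lborel. complex_of_real (f (w + eps n *\<^sub>R y)) * ker y) - (LINT y|lborel. ker y) * complex_of_real (f w))"
        unfolding moll_def fourier_mollify[OF F eps(2)] ker_props(3)
        by (simp add: field_simps)
      then show ?thesis by (simp only: norm_mult power_mult_distrib norm_of_real power2_abs)
    qed
    then show ?thesis
      by (subst nn_integral_cmult[symmetric]) (auto simp: ennreal_mult' )
  qed
  moreover have "(\<lambda>n. ennreal ((1 / (4 * pi\<^sup>2))\<^sup>2) * ?I n) \<longlonglongrightarrow> ennreal ((1 / (4 * pi\<^sup>2))\<^sup>2) * 0"
    by (rule ennreal_tendsto_cmult[OF _ l]) simp
  ultimately show ?thesis by simp
qed

lemma tendsto_eps_scaled: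
  fixes k :: "real \<times> real \<Rightarrow> complex"
  assumes "isCont k 0"
  shows "(\<lambda>n. k (eps n *\<^sub>R \<zeta>)) \<longlonglongrightarrow> k 0"
proof -
  have "(\<lambda>n. eps n *\<^sub>R \<zeta>) \<longlonglongrightarrow> 0 *\<^sub>R \<zeta>" by (rule tendsto_scaleR[OF eps(1) tendsto_const])
  then show ?thesis using isCont_tendsto_compose[OF assms] by simp
qed

lemma isCont_chi: "isCont chi 0"
  using chi_props(2) continuous_on_eq_continuous_at[OF open_UNIV] by blast

text \<open>Injectivity by mollifying H itself: \<open>ker\<close> is an inverse transform of
  \<open>chi\<close>, so by Fubini every average of H against \<open>ker\<close> is a superposition
  of values of \<open>inv_ft H\<close>, hence 0, while these averages converge to 4 pi^2 H in
  L^2.\<close>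

lemma inv_ft_eq_0:
  assumes H1: "integrable lborel H" and H2: "integrable lborel (\<lambda>\<zeta>. (cmod (H \<zeta>))\<^sup>2)"
    and z: "\<And>w. inv_ft H w = 0"
  shows "AE \<zeta> in lborel. H \<zeta> = 0"
proof -
  have [measurable]: "H \<in> borel_measurable borel" using H1 by auto
  note [measurable] = chi_props(1) ker_props(4)
  have 0: "(LINT y|lborel. H (w + eps n *\<^sub>R y) * ker y) = 0" for w n
  proof -
    let ?G = "\<lambda>y \<zeta>. H (w + eps n *\<^sub>R y) * (chi \<zeta> * iexp (\<zeta> \<bullet> (- y)))"
    have iH: "integrable lborel (\<lambda>y. H (w + eps n *\<^sub>R y))"
      by (rule integrable_lborel_scale[OF H1 eps(3)])
    have "(LINT y|lborel. H (w + eps n *\<^sub>R y) * ker y) = (LINT y|lborel. (LINT \<zeta>|lborel. ?G y \<zeta>))"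
      by (subst chi_ft[symmetric]) (simp only: inv_ft_def integral_mult_right_zero)
    also have "\<dots> = (LINT \<zeta>|lborel. (LINT y|lborel. ?G y \<zeta>))"
    proof (rule lborel_pair.Fubini_integral[symmetric], rule lborel_pair.Fubini_integrable)
      show "integrable lborel (\<lambda>y. LINT \<zeta>|lborel. norm (case (y, \<zeta>) of (y, \<zeta>) \<Rightarrow> ?G y \<zeta>))"
        using iH by (simp add: norm_mult integrable_norm)
      show "AE y in lborel. integrable lborel (\<lambda>\<zeta>. case (y, \<zeta>) of (y, \<zeta>) \<Rightarrow> ?G y \<zeta>)"
        by (simp only: prod.case)
           (intro AE_I2 integrable_mult_right integrable_times_unimodular chi_props(4), auto)
    qed measurable
    also have "(\<lambda>\<zeta>. LINT y|lborel. ?G y \<zeta>) = (\<lambda>\<zeta>. 0)"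
    proof
      fix \<zeta>
      \<comment> \<open>The substitution w + eps n y identifies the inner integral, up to a
        unimodular factor and the Jacobian, with the inverse transform at -\<zeta> / eps n.\<close>
      have "0 = inv_ft H (- (1 / eps n) *\<^sub>R \<zeta>)" by (simp add: z)
      also have "\<dots> = (eps n)\<^sup>2 *\<^sub>R (LINT y|lborel. H (w + eps n *\<^sub>R y) * iexp ((w + eps n *\<^sub>R y) \<bullet> (- (1 / eps n) *\<^sub>R \<zeta>)))"
        unfolding inv_ft_def using eps(3)[of n] by (subst integral_lborel_scale[of _ "eps n" w]) (auto simp: power2_eq_square)
      finally have "(LINT y|lborel. H (w + eps n *\<^sub>R y) * iexp ((w + eps n *\<^sub>R y) \<bullet> (- (1 / eps n) *\<^sub>R \<zeta>))) = 0"
        using eps(3)[of n] by simp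
      moreover have "?G y \<zeta> = chi \<zeta> * iexp (w \<bullet> ((1 / eps n) *\<^sub>R \<zeta>)) * (H (w + eps n *\<^sub>R y) * iexp ((w + eps n *\<^sub>R y) \<bullet> (- (1 / eps n) *\<^sub>R \<zeta>)))" for y
      proof -
        have "iexp (\<zeta> \<bullet> (- y)) = iexp (w \<bullet> ((1 / eps n) *\<^sub>R \<zeta>)) * iexp ((w + eps n *\<^sub>R y) \<bullet> (- (1 / eps n) *\<^sub>R \<zeta>))"
        proof -
          have "\<zeta> \<bullet> (- y) = w \<bullet> ((1 / eps n) *\<^sub>R \<zeta>) + (w + eps n *\<^sub>R y) \<bullet> (- (1 / eps n) *\<^sub>R \<zeta>)"
            using eps(3)[of n] by (simp add: inner_add_left inner_add_right add_divide_distrib inner_commute)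
          then show ?thesis by (simp only: of_real_add distrib_left exp_add)
        qed
        then show ?thesis by (simp add: mult_ac)
      qed
      ultimately show "(LINT y|lborel. ?G y \<zeta>) = 0" by (simp only: integral_mult_right_zero mult_zero_right)
    qed
    finally show ?thesis by simp
  qed
  have "(\<lambda>n. \<integral>\<^sup>+w. ennreal ((cmod ((LINT y|lborel. H (w + eps n *\<^sub>R y) * ker y) - (LINT y|lborel. ker y) * H w))\<^sup>2) \<partial>lborel) \<longlonglongrightarrow> 0"
    by (rule L2_mollify[OF _ H2 ker_props(1,2) eps(1,3)]) simp
  then have "(\<lambda>n::nat. \<integral>\<^sup>+w. ennreal ((cmod (of_real (4 * pi\<^sup>2) * H w))\<^sup>2) \<partial>lborel) \<longlonglongrightarrow> 0"
    unfolding 0 ker_props(3) by simp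
  then have "(\<integral>\<^sup>+w. ennreal ((cmod (of_real (4 * pi\<^sup>2) * H w))\<^sup>2) \<partial>lborel) = 0"
    using LIMSEQ_unique tendsto_const by blast
  then show ?thesis by (subst (asm) nn_integral_0_iff_AE) (auto simp: ennreal_eq_0_iff)
qed

text \<open>For Q that need not be integrable itself. Countably many damped copies vanish off one
  null set, and at each point some damping factor is nonzero because k (eps n \<zeta>) tends to k
  0.\<close>

lemma AE_eq_0_of_localised:
  fixes Q k :: "real \<times> real \<Rightarrow> complex"
  assumes k: "isCont k 0" "k 0 \<noteq> 0"
    and i: "\<And>n. integrable lborel (\<lambda>\<zeta>. Q \<zeta> * k (eps n *\<^sub>R \<zeta>))" "\<And>n. integrable lborel (\<lambda>\<zeta>. (cmod (Q \<zeta> * k (eps n *\<^sub>R \<zeta>)))\<^sup>2)"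
    and z: "\<And>n w. inv_ft (\<lambda>\<zeta>. Q \<zeta> * k (eps n *\<^sub>R \<zeta>)) w = 0"
  shows "AE \<zeta> in lborel. Q \<zeta> = 0"
proof -
  have "AE \<zeta> in lborel. \<forall>n. Q \<zeta> * k (eps n *\<^sub>R \<zeta>) = 0"
    unfolding AE_all_countable using inv_ft_eq_0[OF i z] by blast
  then show ?thesis
  proof (rule eventually_mono)
    fix \<zeta> assume *: "\<forall>n. Q \<zeta> * k (eps n *\<^sub>R \<zeta>) = 0"
    have "\<forall>\<^sub>F n in sequentially. k (eps n *\<^sub>R \<zeta>) \<noteq> 0"
      using tendsto_eps_scaled[OF k(1)] k(2) by (rule tendsto_imp_eventually_ne)
    then obtain n where "k (eps n *\<^sub>R \<zeta>) \<noteq> 0" using eventually_happens'[OF sequentially_bot] by blast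
    then show "Q \<zeta> = 0" using * by auto
  qed
qed

lemma L2_mult_bounded:
  fixes F g :: "'a \<Rightarrow> complex"
  assumes [measurable]: "F \<in> borel_measurable M" "g \<in> borel_measurable M"
    and F: "integrable M (\<lambda>z. (cmod (F z))\<^sup>2)" and g: "\<And>z. cmod (g z) \<le> B"
  shows "integrable M (\<lambda>z. (cmod (F z * g z))\<^sup>2)"
proof (rule integrable_dominated)
  show "integrable M (\<lambda>z. (cmod (F z))\<^sup>2 * B\<^sup>2)" using F by simp
  show "norm ((cmod (F x * g x))\<^sup>2) \<le> (cmod (F x))\<^sup>2 * B\<^sup>2" for x
    using g by (auto intro!: mult_left_mono power_mono simp: norm_mult power_mult_distrib)
qed auto

lemma chi_cutoff_L2:
  assumes "L2c F"
  shows "integrable lborel (\<lambda>\<zeta>. F \<zeta> * chi (eps n *\<^sub>R \<zeta>))" "integrable lborel (\<lambda>\<zeta>. (cmod (F \<zeta> * chi (eps n *\<^sub>R \<zeta>)))\<^sup>2)"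
proof -
  note [measurable] = chi_props(1) L2c_D(1)[OF assms]
  have "integrable lborel (\<lambda>\<zeta>. (cmod (chi (0 + eps n *\<^sub>R \<zeta>)))\<^sup>2)"
    by (rule integrable_lborel_scale[OF chi_props(5) eps(3)])
  then show "integrable lborel (\<lambda>\<zeta>. F \<zeta> * chi (eps n *\<^sub>R \<zeta>))"
    using L2c_D[OF assms] by (intro integrable_mult_L2) auto
  obtain B where "\<And>z. cmod (chi z) \<le> B" using chi_props(6) by blast
  then show "integrable lborel (\<lambda>\<zeta>. (cmod (F \<zeta> * chi (eps n *\<^sub>R \<zeta>)))\<^sup>2)"
    using L2c_D[OF assms] by (intro L2_mult_bounded) auto
qed

text \<open>The energy space and the weak formulation each provide their own transform of phi; this
  identifies them. Cut off and inverted, both give the same mollification of f.\<close>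

lemma fourier_L2_unique:
  assumes F: "fourier_L2 f F" and G: "fourier_L2 f G"
  shows "AE \<zeta> in lborel. F \<zeta> = G \<zeta>"
proof -
  have L: "L2c F" "L2c G" using F G by (auto simp: fourier_L2_def)
  note [measurable] = L2c_D(1)[OF L(1)] L2c_D(1)[OF L(2)]
  have D: "L2c (\<lambda>\<zeta>. F \<zeta> - G \<zeta>)"
    using L2_diff_integrable[of F lborel G] L2c_D[OF L(1)] L2c_D[OF L(2)] by (simp add: L2c_def)
  have "AE \<zeta> in lborel. F \<zeta> - G \<zeta> = 0"
  proof (rule AE_eq_0_of_localised[of chi])
    show "isCont chi 0" by (rule isCont_chi)
    show "inv_ft (\<lambda>\<zeta>. (F \<zeta> - G \<zeta>) * chi (eps n *\<^sub>R \<zeta>)) w = 0" for n w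
    proof -
      have "integrable lborel (\<lambda>z. F z * chi (eps n *\<^sub>R z) * iexp (z \<bullet> w))" "integrable lborel (\<lambda>z. G z * chi (eps n *\<^sub>R z) * iexp (z \<bullet> w))"
        by (rule integrable_times_unimodular[OF chi_cutoff_L2(1)]; use L in simp)+
      then have "inv_ft (\<lambda>\<zeta>. (F \<zeta> - G \<zeta>) * chi (eps n *\<^sub>R \<zeta>)) w
          = inv_ft (\<lambda>\<zeta>. F \<zeta> * chi (eps n *\<^sub>R \<zeta>)) w - inv_ft (\<lambda>\<zeta>. G \<zeta> * chi (eps n *\<^sub>R \<zeta>)) w"
        unfolding inv_ft_def by (simp add: left_diff_distrib)
      then show ?thesis by (simp add: fourier_mollify[OF F eps(2)] fourier_mollify[OF G eps(2)])
    qed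
  qed (use chi_cutoff_L2[OF D] chi_props(3) in auto)
  then show ?thesis by eventually_elim simp
qed

section \<open>Parseval identities and the equation on the Fourier side\<close>

text \<open>With f replaced by \<open>moll F n\<close> this is Fubini. The spatial side converges by
  Cauchy-Schwarz and L^2 convergence of the mollifications, the frequency side by dominated
  convergence, for which integrability of the product is assumed outright instead of a Plancherel
  bound for v.\<close>

lemma parseval:
  assumes F: "fourier_L2 f F" and v1: "integrable lborel v" and v2: "integrable lborel (\<lambda>z. (cmod (v z))\<^sup>2)"
    and Fv: "integrable lborel (\<lambda>\<zeta>. F \<zeta> * inv_ft v \<zeta>)"
  shows "(LINT z|lborel. complex_of_real (f z) * v z) = (LINT \<zeta>|lborel. F \<zeta> * inv_ft v \<zeta>) / of_real (4 * pi\<^sup>2)"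
proof -
  have f: "L2 f" "L2c F" using F by (auto simp: fourier_L2_def)
  note [measurable] = L2_of_real(1)[OF f(1)] L2c_D(1)[OF f(2)] chi_props(1)
  have [measurable]: "v \<in> borel_measurable borel" "f \<in> borel_measurable borel" using v1 f(1) by (auto simp: L2_def)
  have [measurable]: "moll F n \<in> borel_measurable borel" for n
    unfolding moll_def inv_ft_def by measurable
  define A where "A n = (LINT w|lborel. moll F n w * v w)" for n
  let ?Fn = "\<lambda>n \<zeta>. F \<zeta> * chi (eps n *\<^sub>R \<zeta>)"
  have iFn: "integrable lborel (?Fn n)" for n by (rule chi_cutoff_L2[OF f(2)])
  have A_eq: "A n = (LINT \<zeta>|lborel. chi (eps n *\<^sub>R \<zeta>) * (F \<zeta> * inv_ft v \<zeta>)) / of_real (4 * pi\<^sup>2)" for n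
  proof -
    have "A n = (LINT w|lborel. (LINT \<zeta>|lborel. ?Fn n \<zeta> * iexp (\<zeta> \<bullet> w) * v w)) / of_real (4 * pi\<^sup>2)"
      unfolding A_def moll_def inv_ft_def by simp
    also have "(LINT w|lborel. (LINT \<zeta>|lborel. ?Fn n \<zeta> * iexp (\<zeta> \<bullet> w) * v w)) = (LINT \<zeta>|lborel. (LINT w|lborel. ?Fn n \<zeta> * iexp (\<zeta> \<bullet> w) * v w))"
    proof (rule lborel_pair.Fubini_integral[symmetric], rule lborel_pair.Fubini_integrable)
      have "(\<lambda>w. LINT \<zeta>|lborel. norm (?Fn n \<zeta> * iexp (\<zeta> \<bullet> w) * v w)) = (\<lambda>w. (LINT \<zeta>|lborel. norm (?Fn n \<zeta>)) * norm (v w))"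
        by (simp add: norm_mult)
      then show "integrable lborel (\<lambda>w. LINT \<zeta>|lborel. norm (case (w, \<zeta>) of (w, \<zeta>) \<Rightarrow> ?Fn n \<zeta> * iexp (\<zeta> \<bullet> w) * v w))"
        using v1 by simp
      show "AE w in lborel. integrable lborel (\<lambda>\<zeta>. case (w, \<zeta>) of (w, \<zeta>) \<Rightarrow> ?Fn n \<zeta> * iexp (\<zeta> \<bullet> w) * v w)"
        by (simp only: prod.case) (intro AE_I2 integrable_mult_left integrable_times_unimodular iFn, auto)
    qed measurable
    also have "\<dots> = (LINT \<zeta>|lborel. chi (eps n *\<^sub>R \<zeta>) * (F \<zeta> * inv_ft v \<zeta>))"
      unfolding inv_ft_def integral_mult_right_zero[symmetric]
      by (intro Bochner_Integration.integral_cong refl) (simp add: mult_ac inner_commute)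
    finally show ?thesis .
  qed
  obtain B where B: "\<And>z. cmod (chi z) \<le> B" using chi_props(6) by blast
  have "(\<lambda>n. LINT \<zeta>|lborel. chi (eps n *\<^sub>R \<zeta>) * (F \<zeta> * inv_ft v \<zeta>)) \<longlonglongrightarrow> (LINT \<zeta>|lborel. F \<zeta> * inv_ft v \<zeta>)"
  proof (rule integral_dominated_convergence[where w = "\<lambda>\<zeta>. B * cmod (F \<zeta> * inv_ft v \<zeta>)"])
    show "AE \<zeta> in lborel. (\<lambda>n. chi (eps n *\<^sub>R \<zeta>) * (F \<zeta> * inv_ft v \<zeta>)) \<longlonglongrightarrow> F \<zeta> * inv_ft v \<zeta>"
    proof (rule AE_I2)
      fix \<zeta> :: "real \<times> real"
      have "(\<lambda>n. chi (eps n *\<^sub>R \<zeta>) * (F \<zeta> * inv_ft v \<zeta>)) \<longlonglongrightarrow> chi 0 * (F \<zeta> * inv_ft v \<zeta>)"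
        by (rule tendsto_mult_right[OF tendsto_eps_scaled[OF isCont_chi]])
      then show "(\<lambda>n. chi (eps n *\<^sub>R \<zeta>) * (F \<zeta> * inv_ft v \<zeta>)) \<longlonglongrightarrow> F \<zeta> * inv_ft v \<zeta>"
        by (simp add: chi_props)
    qed
    show "AE \<zeta> in lborel. norm (chi (eps n *\<^sub>R \<zeta>) * (F \<zeta> * inv_ft v \<zeta>)) \<le> B * cmod (F \<zeta> * inv_ft v \<zeta>)" for n
      unfolding norm_mult[of "chi _"] by (intro AE_I2 mult_right_mono B) auto
    show "(\<lambda>\<zeta>. F \<zeta> * inv_ft v \<zeta>) \<in> borel_measurable lborel" using Fv by auto
    then show "(\<lambda>\<zeta>. chi (eps n *\<^sub>R \<zeta>) * (F \<zeta> * inv_ft v \<zeta>)) \<in> borel_measurable lborel" for n by measurable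
  qed (use Fv in auto)
  then have "(\<lambda>n. A n) \<longlonglongrightarrow> (LINT \<zeta>|lborel. F \<zeta> * inv_ft v \<zeta>) / of_real (4 * pi\<^sup>2)"
    unfolding A_eq by (rule tendsto_divide) auto
  then have l1: "A \<longlonglongrightarrow> (LINT \<zeta>|lborel. F \<zeta> * inv_ft v \<zeta>) / of_real (4 * pi\<^sup>2)" .
  define L where "L = (LINT z|lborel. complex_of_real (f z) * v z)"
  have ifv: "integrable lborel (\<lambda>z. complex_of_real (f z) * v z)"
    using L2_of_real[OF f(1)] v2 by (intro integrable_mult_L2) auto
  have imv: "integrable lborel (\<lambda>w. moll F n w * v w)" for n
  proof (rule integrable_dominated)
    define c where "c = (LINT \<zeta>|lborel. norm (?Fn n \<zeta>)) / (4 * pi\<^sup>2)"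
    have "cmod (moll F n w) \<le> c" for w
    proof -
      have "cmod (inv_ft (?Fn n) w) \<le> (LINT \<zeta>|lborel. norm (?Fn n \<zeta> * iexp (\<zeta> \<bullet> w)))"
        unfolding inv_ft_def by (rule integral_norm_bound)
      then show ?thesis by (simp add: moll_def c_def norm_divide norm_mult norm_power divide_right_mono)
    qed
    then show "norm (moll F n w * v w) \<le> c * cmod (v w)" for w
      unfolding norm_mult by (intro mult_right_mono) auto
    show "integrable lborel (\<lambda>w. c * cmod (v w))" using v1 by auto
  qed auto
  let ?a = "\<lambda>n. \<integral>\<^sup>+w. ennreal ((cmod (moll F n w - f w))\<^sup>2) \<partial>lborel"
  have le: "ennreal ((cmod (A n - L))\<^sup>2) \<le> (\<integral>\<^sup>+z. ennreal ((cmod (v z))\<^sup>2) \<partial>lborel) * ?a n" for n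
  proof -
    have "A n - L = (LINT w|lborel. (moll F n w - f w) * v w)"
      unfolding A_def L_def using ifv imv by (simp add: left_diff_distrib)
    moreover have "integrable lborel (\<lambda>w. (moll F n w - f w) * v w)"
      using ifv imv by (simp add: left_diff_distrib)
    ultimately have "ennreal (cmod (A n - L)) \<le> (\<integral>\<^sup>+w. ennreal (cmod (v w)) * ennreal (cmod (moll F n w - f w)) \<partial>lborel)"
      using integral_norm_bound_ennreal by (fastforce simp: norm_mult ennreal_mult mult.commute)
    then have "(ennreal (cmod (A n - L)))\<^sup>2 \<le> (\<integral>\<^sup>+w. ennreal (cmod (v w)) * ennreal (cmod (moll F n w - f w)) \<partial>lborel)\<^sup>2"
      by (intro power_mono) auto
    also have "\<dots> \<le> (\<integral>\<^sup>+w. (ennreal (cmod (v w)))\<^sup>2 \<partial>lborel) * (\<integral>\<^sup>+w. (ennreal (cmod (moll F n w - f w)))\<^sup>2 \<partial>lborel)"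
      by (rule Cauchy_Schwarz_nn_integral) auto
    finally show ?thesis by (simp add: ennreal_power)
  qed
  have "(\<lambda>n. (\<integral>\<^sup>+z. ennreal ((cmod (v z))\<^sup>2) \<partial>lborel) * ?a n) \<longlonglongrightarrow> (\<integral>\<^sup>+z. ennreal ((cmod (v z))\<^sup>2) \<partial>lborel) * 0"
    by (rule ennreal_tendsto_cmult[OF _ moll_tendsto[OF F]]) (use v2 in \<open>auto simp: integrable_iff_bounded\<close>)
  then have l0: "(\<lambda>n. (\<integral>\<^sup>+z. ennreal ((cmod (v z))\<^sup>2) \<partial>lborel) * ?a n) \<longlonglongrightarrow> 0"
    by simp
  have "(\<lambda>n. ennreal ((cmod (A n - L))\<^sup>2)) \<longlonglongrightarrow> 0"
    by (rule tendsto_sandwich[OF _ _ tendsto_const l0]) (auto intro!: always_eventually le)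
  then have "(\<lambda>n. ennreal ((cmod (A n - L))\<^sup>2)) \<longlonglongrightarrow> ennreal 0" by simp
  then have "(\<lambda>n. (cmod (A n - L))\<^sup>2) \<longlonglongrightarrow> 0"
    by (subst (asm) tendsto_ennreal_iff) auto
  then have "(\<lambda>n. sqrt ((cmod (A n - L))\<^sup>2)) \<longlonglongrightarrow> sqrt 0" by (rule tendsto_real_sqrt)
  then have "A \<longlonglongrightarrow> L" by (simp add: tendsto_norm_zero_iff LIM_zero_iff)
  then show ?thesis using LIMSEQ_unique[OF l1] by (simp add: L_def)
qed

definition conv :: "(real \<times> real \<Rightarrow> complex) \<Rightarrow> real \<times> real \<Rightarrow> complex" where
  "conv F \<tau> = (LINT \<zeta>|lborel. F \<zeta> * F (\<tau> - \<zeta>))"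

lemma conv_integrable:
  assumes F: "L2c F"
  shows "integrable lborel (\<lambda>\<zeta>. F \<zeta> * F (\<tau> - \<zeta>))"
    and "(LINT \<zeta>|lborel. cmod (F \<zeta> * F (\<tau> - \<zeta>))) \<le> (LINT \<zeta>|lborel. (cmod (F \<zeta>))\<^sup>2)"
proof -
  note [measurable] = L2c_D(1)[OF F]
  note F2 = L2c_D(2)[OF F]
  have r: "integrable lborel (\<lambda>\<zeta>. (cmod (F (\<tau> - \<zeta>)))\<^sup>2)" by (rule integrable_lborel_reflect[OF F2])
  show i: "integrable lborel (\<lambda>\<zeta>. F \<zeta> * F (\<tau> - \<zeta>))" using F2 r by (intro integrable_mult_L2) auto
  have "(LINT \<zeta>|lborel. cmod (F \<zeta> * F (\<tau> - \<zeta>))) \<le> (LINT \<zeta>|lborel. (cmod (F \<zeta>))\<^sup>2 / 2 + (cmod (F (\<tau> - \<zeta>)))\<^sup>2 / 2)"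
  proof (rule integral_mono)
    fix \<zeta> show "cmod (F \<zeta> * F (\<tau> - \<zeta>)) \<le> (cmod (F \<zeta>))\<^sup>2 / 2 + (cmod (F (\<tau> - \<zeta>)))\<^sup>2 / 2"
      using sum_squares_bound[of "cmod (F \<zeta>)" "cmod (F (\<tau> - \<zeta>))"] by (simp add: norm_mult)
  qed (use i F2 r in auto)
  also have "\<dots> = (LINT \<zeta>|lborel. (cmod (F \<zeta>))\<^sup>2) / 2 + (LINT \<zeta>|lborel. (cmod (F (\<tau> - \<zeta>)))\<^sup>2) / 2"
    using F2 r by simp
  also have "(LINT \<zeta>|lborel. (cmod (F (\<tau> - \<zeta>)))\<^sup>2) = (LINT \<zeta>|lborel. (cmod (F \<zeta>))\<^sup>2)"
    by (rule integral_lborel_reflect) auto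
  finally show "(LINT \<zeta>|lborel. cmod (F \<zeta> * F (\<tau> - \<zeta>))) \<le> (LINT \<zeta>|lborel. (cmod (F \<zeta>))\<^sup>2)" by simp
qed

lemma conv_props:
  assumes F: "L2c F"
  shows "conv F \<in> borel_measurable borel" "cmod (conv F \<tau>) \<le> (LINT \<zeta>|lborel. (cmod (F \<zeta>))\<^sup>2)"
proof -
  note [measurable] = L2c_D(1)[OF F]
  show "conv F \<in> borel_measurable borel" unfolding conv_def by measurable
  show "cmod (conv F \<tau>) \<le> (LINT \<zeta>|lborel. (cmod (F \<zeta>))\<^sup>2)"
    unfolding conv_def by (rule order_trans[OF integral_norm_bound conv_integrable(2)[OF F]])
qed

lemma inv_ft_test:
  assumes "test1 a" "test1 b"
  shows "inv_ft (tens a b) = tens (ft1 (\<lambda>x. a (- x))) (ft1 (\<lambda>x. b (- x)))"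
    and "test1 (\<lambda>x. a (- x))" "test1 (\<lambda>x. b (- x))"
proof -
  have r: "ft1 c (- x) = ft1 (\<lambda>x. c (- x)) x" if "test1 c" for c x
    using ft1_modulated[OF that, of "-1" 0 x] by simp
  show "inv_ft (tens a b) = tens (ft1 (\<lambda>x. a (- x))) (ft1 (\<lambda>x. b (- x)))"
    by (rule ext) (simp add: inv_ft_tens test1_integrable assms r, simp add: tens_def)
  show "test1 (\<lambda>x. a (- x))" "test1 (\<lambda>x. b (- x))"
    using test1_affine[of _ "-1" 0] assms by auto
qed

text \<open>Parseval is applied twice: once to \<open>f u\<close>, and once to each \<open>u(z) exp (i z \<zeta>)\<close> in order to identify
  the transform of \<open>f u\<close>.\<close>

lemma fourier_square:
  assumes F: "fourier_L2 f F" and a: "test1 a" and b: "test1 b"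
  shows "(LINT z|lborel. complex_of_real ((f z)\<^sup>2) * tens a b z)
    = (LINT \<tau>|lborel. conv F \<tau> * inv_ft (tens a b) \<tau>) / (of_real (4 * pi\<^sup>2))\<^sup>2"
proof -
  have f: "L2 f" "L2c F" using F by (auto simp: fourier_L2_def)
  note [measurable] = L2_of_real(1)[OF f(1)] L2c_D(1)[OF f(2)] conv_props(1)[OF f(2)]
  note F2 = L2c_D(2)[OF f(2)]
  define U where "U = inv_ft (tens a b)"
  have U: "integrable lborel U" "integrable lborel (\<lambda>\<zeta>. (cmod (U \<zeta>))\<^sup>2)"
    unfolding U_def inv_ft_test(1)[OF a b] by (intro test_ft_L2 inv_ft_test[OF a b])+
  have [measurable]: "U \<in> borel_measurable borel" using U by auto
  have [measurable]: "tens a b \<in> borel_measurable borel" using test_tens_L2(1)[OF a b] by auto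
  define v where "v z = complex_of_real (f z) * tens a b z" for z
  have v1: "integrable lborel v"
    unfolding v_def using L2_of_real[OF f(1)] test_tens_L2[OF a b] by (intro integrable_mult_L2) auto
  obtain B where B: "\<And>z. cmod (tens a b z) \<le> B" using test_tens_L2(3)[OF a b] by blast
  have v2: "integrable lborel (\<lambda>z. (cmod (v z))\<^sup>2)"
    unfolding v_def using L2_of_real[OF f(1)] B by (intro L2_mult_bounded) auto
  have iv: "inv_ft v \<zeta> = (LINT \<tau>|lborel. F (\<tau> - \<zeta>) * U \<tau>) / of_real (4 * pi\<^sup>2)" for \<zeta>
  proof -
    let ?u = "tens (\<lambda>x. a x * iexp (fst \<zeta> * x)) (\<lambda>x. b x * iexp (snd \<zeta> * x))"
    have u_eq: "?u z = tens a b z * iexp (z \<bullet> \<zeta>)" for z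
      by (subst inner_commute, subst iexp_tens, subst tens_mult) rule
    have t: "test1 (\<lambda>x. a x * iexp (fst \<zeta> * x))" "test1 (\<lambda>x. b x * iexp (snd \<zeta> * x))"
      by (intro test1_iexp a b)+
    \<comment> \<open>Modulating u translates its inverse transform; this is where the convolution
      comes from.\<close>
    have iu: "inv_ft ?u \<zeta>' = U (\<zeta> + \<zeta>')" for \<zeta>'
      unfolding inv_ft_def U_def u_eq by (simp add: inner_add_right distrib_left exp_add mult.assoc)
    have sh: "integrable lborel (\<lambda>\<zeta>'. (cmod (U (\<zeta> + \<zeta>')))\<^sup>2)" by (rule integrable_lborel_shift[OF U(2)])
    have "inv_ft v \<zeta> = (LINT z|lborel. complex_of_real (f z) * ?u z)"
      unfolding inv_ft_def v_def u_eq by (simp add: mult.assoc)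
    also have "\<dots> = (LINT \<zeta>'|lborel. F \<zeta>' * inv_ft ?u \<zeta>') / of_real (4 * pi\<^sup>2)"
      unfolding iu using F2 sh
      by (subst parseval[OF F test_tens_L2(1,2)[OF t], unfolded iu]) (auto intro!: integrable_mult_L2)
    also have "(LINT \<zeta>'|lborel. F \<zeta>' * inv_ft ?u \<zeta>') = (LINT \<tau>|lborel. F (\<tau> - \<zeta>) * U \<tau>)"
      unfolding iu by (subst integral_lborel_shift[of _ "- \<zeta>", symmetric]) (auto simp: algebra_simps)
    finally show ?thesis .
  qed
  let ?G = "\<lambda>\<tau> \<zeta>. F \<zeta> * F (\<tau> - \<zeta>) * U \<tau>"
  have G: "integrable (lborel \<Otimes>\<^sub>M lborel) (\<lambda>(\<tau>, \<zeta>). ?G \<tau> \<zeta>)"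
  proof (rule lborel_pair.Fubini_integrable)
    have eq: "(\<lambda>\<tau>. LINT \<zeta>|lborel. norm (?G \<tau> \<zeta>)) = (\<lambda>\<tau>. (LINT \<zeta>|lborel. cmod (F \<zeta> * F (\<tau> - \<zeta>))) * cmod (U \<tau>))"
      by (simp add: norm_mult)
    \<comment> \<open>The convolution of |F| with itself is bounded by this constant, so
      integrability of U alone makes the double integral finite.\<close>
    define D where "D = (LINT \<zeta>|lborel. (cmod (F \<zeta>))\<^sup>2)"
    have "integrable lborel (\<lambda>\<tau>. (LINT \<zeta>|lborel. cmod (F \<zeta> * F (\<tau> - \<zeta>))) * cmod (U \<tau>))"
    proof (rule integrable_dominated)
      show "integrable lborel (\<lambda>\<tau>. D * cmod (U \<tau>))" using U by auto
      show "norm ((LINT \<zeta>|lborel. cmod (F \<zeta> * F (\<tau> - \<zeta>))) * cmod (U \<tau>)) \<le> D * cmod (U \<tau>)" for \<tau>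
        using mult_right_mono[OF conv_integrable(2)[OF f(2), of \<tau>] norm_ge_zero[of "U \<tau>"]]
        by (simp add: D_def abs_mult)
    qed measurable
    then show "integrable lborel (\<lambda>\<tau>. LINT \<zeta>|lborel. norm (case (\<tau>, \<zeta>) of (\<tau>, \<zeta>) \<Rightarrow> ?G \<tau> \<zeta>))"
      unfolding prod.case eq .
    show "AE \<tau> in lborel. integrable lborel (\<lambda>\<zeta>. case (\<tau>, \<zeta>) of (\<tau>, \<zeta>) \<Rightarrow> ?G \<tau> \<zeta>)"
      using conv_integrable(1)[OF f(2)] by auto
  qed measurable
  have inner: "(LINT \<tau>|lborel. ?G \<tau> \<zeta>) = of_real (4 * pi\<^sup>2) * (F \<zeta> * inv_ft v \<zeta>)" for \<zeta>
    unfolding iv by (simp add: mult.assoc)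
  have "integrable lborel (\<lambda>\<zeta>. of_real (1 / (4 * pi\<^sup>2)) * (LINT \<tau>|lborel. ?G \<tau> \<zeta>))"
    by (intro integrable_mult_right lborel_pair.integrable_snd[OF G])
  then have iFv: "integrable lborel (\<lambda>\<zeta>. F \<zeta> * inv_ft v \<zeta>)" unfolding inner by simp
  have "(LINT z|lborel. complex_of_real ((f z)\<^sup>2) * tens a b z) = (LINT z|lborel. complex_of_real (f z) * v z)"
    unfolding v_def by (simp add: power2_eq_square mult.assoc)
  also have "\<dots> = (LINT \<zeta>|lborel. F \<zeta> * inv_ft v \<zeta>) / of_real (4 * pi\<^sup>2)"
    by (rule parseval[OF F v1 v2 iFv])
  also have "(LINT \<zeta>|lborel. F \<zeta> * inv_ft v \<zeta>) = (LINT \<zeta>|lborel. (LINT \<tau>|lborel. ?G \<tau> \<zeta>)) / of_real (4 * pi\<^sup>2)"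
    unfolding inner by simp
  also have "(LINT \<zeta>|lborel. (LINT \<tau>|lborel. ?G \<tau> \<zeta>)) = (LINT \<tau>|lborel. (LINT \<zeta>|lborel. ?G \<tau> \<zeta>))"
    by (rule lborel_pair.Fubini_integral[OF G])
  also have "\<dots> = (LINT \<tau>|lborel. conv F \<tau> * U \<tau>)" by (simp add: conv_def)
  finally show ?thesis by (simp add: U_def power2_eq_square)
qed

text \<open>The nonvanishing at 0 needed to localise the equation with dilates of the transform of
  the bump.\<close>

lemma ft1_bump_0: "ft1 (\<lambda>x. of_real (bump x)) 0 \<noteq> 0"
proof
  assume *: "ft1 (\<lambda>x. of_real (bump x)) 0 = 0"
  have i: "integrable lborel bump"
    using integrable_Re[OF test1_integrable[OF test1_bump]] by simp
  have "(LINT x|lborel. bump x) = 0" using * by (simp add: ft1_def)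
  then have "AE x in lborel. bump x = 0"
    using i bump_props(2) by (subst (asm) integral_nonneg_eq_0_iff_AE) auto
  then have "AE x in lborel. x \<notin> {-1<..<1::real}"
  proof (rule eventually_mono)
    fix x :: real assume "bump x = 0"
    then show "x \<notin> {-1<..<1}" by (auto simp: bump_def flat_def)
  qed
  then have "{-1<..<1::real} \<in> null_sets lborel" by (subst AE_iff_null_sets) auto
  then show False by (simp add: null_sets_def)
qed

lemma deriv_real_valued:
  assumes "\<And>x. (a has_vector_derivative a' x) (at x)" "\<And>x. Im (a x) = 0"
  shows "Im (a' x) = 0"
proof -
  have "((\<lambda>x. Im (a x)) has_vector_derivative Im (a' x)) (at x)"
    by (rule bounded_linear.has_vector_derivative[OF bounded_linear_Im assms(1)])
  then have "((\<lambda>x. 0) has_vector_derivative Im (a' x)) (at x)" using assms(2) by simp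
  then show ?thesis using vector_derivative_unique_at has_vector_derivative_const by blast
qed

lemma cnj_ft1:
  assumes "\<And>x. Im (a x) = 0"
  shows "cnj (ft1 a x) = ft1 a (- x)"
proof -
  have "cnj (a t) = a t" for t using assms by (simp add: complex_eq_iff)
  moreover have "cnj (ft1 a x) = (LINT \<xi>|lborel. cnj (a \<xi> * exp (- \<i> * of_real (x * \<xi>))))"
    unfolding ft1_def by (rule Bochner_Integration.integral_cnj[symmetric])
  ultimately show ?thesis by (simp add: ft1_def exp_cnj)
qed

section \<open>The equation tested against tensors\<close>

definition disp_symbol :: "real \<Rightarrow> real \<Rightarrow> real \<Rightarrow> real \<times> real \<Rightarrow> real" where
  "disp_symbol c lam mu \<zeta> = c * (fst \<zeta>)\<^sup>2 - mu * (snd \<zeta>)\<^sup>2 - \<bar>fst \<zeta>\<bar> * ((fst \<zeta>)\<^sup>2 + lam * (snd \<zeta>)\<^sup>2)"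

text \<open>The transform of the left side of the equation. In 1 / (8 pi^2), the factor 1/2 belongs
  to phi^2 / 2 and 1 / (4 pi^2) to the transform of a product. The symbol has the sign of the weak
  formulation, opposite to that of the overview.\<close>

definition defect :: "real \<Rightarrow> real \<Rightarrow> real \<Rightarrow> (real \<times> real \<Rightarrow> complex) \<Rightarrow> real \<times> real \<Rightarrow> complex" where
  "defect c lam mu F \<zeta> = F \<zeta> * of_real (disp_symbol c lam mu \<zeta>) + conv F \<zeta> * of_real (- (fst \<zeta>)\<^sup>2 / (8 * pi\<^sup>2))"

lemma disp_symbol_measurable [measurable]: "disp_symbol c lam mu \<in> borel_measurable borel"
  unfolding disp_symbol_def[abs_def] borel_prod[symmetric] by measurable

lemma weight_bounds:
  fixes x y :: real
  shows "x\<^sup>2 \<le> (1 + \<bar>x\<bar>) ^ 3 * (1 + \<bar>y\<bar>) ^ 3" "y\<^sup>2 \<le> (1 + \<bar>x\<bar>) ^ 3 * (1 + \<bar>y\<bar>) ^ 3"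
    "\<bar>x\<bar> * x\<^sup>2 \<le> (1 + \<bar>x\<bar>) ^ 3 * (1 + \<bar>y\<bar>) ^ 3" "\<bar>x\<bar> * y\<^sup>2 \<le> (1 + \<bar>x\<bar>) ^ 3 * (1 + \<bar>y\<bar>) ^ 3"
proof -
  have p: "\<bar>t\<bar> ^ k \<le> (1 + \<bar>t\<bar>) ^ 3" if "k \<le> 3" for t :: real and k
    using power_mono[of "\<bar>t\<bar>" "1 + \<bar>t\<bar>" k] power_increasing[of k 3 "1 + \<bar>t\<bar>"] that by linarith
  have q: "\<bar>x\<bar> ^ i * \<bar>y\<bar> ^ j \<le> (1 + \<bar>x\<bar>) ^ 3 * (1 + \<bar>y\<bar>) ^ 3" if "i \<le> 3" "j \<le> 3" for i j
    by (intro mult_mono p that) auto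
  have e: "\<bar>x\<bar> ^ 3 = \<bar>x\<bar> * x\<^sup>2" by (simp add: power3_eq_cube power2_eq_square)
  show "x\<^sup>2 \<le> (1 + \<bar>x\<bar>) ^ 3 * (1 + \<bar>y\<bar>) ^ 3" using q[of 2 0] by simp
  show "y\<^sup>2 \<le> (1 + \<bar>x\<bar>) ^ 3 * (1 + \<bar>y\<bar>) ^ 3" using q[of 0 2] by simp
  show "\<bar>x\<bar> * x\<^sup>2 \<le> (1 + \<bar>x\<bar>) ^ 3 * (1 + \<bar>y\<bar>) ^ 3" using q[of 3 0] unfolding e by simp
  show "\<bar>x\<bar> * y\<^sup>2 \<le> (1 + \<bar>x\<bar>) ^ 3 * (1 + \<bar>y\<bar>) ^ 3" using q[of 1 2] by simp
qed

lemma disp_symbol_bound: "\<bar>disp_symbol c lam mu \<zeta>\<bar> \<le> (\<bar>c\<bar> + \<bar>mu\<bar> + 1 + \<bar>lam\<bar>) * ((1 + \<bar>fst \<zeta>\<bar>) ^ 3 * (1 + \<bar>snd \<zeta>\<bar>) ^ 3)"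
proof -
  obtain x y where z: "\<zeta> = (x, y)" by (cases \<zeta>)
  let ?P = "(1 + \<bar>x\<bar>) ^ 3 * (1 + \<bar>y\<bar>) ^ 3"
  have "disp_symbol c lam mu \<zeta> = c * x\<^sup>2 - mu * y\<^sup>2 - \<bar>x\<bar> * x\<^sup>2 - lam * (\<bar>x\<bar> * y\<^sup>2)"
    by (simp add: disp_symbol_def z algebra_simps)
  also have "\<bar>\<dots>\<bar> \<le> \<bar>c * x\<^sup>2\<bar> + \<bar>mu * y\<^sup>2\<bar> + \<bar>\<bar>x\<bar> * x\<^sup>2\<bar> + \<bar>lam * (\<bar>x\<bar> * y\<^sup>2)\<bar>" by linarith
  also have "\<dots> = \<bar>c\<bar> * x\<^sup>2 + \<bar>mu\<bar> * y\<^sup>2 + \<bar>x\<bar> * x\<^sup>2 + \<bar>lam\<bar> * (\<bar>x\<bar> * y\<^sup>2)" by (simp add: abs_mult)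
  also have "\<dots> \<le> \<bar>c\<bar> * ?P + \<bar>mu\<bar> * ?P + ?P + \<bar>lam\<bar> * ?P"
    by (rule add_mono[OF add_mono[OF add_mono[OF mult_left_mono[OF weight_bounds(1)] mult_left_mono[OF weight_bounds(2)]]
            weight_bounds(3)] mult_left_mono[OF weight_bounds(4)]]) auto
  also have "\<dots> = (\<bar>c\<bar> + \<bar>mu\<bar> + 1 + \<bar>lam\<bar>) * ?P" by (simp only: distrib_right mult_1)
  finally show ?thesis by (simp only: z fst_conv snd_conv)
qed

lemma L2_add_integrable:
  fixes f g :: "'a \<Rightarrow> complex"
  assumes "f \<in> borel_measurable M" "g \<in> borel_measurable M"
    and "integrable M (\<lambda>z. (cmod (f z))\<^sup>2)" and "integrable M (\<lambda>z. (cmod (g z))\<^sup>2)"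
  shows "integrable M (\<lambda>z. (cmod (f z + g z))\<^sup>2)"
  using L2_diff_integrable[of f M "\<lambda>z. - g z"] assms by simp

text \<open>F is in L^2 and \<open>conv F\<close> is merely bounded, so neither product with the
  growing symbol is integrable a priori. The rapid decay of the test transform supplies integrable,
  square integrable and bounded partners for both.\<close>

lemma defect_test:
  assumes F: "L2c F" and a: "test1 a" and b: "test1 b"
  shows "integrable lborel (\<lambda>\<zeta>. F \<zeta> * of_real (disp_symbol c lam mu \<zeta>) * inv_ft (tens a b) \<zeta>)"
    and "integrable lborel (\<lambda>\<zeta>. conv F \<zeta> * of_real (d * (fst \<zeta>)\<^sup>2) * inv_ft (tens a b) \<zeta>)"
    and "integrable lborel (\<lambda>\<zeta>. defect c lam mu F \<zeta> * inv_ft (tens a b) \<zeta>)"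
    and "integrable lborel (\<lambda>\<zeta>. (cmod (defect c lam mu F \<zeta> * inv_ft (tens a b) \<zeta>))\<^sup>2)"
proof -
  note [measurable] = L2c_D(1)[OF F] conv_props(1)[OF F]
  have fm [measurable]: "(fst :: real \<times> real \<Rightarrow> real) \<in> borel_measurable borel"
    by (intro borel_measurable_continuous_onI continuous_intros)
  note t = inv_ft_test[OF a b]
  define U where "U = inv_ft (tens a b)"
  have [measurable]: "U \<in> borel_measurable borel"
    using test_ft_L2(1)[OF t(2,3)] unfolding U_def t(1) by auto
  have U1: "integrable lborel (\<lambda>\<zeta>. of_real (disp_symbol c lam mu \<zeta>) * U \<zeta>)"
    "integrable lborel (\<lambda>\<zeta>. (cmod (of_real (disp_symbol c lam mu \<zeta>) * U \<zeta>))\<^sup>2)"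
    "\<exists>B. \<forall>\<zeta>. cmod (of_real (disp_symbol c lam mu \<zeta>) * U \<zeta>) \<le> B"
    using test_ft_weighted[OF t(2,3), of "\<lambda>\<zeta>. of_real (disp_symbol c lam mu \<zeta>)" "\<bar>c\<bar> + \<bar>mu\<bar> + 1 + \<bar>lam\<bar>" 3] disp_symbol_bound[of c lam mu]
    unfolding U_def t(1) by simp_all
  have U2: "integrable lborel (\<lambda>\<zeta>. of_real (d * (fst \<zeta>)\<^sup>2) * U \<zeta>)"
    "integrable lborel (\<lambda>\<zeta>. (cmod (of_real (d * (fst \<zeta>)\<^sup>2) * U \<zeta>))\<^sup>2)" for d
    using test_ft_weighted[OF t(2,3), of "\<lambda>\<zeta>. of_real (d * (fst \<zeta>)\<^sup>2)" "\<bar>d\<bar>" 3] weight_bounds(1)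
    unfolding U_def t(1) by (simp_all add: norm_mult norm_power abs_mult mult_left_mono)
  have i1: "integrable lborel (\<lambda>\<zeta>. F \<zeta> * (of_real (disp_symbol c lam mu \<zeta>) * U \<zeta>))"
    using U1 L2c_D(2)[OF F] by (intro integrable_mult_L2) auto
  have j1: "integrable lborel (\<lambda>\<zeta>. (cmod (F \<zeta> * (of_real (disp_symbol c lam mu \<zeta>) * U \<zeta>)))\<^sup>2)"
  proof -
    obtain B where "\<And>\<zeta>. cmod (of_real (disp_symbol c lam mu \<zeta>) * U \<zeta>) \<le> B" using U1(3) by blast
    then show ?thesis using L2c_D(2)[OF F] by (intro L2_mult_bounded) auto
  qed
  define D where "D = (LINT \<zeta>|lborel. (cmod (F \<zeta>))\<^sup>2)"
  have cD: "cmod (conv F \<zeta>) \<le> D" for \<zeta> unfolding D_def by (rule conv_props(2)[OF F])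
  have i2: "integrable lborel (\<lambda>\<zeta>. of_real (d * (fst \<zeta>)\<^sup>2) * U \<zeta> * conv F \<zeta>)" for d
  proof (rule integrable_dominated)
    show "integrable lborel (\<lambda>\<zeta>. cmod (of_real (d * (fst \<zeta>)\<^sup>2) * U \<zeta>) * D)" using U2(1) by auto
    show "cmod (of_real (d * (fst \<zeta>)\<^sup>2) * U \<zeta> * conv F \<zeta>) \<le> cmod (of_real (d * (fst \<zeta>)\<^sup>2) * U \<zeta>) * D" for \<zeta>
      unfolding norm_mult[of "_ * U \<zeta>"] by (intro mult_left_mono cD) auto
  qed measurable
  have j2: "integrable lborel (\<lambda>\<zeta>. (cmod (of_real (d * (fst \<zeta>)\<^sup>2) * U \<zeta> * conv F \<zeta>))\<^sup>2)" for d
    by (rule L2_mult_bounded[OF _ _ U2(2) cD]) measurable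
  show "integrable lborel (\<lambda>\<zeta>. F \<zeta> * of_real (disp_symbol c lam mu \<zeta>) * inv_ft (tens a b) \<zeta>)"
    using i1 by (simp only: U_def mult.assoc)
  show "integrable lborel (\<lambda>\<zeta>. conv F \<zeta> * of_real (d * (fst \<zeta>)\<^sup>2) * inv_ft (tens a b) \<zeta>)"
    using i2[of d] by (simp only: U_def mult.assoc mult.commute[of "conv F _"])
  have eq: "defect c lam mu F \<zeta> * inv_ft (tens a b) \<zeta> = F \<zeta> * (of_real (disp_symbol c lam mu \<zeta>) * U \<zeta>)
      + of_real ((- 1 / (8 * pi\<^sup>2)) * (fst \<zeta>)\<^sup>2) * U \<zeta> * conv F \<zeta>" for \<zeta>
    by (simp add: defect_def U_def algebra_simps)
  show "integrable lborel (\<lambda>\<zeta>. defect c lam mu F \<zeta> * inv_ft (tens a b) \<zeta>)"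
    unfolding eq by (intro Bochner_Integration.integrable_add i1 i2)
  show "integrable lborel (\<lambda>\<zeta>. (cmod (defect c lam mu F \<zeta> * inv_ft (tens a b) \<zeta>))\<^sup>2)"
    unfolding eq by (intro L2_add_integrable j1 j2) measurable
qed

text \<open>For real a and b the tensor is itself a real test function. Moving its derivatives to
  the Fourier side turns every term of the weak formulation into an integral against the same
  \<open>U\<close>.\<close>

lemma weak_solution_tested:
  assumes F: "fourier_L2 phi F" and a: "test1 a" "\<And>x. Im (a x) = 0" and b: "test1 b" "\<And>x. Im (b x) = 0"
    and w: "\<And>psi. test_fn psi \<Longrightarrow>
        complex_of_real (LINT z|lborel. (- c * phi z + (phi z)\<^sup>2 / 2) * pdx (pdx psi) z)
      + complex_of_real (mu * (LINT z|lborel. phi z * pdy (pdy psi) z))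
      + (LINT \<zeta>|lborel. complex_of_real (- \<bar>fst \<zeta>\<bar> * ((fst \<zeta>)\<^sup>2 + lam * (snd \<zeta>)\<^sup>2) / (4 * pi\<^sup>2))
                         * F \<zeta> * cnj (ft psi \<zeta>)) = 0"
  shows "(LINT \<zeta>|lborel. defect c lam mu F \<zeta> * inv_ft (tens a b) \<zeta>) = 0"
proof -
  have f: "L2 phi" "L2c F" using F by (auto simp: fourier_L2_def)
  note [measurable] = L2_of_real(1)[OF f(1)] L2c_D(1)[OF f(2)] conv_props(1)[OF f(2)]
  note F2 = L2c_D(2)[OF f(2)]
  obtain a1 where a1: "\<And>x. (a has_vector_derivative a1 x) (at x)" "test1 a1" using test1_deriv[OF a(1)] by blast
  obtain a2 where a2: "\<And>x. (a1 has_vector_derivative a2 x) (at x)" "test1 a2" using test1_deriv[OF a1(2)] by blast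
  obtain b1 where b1: "\<And>x. (b has_vector_derivative b1 x) (at x)" "test1 b1" using test1_deriv[OF b(1)] by blast
  obtain b2 where b2: "\<And>x. (b1 has_vector_derivative b2 x) (at x)" "test1 b2" using test1_deriv[OF b1(2)] by blast
  have r1: "Im (a1 x) = 0" "Im (b1 x) = 0" for x using deriv_real_valued a1 b1 a b by blast+
  have r2: "Im (a2 x) = 0" "Im (b2 x) = 0" for x using deriv_real_valued a2 b2 r1 by blast+
  define psi where "psi z = Re (tens a b z)" for z
  have psi: "test_fn psi" unfolding psi_def[abs_def] by (intro test_fn_Re_tens a b)
  have dxx: "pdx (pdx psi) = (\<lambda>z. Re (tens a2 b z))"
    unfolding psi_def[abs_def] using pd_Re_tens(1)[OF a1(1)] pd_Re_tens(1)[OF a2(1)] by simp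
  have dyy: "pdy (pdy psi) = (\<lambda>z. Re (tens a b2 z))"
    unfolding psi_def[abs_def] using pd_Re_tens(2)[OF b1(1)] pd_Re_tens(2)[OF b2(1)] by simp
  define U where "U = inv_ft (tens a b)"
  have U: "U \<zeta> = ft1 a (- fst \<zeta>) * ft1 b (- snd \<zeta>)" for \<zeta>
    unfolding U_def by (intro inv_ft_tens test1_integrable a b)
  \<comment> \<open>Conjugating the transform of a real function reflects the frequency, which is
    exactly \<open>inv_ft\<close>.\<close>
  have cft: "cnj (ft psi \<zeta>) = U \<zeta>" for \<zeta>
    unfolding psi_def[abs_def] U using a b
    by (subst ft_Re_tens) (auto simp: tens_def cnj_ft1 test1_integrable)
  have Ux: "inv_ft (tens a2 b) \<zeta> = - of_real ((fst \<zeta>)\<^sup>2) * U \<zeta>" for \<zeta>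
  proof -
    have "inv_ft (tens a2 b) \<zeta> = ft1 a2 (- fst \<zeta>) * ft1 b (- snd \<zeta>)"
      by (intro inv_ft_tens test1_integrable a2 b)
    also have "\<dots> = (\<i> * \<i>) * of_real ((fst \<zeta>)\<^sup>2) * U \<zeta>"
      by (simp add: U ft1_deriv[OF a1(2) a2] ft1_deriv[OF a(1) a1] power2_eq_square mult_ac del: i_squared complex_i_mult_minus)
    finally show ?thesis by simp
  qed
  have Uy: "inv_ft (tens a b2) \<zeta> = - of_real ((snd \<zeta>)\<^sup>2) * U \<zeta>" for \<zeta>
  proof -
    have "inv_ft (tens a b2) \<zeta> = ft1 a (- fst \<zeta>) * ft1 b2 (- snd \<zeta>)"
      by (intro inv_ft_tens test1_integrable a b2)
    also have "\<dots> = (\<i> * \<i>) * of_real ((snd \<zeta>)\<^sup>2) * U \<zeta>"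
      by (simp add: U ft1_deriv[OF b1(2) b2] ft1_deriv[OF b(1) b1] power2_eq_square mult_ac del: i_squared complex_i_mult_minus)
    finally show ?thesis by simp
  qed
  have pars: "(LINT z|lborel. complex_of_real (phi z) * tens p q z) = (LINT \<zeta>|lborel. F \<zeta> * inv_ft (tens p q) \<zeta>) / of_real (4 * pi\<^sup>2)"
    and parsi: "integrable lborel (\<lambda>\<zeta>. F \<zeta> * inv_ft (tens p q) \<zeta>)"
    if "test1 p" "test1 q" for p q
  proof -
    show i: "integrable lborel (\<lambda>\<zeta>. F \<zeta> * inv_ft (tens p q) \<zeta>)"
      unfolding inv_ft_test(1)[OF that]
      using test_ft_L2[OF inv_ft_test(2,3)[OF that]] F2 by (intro integrable_mult_L2) auto
    show "(LINT z|lborel. complex_of_real (phi z) * tens p q z) = (LINT \<zeta>|lborel. F \<zeta> * inv_ft (tens p q) \<zeta>) / of_real (4 * pi\<^sup>2)"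
      by (rule parseval[OF F test_tens_L2(1,2)[OF that] i])
  qed
  have iphi: "integrable lborel (\<lambda>z. complex_of_real (phi z) * tens a2 b z)"
    using test_tens_L2[OF a2(2) b(1)] L2_of_real[OF f(1)] by (intro integrable_mult_L2) auto
  have iphi2: "integrable lborel (\<lambda>z. complex_of_real ((phi z)\<^sup>2) * tens a2 b z)"
  proof -
    obtain B where B: "\<And>z. cmod (tens a2 b z) \<le> B" using test_tens_L2(3)[OF a2(2) b(1)] by blast
    have i: "integrable lborel (\<lambda>z. (phi z)\<^sup>2)" using f(1) by (simp add: L2_def)
    have [measurable]: "tens a2 b \<in> borel_measurable borel" "phi \<in> borel_measurable borel"
      using iphi test_tens_L2(1)[OF a2(2) b(1)] f(1) by (auto simp: L2_def)
    show ?thesis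
    proof (rule integrable_dominated)
      show "integrable lborel (\<lambda>z. (phi z)\<^sup>2 * B)" using i by auto
      show "cmod (complex_of_real ((phi z)\<^sup>2) * tens a2 b z) \<le> (phi z)\<^sup>2 * B" for z
        unfolding norm_mult norm_of_real abs_power2 by (rule mult_left_mono[OF B]) simp
    qed measurable
  qed
  have t1: "complex_of_real (LINT z|lborel. (- c * phi z + (phi z)\<^sup>2 / 2) * pdx (pdx psi) z)
     = - of_real c * (LINT z|lborel. complex_of_real (phi z) * tens a2 b z) + (LINT z|lborel. complex_of_real ((phi z)\<^sup>2) * tens a2 b z) / 2"
  proof -
    have re: "complex_of_real (Re (tens a2 b z)) = tens a2 b z" for z
      using r2 b by (simp add: tens_def complex_eq_iff)
    have "complex_of_real (LINT z|lborel. (- c * phi z + (phi z)\<^sup>2 / 2) * pdx (pdx psi) z)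
       = (LINT z|lborel. complex_of_real ((- c * phi z + (phi z)\<^sup>2 / 2) * Re (tens a2 b z)))"
      unfolding dxx by (rule integral_complex_of_real[symmetric])
    also have "\<dots> = (LINT z|lborel. - of_real c * (complex_of_real (phi z) * tens a2 b z) + complex_of_real ((phi z)\<^sup>2) * tens a2 b z / 2)"
      unfolding of_real_mult re by (intro Bochner_Integration.integral_cong refl) (simp add: algebra_simps)
    also have "\<dots> = (LINT z|lborel. - of_real c * (complex_of_real (phi z) * tens a2 b z)) + (LINT z|lborel. complex_of_real ((phi z)\<^sup>2) * tens a2 b z / 2)"
    proof (rule Bochner_Integration.integral_add)
      show "integrable lborel (\<lambda>z. - of_real c * (complex_of_real (phi z) * tens a2 b z))"
        by (rule integrable_mult_right) (rule iphi)
      show "integrable lborel (\<lambda>z. complex_of_real ((phi z)\<^sup>2) * tens a2 b z / 2)"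
        by (rule integrable_divide_zero) (rule iphi2)
    qed
    finally show ?thesis by (simp only: integral_mult_right_zero integral_divide_zero)
  qed
  have t2: "complex_of_real (mu * (LINT z|lborel. phi z * pdy (pdy psi) z)) = of_real mu * (LINT z|lborel. complex_of_real (phi z) * tens a b2 z)"
  proof -
    have re: "complex_of_real (Re (tens a b2 z)) = tens a b2 z" for z
      using r2 a by (simp add: tens_def complex_eq_iff)
    show ?thesis unfolding dyy of_real_mult integral_complex_of_real[symmetric] re ..
  qed
  define K where "K = complex_of_real (4 * pi\<^sup>2)"
  have K0: "K \<noteq> 0" by (simp add: K_def)
  define T where "T \<zeta> = complex_of_real (- \<bar>fst \<zeta>\<bar> * ((fst \<zeta>)\<^sup>2 + lam * (snd \<zeta>)\<^sup>2)) * F \<zeta> * U \<zeta>" for \<zeta>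
  have t3: "(LINT \<zeta>|lborel. complex_of_real (- \<bar>fst \<zeta>\<bar> * ((fst \<zeta>)\<^sup>2 + lam * (snd \<zeta>)\<^sup>2) / (4 * pi\<^sup>2)) * F \<zeta> * cnj (ft psi \<zeta>))
      = (LINT \<zeta>|lborel. T \<zeta>) / K"
    unfolding integral_divide_zero[symmetric] cft T_def K_def
    by (intro Bochner_Integration.integral_cong refl) (simp add: field_simps)
  have t4: "(LINT z|lborel. complex_of_real ((phi z)\<^sup>2) * tens a2 b z) = (LINT \<tau>|lborel. conv F \<tau> * inv_ft (tens a2 b) \<tau>) / K\<^sup>2"
    unfolding K_def by (rule fourier_square[OF F a2(2) b(1)])
  have ix: "integrable lborel (\<lambda>\<zeta>. F \<zeta> * inv_ft (tens a2 b) \<zeta>)" by (rule parsi[OF a2(2) b(1)])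
  have iy: "integrable lborel (\<lambda>\<zeta>. F \<zeta> * inv_ft (tens a b2) \<zeta>)" by (rule parsi[OF a(1) b2(2)])
  have ic: "integrable lborel (\<lambda>\<zeta>. conv F \<zeta> * inv_ft (tens a2 b) \<zeta>)"
    using defect_test(2)[OF f(2) a(1) b(1), of "-1"] by (simp add: Ux U_def mult.assoc)
  have iT: "integrable lborel T"
  proof -
    \<comment> \<open>Setting c = mu = 0 isolates the nonlocal part of the symbol, so the general
      integrability statement applies.\<close>
    have "T \<zeta> = F \<zeta> * of_real (disp_symbol 0 lam 0 \<zeta>) * inv_ft (tens a b) \<zeta>" for \<zeta>
      by (simp add: T_def U_def disp_symbol_def)
    then show ?thesis using defect_test(1)[OF f(2) a(1) b(1), of 0 lam 0] by presburger
  qed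
  have "0 = - of_real c * ((LINT \<zeta>|lborel. F \<zeta> * inv_ft (tens a2 b) \<zeta>) / K) + (LINT \<tau>|lborel. conv F \<tau> * inv_ft (tens a2 b) \<tau>) / K\<^sup>2 / 2
     + of_real mu * ((LINT \<zeta>|lborel. F \<zeta> * inv_ft (tens a b2) \<zeta>) / K) + (LINT \<zeta>|lborel. T \<zeta>) / K"
    using w[OF psi] unfolding t1 t2 t3 t4 pars[OF a2(2) b(1)] pars[OF a(1) b2(2)] K_def[symmetric] by simp
  \<comment> \<open>One factor K = 4 pi^2 is common to all terms. The quadratic term has K^2, so it
    keeps 1 / (2 K) = 1 / (8 pi^2).\<close>
  also have "\<dots> = (- of_real c * (LINT \<zeta>|lborel. F \<zeta> * inv_ft (tens a2 b) \<zeta>) + (LINT \<tau>|lborel. conv F \<tau> * inv_ft (tens a2 b) \<tau>) * (1 / (2 * K))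
     + of_real mu * (LINT \<zeta>|lborel. F \<zeta> * inv_ft (tens a b2) \<zeta>) + (LINT \<zeta>|lborel. T \<zeta>)) / K"
    using K0 by (simp add: field_simps power2_eq_square)
  also have "- of_real c * (LINT \<zeta>|lborel. F \<zeta> * inv_ft (tens a2 b) \<zeta>) + (LINT \<tau>|lborel. conv F \<tau> * inv_ft (tens a2 b) \<tau>) * (1 / (2 * K))
     + of_real mu * (LINT \<zeta>|lborel. F \<zeta> * inv_ft (tens a b2) \<zeta>) + (LINT \<zeta>|lborel. T \<zeta>)
    = (LINT \<zeta>|lborel. - of_real c * (F \<zeta> * inv_ft (tens a2 b) \<zeta>) + conv F \<zeta> * inv_ft (tens a2 b) \<zeta> * (1 / (2 * K))
        + of_real mu * (F \<zeta> * inv_ft (tens a b2) \<zeta>) + T \<zeta>)"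
    using ix iy ic iT by simp
  also have "\<dots> = (LINT \<zeta>|lborel. defect c lam mu F \<zeta> * inv_ft (tens a b) \<zeta>)"
    by (intro Bochner_Integration.integral_cong refl)
       (simp add: T_def Ux Uy defect_def disp_symbol_def U_def[symmetric] K_def algebra_simps)
  finally show ?thesis using K0 by simp
qed

text \<open>Bumps of width eps n centred at w are real test functions, and their inverse transforms
  are a fixed damping k (eps n \<zeta>) times \<open>iexp\<close>. Testing with them says that the
  damped defect has vanishing inverse transform at every w.\<close>

lemma weak_solution_symbol:
  assumes "weak_solution c lam mu phi"
  obtains F where "fourier_L2 phi F" "AE \<zeta> in lborel. defect c lam mu F \<zeta> = 0"
proof -
  obtain F where F: "fourier_L2 phi F" and w: "\<And>psi. test_fn psi \<Longrightarrow>
        complex_of_real (LINT z|lborel. (- c * phi z + (phi z)\<^sup>2 / 2) * pdx (pdx psi) z)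
      + complex_of_real (mu * (LINT z|lborel. phi z * pdy (pdy psi) z))
      + (LINT \<zeta>|lborel. complex_of_real (- \<bar>fst \<zeta>\<bar> * ((fst \<zeta>)\<^sup>2 + lam * (snd \<zeta>)\<^sup>2) / (4 * pi\<^sup>2))
                         * F \<zeta> * cnj (ft psi \<zeta>)) = 0"
    using assms unfolding weak_solution_def by blast
  have L: "L2c F" using F by (simp add: fourier_L2_def)
  let ?B = "ft1 (\<lambda>x. of_real (bump x))"
  define k where "k \<zeta> = ?B (- fst \<zeta>) * ?B (- snd \<zeta>)" for \<zeta> :: "real \<times> real"
  \<comment> \<open>An approximate identity at w: the prefactor 1 / eps n cancels the Jacobian, so
    the damping factor depends on n only through dilation.\<close>
  define bb where "bb n w x = complex_of_real (bump ((1 / eps n) * x + (- w / eps n)) * (1 / eps n))" for n w x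
  have tb: "test1 (bb n w)" for n w
  proof -
    have "test1 (\<lambda>x. complex_of_real (bump ((1 / eps n) * x + (- w / eps n))) * of_real (1 / eps n))"
      using eps(3)[of n] by (intro test1_mult C_diff_const test1_affine[OF test1_bump]) auto
    then show ?thesis by (simp add: bb_def[abs_def])
  qed
  have ftb: "ft1 (bb n w) (- x) = iexp (w * x) * ?B (- (eps n * x))" for n w x
  proof -
    have e: "eps n \<noteq> 0" "eps n > 0" using eps by auto
    have "ft1 (bb n w) (- x) = eps n *\<^sub>R (LINT \<xi>|lborel. bb n w (w + eps n * \<xi>) * exp (- \<i> * of_real (- x * (w + eps n * \<xi>))))"
      unfolding ft1_def using e by (subst lborel_integral_real_affine[of "eps n" _ w]) auto
    also have "\<dots> = (LINT \<xi>|lborel. iexp (w * x) * (complex_of_real (bump \<xi>) * exp (- \<i> * of_real (- (eps n * x) * \<xi>))))"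
      unfolding integral_scaleR_right[symmetric]
    proof (intro Bochner_Integration.integral_cong refl)
      fix \<xi>
      have "1 / eps n * (w + eps n * \<xi>) + - w / eps n = \<xi>" using e by (simp add: field_simps)
      then have "eps n *\<^sub>R bb n w (w + eps n * \<xi>) = of_real (bump \<xi>)"
        using e by (simp add: bb_def scaleR_conv_of_real)
      moreover have "exp (- \<i> * of_real (- x * (w + eps n * \<xi>))) = iexp (w * x) * exp (- \<i> * of_real (- (eps n * x) * \<xi>))"
        by (simp add: exp_add[symmetric] algebra_simps)
      ultimately have "eps n *\<^sub>R bb n w (w + eps n * \<xi>) * exp (- \<i> * of_real (- x * (w + eps n * \<xi>)))
          = of_real (bump \<xi>) * (iexp (w * x) * exp (- \<i> * of_real (- (eps n * x) * \<xi>)))"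
        by (simp only:)
      then show "eps n *\<^sub>R (bb n w (w + eps n * \<xi>) * exp (- \<i> * of_real (- x * (w + eps n * \<xi>))))
          = iexp (w * x) * (complex_of_real (bump \<xi>) * exp (- \<i> * of_real (- (eps n * x) * \<xi>)))"
        by (simp only: mult_scaleR_left mult.left_commute)
    qed
    finally show ?thesis by (simp only: ft1_def integral_mult_right_zero)
  qed
  have U: "inv_ft (tens (bb n (fst w)) (bb n (snd w))) \<zeta> = k (eps n *\<^sub>R \<zeta>) * iexp (\<zeta> \<bullet> w)" for n w \<zeta>
    by (subst inner_commute, subst iexp_tens, subst inv_ft_tens)
       (auto simp: ftb k_def tens_def tb test1_integrable mult_ac)
  have "AE \<zeta> in lborel. defect c lam mu F \<zeta> = 0"
  proof (rule AE_eq_0_of_localised[of k])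
    have c: "continuous_on UNIV ?B" by (rule ft1_continuous[OF test1_bump])
    have "continuous_on UNIV k" unfolding k_def
      by (intro continuous_intros continuous_on_compose2[OF c]) auto
    then show "isCont k 0" using continuous_on_eq_continuous_at[OF open_UNIV] by blast
    show "k 0 \<noteq> 0" using ft1_bump_0 by (simp add: k_def)
    show "integrable lborel (\<lambda>\<zeta>. defect c lam mu F \<zeta> * k (eps n *\<^sub>R \<zeta>))"
      "integrable lborel (\<lambda>\<zeta>. (cmod (defect c lam mu F \<zeta> * k (eps n *\<^sub>R \<zeta>)))\<^sup>2)" for n
      using defect_test(3,4)[OF L tb tb, of c lam mu n 0 n 0] U[of n 0] by simp_all
    show "inv_ft (\<lambda>\<zeta>. defect c lam mu F \<zeta> * k (eps n *\<^sub>R \<zeta>)) w = 0" for n w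
    proof -
      have "(LINT \<zeta>|lborel. defect c lam mu F \<zeta> * inv_ft (tens (bb n (fst w)) (bb n (snd w))) \<zeta>) = 0"
        by (rule weak_solution_tested[OF F tb _ tb _ w]) (auto simp: bb_def)
      then show ?thesis unfolding U by (simp add: inv_ft_def mult.assoc)
    qed
  qed
  then show ?thesis using that F by blast
qed

section \<open>Exponential decay from the high-frequency inequality\<close>

lemma integrable_powr_weight: "integrable lborel (\<lambda>x::real. (1 + \<bar>x\<bar>) powr (- 13 / 12))"
proof -
  let ?f = "\<lambda>x::real. (1 + x) powr (- 13 / 12)"
  have "(\<integral>\<^sup>+x. ennreal (?f x) * indicator {0..} x \<partial>lborel) = ennreal (0 - (- 12 * (1 + 0) powr (- 1 / 12)))"
  proof (rule nn_integral_FTC_atLeast)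
    show "DERIV (\<lambda>x. - 12 * (1 + x) powr (- 1 / 12)) x :> ?f x" if "0 \<le> x" for x :: real
      using that by (auto intro!: derivative_eq_intros)
    have "((\<lambda>x::real. - 12 * (1 + x) powr (- 1 / 12)) \<longlongrightarrow> - 12 * 0) at_top"
      by (intro tendsto_mult tendsto_const tendsto_neg_powr filterlim_tendsto_add_at_top[OF tendsto_const] filterlim_ident) auto
    then show "((\<lambda>x::real. - 12 * (1 + x) powr (- 1 / 12)) \<longlongrightarrow> 0) at_top" by simp
  qed auto
  then have i: "integrable lborel (\<lambda>x. ?f x * indicator {0..} x)"
    by (intro integrableI_nonneg) (auto simp: ennreal_mult' ennreal_indicator)
  have i': "integrable lborel (\<lambda>x. ?f (- x) * indicator {0..} (- x))"
    using integrable_lborel_reflect[OF i, of 0] by simp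
  show ?thesis
    by (rule integrable_dominated[OF Bochner_Integration.integrable_add[OF i i']])
       (auto simp: indicator_def abs_if)
qed

definition br :: "real \<times> real \<Rightarrow> real" where "br z = 1 + norm z"

lemma br_ge1: "br z \<ge> 1" "br z > 0" "br z \<ge> 0" "br z \<noteq> 0"
  by (auto simp: br_def intro: add_pos_nonneg add_nonneg_eq_0_iff[THEN iffD1])
     (metis add_nonneg_eq_0_iff norm_ge_zero zero_le_one zero_neq_one)

lemma br_measurable [measurable]: "br \<in> borel_measurable borel"
  unfolding br_def[abs_def] by measurable

text \<open>13/6 exceeds the dimension 2. Half of it, 13/12, is spent on each coordinate, where it
  still exceeds 1.\<close>

lemma integrable_br_powr: "integrable lborel (\<lambda>z. br z powr (- 13 / 6))"
proof -
  let ?w = "\<lambda>x::real. complex_of_real ((1 + \<bar>x\<bar>) powr (- 13 / 12))"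
  have i: "integrable lborel (\<lambda>z. cmod (tens ?w ?w z))"
    by (intro integrable_norm tens_integral integrable_of_real integrable_powr_weight)
  show ?thesis
  proof (rule integrable_dominated[OF i])
    show "norm (br z powr (- 13 / 6)) \<le> cmod (tens ?w ?w z)" for z
    proof -
      obtain x y where z: "z = (x, y)" by (cases z)
      have n: "\<bar>x\<bar> \<le> norm z" "\<bar>y\<bar> \<le> norm z"
        using norm_fst_le[of x y] norm_snd_le[of y x] by (auto simp: z)
      have "br z powr (- 13 / 6) = br z powr (- 13 / 12) * br z powr (- 13 / 12)"
        by (simp add: powr_add[symmetric])
      also have "\<dots> \<le> (1 + \<bar>x\<bar>) powr (- 13 / 12) * (1 + \<bar>y\<bar>) powr (- 13 / 12)"
        using n by (intro mult_mono powr_mono2') (auto simp: br_def)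
      finally show ?thesis
        by (simp add: tens_def z norm_mult)
    qed
  qed measurable
qed

text \<open>All that the decay argument needs to know about the equation. Within radius R nothing is
  assumed beyond weighted square integrability, since the symbol may vanish there.\<close>

locale high_frequency_inequality =
  fixes f :: "real \<times> real \<Rightarrow> real" and A R :: real
  assumes meas [measurable]: "f \<in> borel_measurable borel"
    and nonneg: "\<And>z. f z \<ge> 0"
    and weighted: "integrable lborel (\<lambda>z. br z * (f z)\<^sup>2)"
    and A: "A \<ge> 0" and R: "R \<ge> 0"
    and ineq: "AE z in lborel. norm z \<ge> R \<longrightarrow> f z \<le> A * br z powr (- 2 / 3) * (LINT w|lborel. f w * f (z - w))"
begin

definition C :: "real \<times> real \<Rightarrow> real" where "C z = (LINT w|lborel. f w * f (z - w))"

definition D :: real where "D = (LINT w|lborel. (f w)\<^sup>2)"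

lemma square_integrable: "integrable lborel (\<lambda>z. (f z)\<^sup>2)"
proof (rule integrable_dominated[OF weighted])
  show "norm ((f z)\<^sup>2) \<le> br z * (f z)\<^sup>2" for z
    using mult_right_mono[OF br_ge1(1)[of z] zero_le_power2[of "f z"]] by simp
qed auto

lemma L2c_f: "L2c (\<lambda>z. complex_of_real (f z))"
  using square_integrable by (simp add: L2c_def)

lemma C_integrable: "integrable lborel (\<lambda>w. f w * f (z - w))"
  using integrable_Re[OF conv_integrable(1)[OF L2c_f, of z]] by simp

lemma C_props: "C \<in> borel_measurable borel" "C z \<ge> 0" "C z \<le> D"
proof -
  show "C \<in> borel_measurable borel" unfolding C_def by measurable
  show "C z \<ge> 0" unfolding C_def by (intro integral_nonneg_AE AE_I2 mult_nonneg_nonneg nonneg)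
  show "C z \<le> D"
    using conv_integrable(2)[OF L2c_f, of z] by (simp add: C_def D_def norm_mult nonneg abs_mult)
qed

lemma D_nonneg: "D \<ge> 0" unfolding D_def by simp

lemma ineq': "AE z in lborel. norm z \<ge> R \<longrightarrow> f z \<le> A * br z powr (- 2 / 3) * C z"
  using ineq by (simp add: C_def)

text \<open>The exponent \<open>7/12\<close> may be any number strictly between \<open>1/2\<close>, so that the integral \<open>K\<close> converges, and
  \<open>2/3\<close>, so that the iteration gains decay.\<close>

definition K :: real where "K = (LINT z|lborel. f z * br z powr (- 7 / 12))"

text \<open>The power -7/12 splits as 1/2 - 13/12: f times the first factor is in L^2 by the energy
  bound, and the second factor is in L^2 because 13/6 > 2.\<close>

lemma K_integrable: "integrable lborel (\<lambda>z. f z * br z powr (- 7 / 12))"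
proof (rule integrable_dominated[OF Bochner_Integration.integrable_add[OF weighted integrable_br_powr]])
  show "norm (f z * br z powr (- 7 / 12)) \<le> br z * (f z)\<^sup>2 + br z powr (- 13 / 6)" for z
  proof -
    let ?a = "f z * br z powr (1 / 2)" and ?b = "br z powr (- 13 / 12)"
    have "f z * br z powr (- 7 / 12) = ?a * ?b" by (simp add: mult.assoc powr_add[symmetric])
    also have "\<dots> \<le> ?a\<^sup>2 + ?b\<^sup>2" using nonneg[of z] by (intro mult_le_sum_squares) auto
    also have "\<dots> = br z * (f z)\<^sup>2 + br z powr (- 13 / 6)"
      using br_ge1[of z] by (simp add: power_mult_distrib power2_eq_square[of "_ powr _"] powr_add[symmetric])
    finally show ?thesis
      using nonneg[of z] by simp
  qed
qed measurable

lemma K_nonneg: "K \<ge> 0" unfolding K_def by (intro integral_nonneg_AE AE_I2 mult_nonneg_nonneg nonneg) auto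

text \<open>The larger of w and z - w has norm at least |z| / 2, hence at least R, so its decay is
  known. All but 7/12 of that decay is converted into decay in z, and the remaining 7/12 is handed
  to the smaller argument to make the product integrable.\<close>

lemma convolution_pointwise:
  assumes B: "B \<ge> 0" and \<alpha>: "\<alpha> \<ge> 7 / 12" and z: "norm z \<ge> 2 * R"
    and w: "norm w \<le> norm (z - w)" and bd: "norm (z - w) \<ge> R \<longrightarrow> f (z - w) \<le> B * br (z - w) powr (- \<alpha>)"
  shows "f w * f (z - w) \<le> B * 2 powr (\<alpha> - 7 / 12) * br z powr (7 / 12 - \<alpha>) * (f w * br w powr (- 7 / 12))"
proof -
  have tri: "norm z \<le> norm w + norm (z - w)" using norm_triangle_ineq[of w "z - w"] by simp
  then have "norm (z - w) \<ge> R" using z w by linarith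
  then have "f (z - w) \<le> B * br (z - w) powr (- \<alpha>)" using bd by simp
  also have "br (z - w) powr (- \<alpha>) = br (z - w) powr (7 / 12 - \<alpha>) * br (z - w) powr (- 7 / 12)"
    by (simp add: powr_add[symmetric])
  also have "\<dots> \<le> (br z / 2) powr (7 / 12 - \<alpha>) * br w powr (- 7 / 12)"
    using tri w \<alpha> br_ge1[of z] br_ge1[of w] by (intro mult_mono powr_mono2') (auto simp: br_def)
  also have "(br z / 2) powr (7 / 12 - \<alpha>) = 2 powr (\<alpha> - 7 / 12) * br z powr (7 / 12 - \<alpha>)"
    using br_ge1[of z] powr_minus_divide[of 2 "7 / 12 - \<alpha>"] by (simp add: powr_divide)
  finally have "f (z - w) \<le> B * (2 powr (\<alpha> - 7 / 12) * br z powr (7 / 12 - \<alpha>) * br w powr (- 7 / 12))"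
    using B by (simp add: mult_left_mono)
  then have "f w * f (z - w) \<le> f w * (B * (2 powr (\<alpha> - 7 / 12) * br z powr (7 / 12 - \<alpha>) * br w powr (- 7 / 12)))"
    by (rule mult_left_mono[OF _ nonneg])
  then show ?thesis by (simp only: mult_ac)
qed

text \<open>The convolution inherits decay \<alpha> - 7/12 and the inequality contributes 2/3, a net
  gain of 1/12.\<close>

lemma decay_step:
  assumes B: "B \<ge> 0" and \<alpha>: "\<alpha> \<ge> 7 / 12"
    and bd: "AE z in lborel. norm z \<ge> R \<longrightarrow> f z \<le> B * br z powr (- \<alpha>)"
  shows "\<exists>B'\<ge>0. AE z in lborel. norm z \<ge> R \<longrightarrow> f z \<le> B' * br z powr (- (\<alpha> + 1 / 12))"
proof -
  define M where "M = B * 2 powr (\<alpha> - 7 / 12)"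
  have M: "M \<ge> 0" using B by (simp add: M_def)
  have far: "C z \<le> 2 * M * K * br z powr (7 / 12 - \<alpha>)" if z: "norm z \<ge> 2 * R" for z
  proof -
    let ?k = "\<lambda>w. f w * br w powr (- 7 / 12)"
    define E where "E = M * br z powr (7 / 12 - \<alpha>)"
    have E: "E \<ge> 0" using M by (simp add: E_def)
    have kr: "integrable lborel (\<lambda>w. ?k (z - w))" by (rule integrable_lborel_reflect[OF K_integrable])
    have ae: "AE w in lborel. f w * f (z - w) \<le> E * (?k w + ?k (z - w))"
      using bd AE_lborel_reflect[OF bd, of z]
    proof eventually_elim
      case (elim w)
      have nk: "?k w \<ge> 0" "?k (z - w) \<ge> 0" using nonneg by auto
      show ?case
      proof (cases "norm w \<le> norm (z - w)")
        case True
        have "f w * f (z - w) \<le> E * ?k w"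
          using convolution_pointwise[OF B \<alpha> z True elim(2)] by (simp add: E_def M_def mult_ac)
        also have "\<dots> \<le> E * (?k w + ?k (z - w))" using E nk by (intro mult_left_mono) auto
        finally show ?thesis .
      next
        case False
        \<comment> \<open>The roles of w and z - w are exchanged, using z - (z - w) = w.\<close>
        have "f (z - w) * f (z - (z - w)) \<le> E * ?k (z - w)"
          using convolution_pointwise[OF B \<alpha> z, of "z - w"] False elim(1) by (simp add: E_def M_def mult_ac)
        also have "\<dots> \<le> E * (?k w + ?k (z - w))" using E nk by (intro mult_left_mono) auto
        finally show ?thesis by (simp add: mult.commute)
      qed
    qed
    have "C z \<le> (LINT w|lborel. E * (?k w + ?k (z - w)))"
      unfolding C_def by (rule integral_mono_AE[OF C_integrable _ ae]) (use K_integrable kr in auto)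
    also have "\<dots> = E * (K + (LINT w|lborel. ?k (z - w)))"
      using K_integrable kr by (simp add: K_def)
    also have "(LINT w|lborel. ?k (z - w)) = K" unfolding K_def by (rule integral_lborel_reflect) measurable
    finally show ?thesis by (simp add: E_def mult_ac)
  qed
  \<comment> \<open>On a bounded set the power of \<open>br\<close> is bounded below, so the uniform
    bound \<open>D\<close> is enough.\<close>
  have near: "C z \<le> D * (1 + 2 * R) powr (\<alpha> - 7 / 12) * br z powr (7 / 12 - \<alpha>)" if z: "norm z \<le> 2 * R" for z
  proof -
    have "1 = br z powr (\<alpha> - 7 / 12) * br z powr (7 / 12 - \<alpha>)"
      using br_ge1[of z] by (simp add: powr_add[symmetric])
    also have "\<dots> \<le> (1 + 2 * R) powr (\<alpha> - 7 / 12) * br z powr (7 / 12 - \<alpha>)"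
      using z \<alpha> by (intro mult_right_mono powr_mono2) (auto simp: br_def)
    finally have "D * 1 \<le> D * ((1 + 2 * R) powr (\<alpha> - 7 / 12) * br z powr (7 / 12 - \<alpha>))"
      by (rule mult_left_mono[OF _ D_nonneg])
    then show ?thesis using C_props(3)[of z] by (simp add: mult.assoc)
  qed
  define N where "N = 2 * M * K + D * (1 + 2 * R) powr (\<alpha> - 7 / 12)"
  have MK: "2 * M * K \<ge> 0" "D * (1 + 2 * R) powr (\<alpha> - 7 / 12) \<ge> 0" using M K_nonneg D_nonneg by auto
  have C_le: "C z \<le> N * br z powr (7 / 12 - \<alpha>)" for z
  proof (cases "norm z \<ge> 2 * R")
    case True
    have "2 * M * K * br z powr (7 / 12 - \<alpha>) \<le> N * br z powr (7 / 12 - \<alpha>)"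
      using MK by (intro mult_right_mono) (auto simp: N_def)
    then show ?thesis using far[OF True] by linarith
  next
    case False
    have "D * (1 + 2 * R) powr (\<alpha> - 7 / 12) * br z powr (7 / 12 - \<alpha>) \<le> N * br z powr (7 / 12 - \<alpha>)"
      using MK by (intro mult_right_mono) (auto simp: N_def)
    then show ?thesis using near[of z] False by linarith
  qed
  have "AE z in lborel. norm z \<ge> R \<longrightarrow> f z \<le> (A * N) * br z powr (- (\<alpha> + 1 / 12))"
    using ineq'
  proof (rule eventually_mono, intro impI)
    fix z assume "norm z \<ge> R \<longrightarrow> f z \<le> A * br z powr (- 2 / 3) * C z" "norm z \<ge> R"
    then have "f z \<le> A * br z powr (- 2 / 3) * C z" by simp
    also have "\<dots> \<le> A * br z powr (- 2 / 3) * (N * br z powr (7 / 12 - \<alpha>))"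
      using A by (intro mult_left_mono C_le) auto
    also have "\<dots> = A * N * (br z powr (- 2 / 3) * br z powr (7 / 12 - \<alpha>))" by (simp only: mult_ac)
    also have "br z powr (- 2 / 3) * br z powr (7 / 12 - \<alpha>) = br z powr (- (\<alpha> + 1 / 12))"
    proof -
      have "- 2 / 3 + (7 / 12 - \<alpha>) = - (\<alpha> + 1 / 12)" by simp
      then show ?thesis by (metis powr_add)
    qed
    finally show "f z \<le> (A * N) * br z powr (- (\<alpha> + 1 / 12))" .
  qed
  moreover have "A * N \<ge> 0" using A MK by (simp add: N_def)
  ultimately show ?thesis by blast
qed

text \<open>The start 2/3 needs no decay of f at all: the convolution is bounded by the squared L^2
  norm.\<close>

lemma decay: "\<exists>B\<ge>0. AE z in lborel. norm z \<ge> R \<longrightarrow> f z \<le> B * br z powr (- (2 / 3 + real n / 12))"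
proof (induction n)
  case 0
  have "AE z in lborel. norm z \<ge> R \<longrightarrow> f z \<le> (A * D) * br z powr (- 2 / 3)"
    using ineq'
  proof (rule eventually_mono, intro impI)
    fix z assume "norm z \<ge> R \<longrightarrow> f z \<le> A * br z powr (- 2 / 3) * C z" "norm z \<ge> R"
    then have "f z \<le> A * br z powr (- 2 / 3) * C z" by simp
    also have "\<dots> \<le> A * br z powr (- 2 / 3) * D" using A by (intro mult_left_mono C_props) auto
    finally show "f z \<le> (A * D) * br z powr (- 2 / 3)" by (simp only: mult_ac)
  qed
  moreover have "A * D \<ge> 0" using A D_nonneg by simp
  ultimately show ?case by auto
next
  case (Suc n)
  then obtain B where "B \<ge> 0" "AE z in lborel. norm z \<ge> R \<longrightarrow> f z \<le> B * br z powr (- (2 / 3 + real n / 12))" by blast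
  from decay_step[OF this(1) _ this(2)] show ?case by (simp add: field_simps)
qed

text \<open>Allows f^2 <= B f at high frequency, which turns weighted L^1 bounds into the L^2 bounds
  of the Sobolev norms.\<close>

lemma high_frequency_bounded: "\<exists>B\<ge>0. AE z in lborel. norm z \<ge> R \<longrightarrow> f z \<le> B"
proof -
  obtain B where B: "B \<ge> 0" "AE z in lborel. norm z \<ge> R \<longrightarrow> f z \<le> B * br z powr (- (2 / 3 + real 0 / 12))"
    using decay by blast
  have "AE z in lborel. norm z \<ge> R \<longrightarrow> f z \<le> B"
    using B(2)
  proof (rule eventually_mono, intro impI)
    fix z assume "norm z \<ge> R \<longrightarrow> f z \<le> B * br z powr (- (2 / 3 + real 0 / 12))" "norm z \<ge> R"
    then have "f z \<le> B * br z powr (- (2 / 3 + real 0 / 12))" by simp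
    also have "\<dots> \<le> B * 1"
      using B(1) br_ge1[of z] powr_mono[of "- (2 / 3 + real 0 / 12)" 0 "br z"] by (intro mult_left_mono) auto
    finally show "f z \<le> B" by simp
  qed
  then show ?thesis using B(1) by blast
qed

lemma integrable_f: "integrable lborel f"
proof -
  \<comment> \<open>Eighteen gains of 1/12 give 2/3 + 18/12 = 13/6, the integrable power. Inside the
    ball f <= 1 + f^2 suffices.\<close>
  obtain B where B: "B \<ge> 0" "AE z in lborel. norm z \<ge> R \<longrightarrow> f z \<le> B * br z powr (- (2 / 3 + real 18 / 12))"
    using decay by blast
  have ball: "integrable lborel (indicator (ball 0 R) :: real \<times> real \<Rightarrow> real)"
    using emeasure_bounded_finite[OF bounded_ball[of "0 :: real \<times> real" R]] by (simp add: integrable_indicator_iff)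
  show ?thesis
  proof (rule Bochner_Integration.integrable_bound)
    show "integrable lborel (\<lambda>z. indicator (ball 0 R) z + (f z)\<^sup>2 + B * br z powr (- 13 / 6))"
      by (intro Bochner_Integration.integrable_add ball square_integrable integrable_mult_right integrable_br_powr)
    show "AE z in lborel. norm (f z) \<le> norm (indicator (ball 0 R) z + (f z)\<^sup>2 + B * br z powr (- 13 / 6))"
      using B(2)
    proof (rule eventually_mono)
      fix z assume *: "norm z \<ge> R \<longrightarrow> f z \<le> B * br z powr (- (2 / 3 + real 18 / 12))"
      have b: "B * br z powr (- 13 / 6) \<ge> 0" using B by simp
      have "f z \<le> indicator (ball 0 R) z + (f z)\<^sup>2 + B * br z powr (- 13 / 6)"
      proof (cases "norm z \<ge> R")
        case True
        then have "f z \<le> B * br z powr (- 13 / 6)" using * by simp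
        moreover have "(0::real) \<le> indicator (ball 0 R) z + (f z)\<^sup>2" by simp
        ultimately show ?thesis by linarith
      next
        case False
        then have "indicator (ball 0 R) z = (1::real)" by simp
        moreover have "f z \<le> 1 + (f z)\<^sup>2" using mult_le_sum_squares[of "f z" 1] nonneg[of z] by simp
        ultimately show ?thesis using b by linarith
      qed
      then show "norm (f z) \<le> norm (indicator (ball 0 R) z + (f z)\<^sup>2 + B * br z powr (- 13 / 6))"
        using nonneg[of z] by simp
    qed
  qed measurable
qed

end

text \<open>The third claim rules out, almost everywhere, the default value 0 of a divergent
  convolution integral; comparisons of integrands rely on it.\<close>

lemma integral_convolution:
  fixes h :: "real \<times> real \<Rightarrow> real"
  assumes h: "integrable lborel h"
  shows "integrable lborel (\<lambda>z. LINT w|lborel. h w * h (z - w))"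
    and "(LINT z|lborel. (LINT w|lborel. h w * h (z - w))) = (LINT w|lborel. h w)\<^sup>2"
    and "AE z in lborel. integrable lborel (\<lambda>w. h w * h (z - w))"
proof -
  have [measurable]: "h \<in> borel_measurable borel" using h by auto
  have sh: "integrable lborel (\<lambda>z. h (z - w))" for w
    using integrable_lborel_shift[OF h, of "- w"] by simp
  have shi: "(LINT z|lborel. g (z - w)) = (LINT z|lborel. g z)" if "g \<in> borel_measurable borel" for g :: "real \<times> real \<Rightarrow> real" and w
    using integral_lborel_shift[OF that, of "- w"] by simp
  have i: "integrable (lborel \<Otimes>\<^sub>M lborel) (\<lambda>(w, z). h w * h (z - w))"
  proof (rule lborel_pair.Fubini_integrable)
    have "(LINT z|lborel. norm (h w * h (z - w))) = \<bar>h w\<bar> * (LINT z|lborel. \<bar>h z\<bar>)" for w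
      using shi[of "\<lambda>z. \<bar>h z\<bar>" w] by (simp add: abs_mult)
    then show "integrable lborel (\<lambda>w. LINT z|lborel. norm (case (w, z) of (w, z) \<Rightarrow> h w * h (z - w)))"
      using h by simp
    show "AE w in lborel. integrable lborel (\<lambda>z. case (w, z) of (w, z) \<Rightarrow> h w * h (z - w))"
      using sh by simp
  qed measurable
  show "integrable lborel (\<lambda>z. LINT w|lborel. h w * h (z - w))" by (rule lborel_pair.integrable_snd[OF i])
  show "AE z in lborel. integrable lborel (\<lambda>w. h w * h (z - w))" by (rule lborel_pair.AE_integrable_snd[OF i])
  have "(LINT z|lborel. (LINT w|lborel. h w * h (z - w))) = (LINT w|lborel. (LINT z|lborel. h w * h (z - w)))"
    by (rule lborel_pair.Fubini_integral[OF i])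
  also have "\<dots> = (LINT w|lborel. h w * (LINT z|lborel. h z))" by (simp add: shi)
  finally show "(LINT z|lborel. (LINT w|lborel. h w * h (z - w))) = (LINT w|lborel. h w)\<^sup>2"
    by (simp add: power2_eq_square)
qed

section \<open>Exponentially weighted masses and the continuity argument\<close>

context high_frequency_inequality
begin

definition L :: real where "L = (LINT z|lborel. f z)"

lemma L_nonneg: "L \<ge> 0" unfolding L_def by (intro integral_nonneg_AE AE_I2 nonneg)

definition wt :: "real \<Rightarrow> real \<Rightarrow> real \<times> real \<Rightarrow> real" where "wt N s z = exp (s * min (norm z) N)"

definition X :: "real \<Rightarrow> real \<Rightarrow> real" where "X N s = (LINT z|lborel. wt N s z * f z)"

lemma wt_measurable [measurable]: "wt N s \<in> borel_measurable borel"
  unfolding wt_def[abs_def] by measurable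

lemma wt_bounds: "0 < wt N s z" "s \<ge> 0 \<Longrightarrow> wt N s z \<le> exp (s * N)" "s \<ge> 0 \<Longrightarrow> wt N s z \<le> exp (s * norm z)"
  by (auto simp: wt_def intro: mult_left_mono)

text \<open>Truncating the exponent at \<open>N\<close> keeps the weight submultiplicative while making it bounded.\<close>

lemma wt_submult:
  assumes "s \<ge> 0" "N \<ge> 0" shows "wt N s z \<le> wt N s w * wt N s (z - w)"
proof -
  have "norm z \<le> norm w + norm (z - w)" using norm_triangle_ineq[of w "z - w"] by simp
  then have "min (norm z) N \<le> min (norm w) N + min (norm (z - w)) N"
    using assms(2) norm_ge_zero[of w] norm_ge_zero[of "z - w"] by linarith
  then have "s * min (norm z) N \<le> s * min (norm w) N + s * min (norm (z - w)) N"
    using assms(1) by (metis distrib_left mult_left_mono)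
  then show ?thesis by (simp add: wt_def flip: exp_add)
qed

lemma wt_integrable: assumes "s \<ge> 0" shows "integrable lborel (\<lambda>z. wt N s z * f z)"
proof (rule integrable_dominated)
  show "integrable lborel (\<lambda>z. exp (s * N) * f z)" using integrable_f by simp
  show "norm (wt N s z * f z) \<le> exp (s * N) * f z" for z
    using mult_right_mono[OF wt_bounds(2)[OF assms, of N z] nonneg[of z]] wt_bounds(1)[of N s z] nonneg[of z]
    by (simp add: abs_mult)
qed measurable

text \<open>Below R1 the weight is at most exp (ln 2) = 2, which gives the term 2 L. Above R1 the
  coefficient is at most \<epsilon>, the submultiplicative weight distributes over the two factors
  of the convolution, and the integral of that convolution is the square of the mass.\<close>

lemma X_quadratic:
  assumes s: "s \<ge> 0" and N: "N \<ge> 0" and \<epsilon>: "\<epsilon> \<ge> 0" and R1: "R1 \<ge> R" "s * R1 \<le> ln 2"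
    and small: "A * (1 + R1) powr (- 2 / 3) \<le> \<epsilon>"
  shows "X N s \<le> 2 * L + \<epsilon> * (X N s)\<^sup>2"
proof -
  let ?h = "\<lambda>z. wt N s z * f z"
  note hi = wt_integrable[OF s, of N]
  let ?c = "\<lambda>z. LINT w|lborel. ?h w * ?h (z - w)"
  have h0: "?h z \<ge> 0" for z using nonneg wt_bounds(1)[of N s z] by simp
  have c0: "?c z \<ge> 0" for z by (intro integral_nonneg_AE AE_I2 mult_nonneg_nonneg h0)
  have "X N s \<le> (LINT z|lborel. 2 * f z + \<epsilon> * ?c z)"
    unfolding X_def
  proof (rule integral_mono_AE[OF hi])
    show "integrable lborel (\<lambda>z. 2 * f z + \<epsilon> * ?c z)"
      using integrable_f integral_convolution(1)[OF hi] by simp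
    show "AE z in lborel. ?h z \<le> 2 * f z + \<epsilon> * ?c z"
      using ineq' integral_convolution(3)[OF hi]
    proof eventually_elim
      case (elim z)
      show ?case
      proof (cases "norm z \<ge> R1")
        case False
        have "wt N s z \<le> exp (s * norm z)" by (rule wt_bounds(3)[OF s])
        also have "\<dots> \<le> exp (ln 2)"
        proof -
          have "s * norm z \<le> s * R1" using False by (intro mult_left_mono s) simp
          then have "s * norm z \<le> ln 2" using R1(2) by linarith
          then show ?thesis by (rule exp_le_cancel_iff[THEN iffD2])
        qed
        finally have "?h z \<le> 2 * f z" by (intro mult_right_mono nonneg) simp
        moreover have "\<epsilon> * ?c z \<ge> 0" using \<epsilon> c0 by simp
        ultimately show ?thesis by linarith
      next
        case True
        then have "f z \<le> A * br z powr (- 2 / 3) * C z" using elim(1) R1 by simp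
        also have "\<dots> \<le> \<epsilon> * C z"
        proof (intro mult_right_mono C_props)
          have "A * br z powr (- 2 / 3) \<le> A * (1 + R1) powr (- 2 / 3)"
            using A True R R1 by (intro mult_left_mono powr_mono2') (auto simp: br_def)
          then show "A * br z powr (- 2 / 3) \<le> \<epsilon>" using small by linarith
        qed
        finally have "?h z \<le> wt N s z * (\<epsilon> * C z)" using wt_bounds(1)[of N s z] by (intro mult_left_mono) auto
        also have "\<dots> = \<epsilon> * (LINT w|lborel. wt N s z * (f w * f (z - w)))" by (simp add: C_def)
        also have "\<dots> \<le> \<epsilon> * ?c z"
        proof (intro mult_left_mono[OF _ \<epsilon>] integral_mono_AE AE_I2)
          show "integrable lborel (\<lambda>w. wt N s z * (f w * f (z - w)))" using C_integrable by simp
          show "integrable lborel (\<lambda>w. ?h w * ?h (z - w))" by (rule elim(2))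
          fix w
          have "wt N s z * (f w * f (z - w)) \<le> (wt N s w * wt N s (z - w)) * (f w * f (z - w))"
            by (intro mult_right_mono wt_submult s N mult_nonneg_nonneg nonneg)
          then show "wt N s z * (f w * f (z - w)) \<le> ?h w * ?h (z - w)" by (simp only: mult_ac)
        qed
        finally show ?thesis using nonneg[of z] by linarith
      qed
    qed
  qed
  also have "\<dots> = 2 * L + \<epsilon> * (X N s)\<^sup>2"
    using integrable_f integral_convolution[OF hi] by (simp add: L_def X_def)
  finally show ?thesis .
qed

text \<open>For the intermediate value theorem in s. The truncation makes a constant multiple of f a
  dominating function.\<close>

lemma X_continuous: "continuous_on {0..} (X N)"
proof (rule continuous_on_sequentiallyI)
  fix u :: "nat \<Rightarrow> real" and a assume u: "\<forall>n. u n \<in> {0..}" "a \<in> {0..}" "u \<longlonglongrightarrow> a"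
  obtain b where b: "\<And>n. u n \<le> b"
    using convergent_imp_Bseq[OF convergentI[OF u(3)]] by (auto simp: Bseq_def abs_le_iff)
  show "(\<lambda>n. X N (u n)) \<longlonglongrightarrow> X N a"
    unfolding X_def
  proof (rule integral_dominated_convergence[where w = "\<lambda>z. exp (b * \<bar>N\<bar>) * f z"])
    show "AE z in lborel. (\<lambda>n. wt N (u n) z * f z) \<longlonglongrightarrow> wt N a z * f z"
      unfolding wt_def using u(3) by (intro AE_I2 tendsto_intros)
    fix n
    show "AE z in lborel. norm (wt N (u n) z * f z) \<le> exp (b * \<bar>N\<bar>) * f z"
    proof (rule AE_I2)
      fix z :: "real \<times> real"
      have "u n * min (norm z) N \<le> u n * \<bar>N\<bar>" using u(1) by (intro mult_left_mono) auto
      also have "\<dots> \<le> b * \<bar>N\<bar>" using b by (intro mult_right_mono) auto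
      finally have "wt N (u n) z \<le> exp (b * \<bar>N\<bar>)" by (simp add: wt_def)
      then show "norm (wt N (u n) z * f z) \<le> exp (b * \<bar>N\<bar>) * f z"
        using nonneg[of z] wt_bounds(1)[of N "u n" z] by (simp add: abs_mult mult_right_mono)
    qed
  qed (use integrable_f in auto)
qed

text \<open>Above frequency \<open>R1\<close> the quadratic coefficient is so small that \<open>1 / (2 \<epsilon>)\<close> violates the quadratic
  inequality; \<open>X N\<close> starts below this barrier at \<open>s = 0\<close> and cannot cross it.\<close>

theorem exponential_decay: "\<exists>\<delta>>0. integrable lborel (\<lambda>z. exp (\<delta> * norm z) * f z)"
proof -
  \<comment> \<open>Together with the barrier b = 4 (L + 1) this gives 2 L + \<epsilon> b^2 = 2 L +
    b / 2 = 4 L + 2, strictly below b. Using L + 1 avoids division by zero when L = 0.\<close>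
  define \<epsilon> where "\<epsilon> = 1 / (8 * (L + 1))"
  have \<epsilon>: "\<epsilon> > 0" using L_nonneg by (simp add: \<epsilon>_def)
  have "((\<lambda>x::real. A * (1 + x) powr (- 2 / 3)) \<longlongrightarrow> A * 0) at_top"
    by (intro tendsto_mult tendsto_const tendsto_neg_powr filterlim_tendsto_add_at_top[OF tendsto_const] filterlim_ident) auto
  then have "\<forall>\<^sub>F x in at_top. A * (1 + x) powr (- 2 / 3) < \<epsilon>" using \<epsilon> by (intro order_tendstoD) auto
  then have "\<forall>\<^sub>F x in at_top. A * (1 + x) powr (- 2 / 3) < \<epsilon> \<and> x \<ge> R" by (intro eventually_conj eventually_ge_at_top)
  then obtain R1 where R1: "A * (1 + R1) powr (- 2 / 3) < \<epsilon>" "R1 \<ge> R"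
    using eventually_happens'[OF trivial_limit_at_top_linorder] by blast
  \<comment> \<open>Keeps exp (s R1) at most 2 for all s up to \<delta>; the added 1 makes the
    denominator positive.\<close>
  define \<delta> where "\<delta> = ln 2 / (R1 + 1)"
  have \<delta>: "\<delta> > 0" using R R1 by (simp add: \<delta>_def)
  have \<delta>R: "s * R1 \<le> ln 2" if "0 \<le> s" "s \<le> \<delta>" for s
  proof -
    have "s * R1 \<le> s * (R1 + 1)" using that by (intro mult_left_mono) auto
    also have "\<dots> \<le> \<delta> * (R1 + 1)" using that R R1 by (intro mult_right_mono) auto
    also have "\<dots> = ln 2" using R R1 by (simp add: \<delta>_def)
    finally show ?thesis .
  qed
  define b where "b = 4 * (L + 1)"
  have b\<epsilon>: "\<epsilon> * b\<^sup>2 = b / 2" 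
  proof -
    have "1 / (8 * l) * (4 * l)\<^sup>2 = 4 * l / 2" if "l \<noteq> 0" for l :: real
      using that by (simp add: power2_eq_square)
    from this[of "L + 1"] show ?thesis using L_nonneg by (simp add: \<epsilon>_def b_def)
  qed
  have ne: "X N s \<noteq> b" if "0 \<le> s" "s \<le> \<delta>" "N \<ge> 0" for N s
  proof
    assume "X N s = b"
    then have "b \<le> 2 * L + b / 2"
      using X_quadratic[OF that(1,3) less_imp_le[OF \<epsilon>] R1(2) \<delta>R[OF that(1,2)] less_imp_le[OF R1(1)]] b\<epsilon> by simp
    then show False by (simp add: b_def)
  qed
  have X_le: "X N \<delta> \<le> b" if N: "N \<ge> 0" for N
  proof (rule ccontr)
    assume "\<not> X N \<delta> \<le> b"
    moreover have "X N 0 \<le> b" using L_nonneg by (simp add: X_def wt_def L_def[symmetric] b_def)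
    moreover have "continuous_on {0..\<delta>} (X N)" by (rule continuous_on_subset[OF X_continuous]) auto
    ultimately obtain s where "0 \<le> s" "s \<le> \<delta>" "X N s = b"
      using IVT'[of "X N" 0 b \<delta>] \<delta> by auto
    then show False using ne[OF _ _ N] by blast
  qed
  have lim: "(\<lambda>n. wt (real n) \<delta> z * f z) \<longlonglongrightarrow> exp (\<delta> * norm z) * f z" for z
  proof (rule tendsto_eventually)
    show "\<forall>\<^sub>F n in sequentially. wt (real n) \<delta> z * f z = exp (\<delta> * norm z) * f z"
      using eventually_ge_at_top[of "nat \<lceil>norm z\<rceil>"]
    proof eventually_elim
      case (elim n)
      then have "norm z \<le> real n" by linarith
      then show ?case by (simp add: wt_def)
    qed
  qed
  \<comment> \<open>Fatou removes the truncation, since neither the barrier b nor \<delta> depends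
    on N.\<close>
  have "(\<integral>\<^sup>+z. ennreal (exp (\<delta> * norm z) * f z) \<partial>lborel) = (\<integral>\<^sup>+z. liminf (\<lambda>n. ennreal (wt (real n) \<delta> z * f z)) \<partial>lborel)"
    by (intro nn_integral_cong lim_imp_Liminf[symmetric] tendsto_ennrealI lim) simp
  also have "\<dots> \<le> liminf (\<lambda>n. \<integral>\<^sup>+z. ennreal (wt (real n) \<delta> z * f z) \<partial>lborel)"
    by (rule nn_integral_liminf) measurable
  also have "\<dots> \<le> liminf (\<lambda>n::nat. ennreal b)"
  proof (intro Liminf_mono always_eventually allI)
    fix n
    have "(\<integral>\<^sup>+z. ennreal (wt (real n) \<delta> z * f z) \<partial>lborel) = ennreal (X (real n) \<delta>)"
      unfolding X_def using wt_integrable[of \<delta> "real n"] \<delta> nonneg wt_bounds(1)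
      by (intro nn_integral_eq_integral) (auto simp: less_imp_le)
    also have "\<dots> \<le> ennreal b" by (intro ennreal_leI X_le) simp
    finally show "(\<integral>\<^sup>+z. ennreal (wt (real n) \<delta> z * f z) \<partial>lborel) \<le> ennreal b" .
  qed
  also have "\<dots> < \<infinity>" by (simp add: Liminf_const)
  finally have "integrable lborel (\<lambda>z. exp (\<delta> * norm z) * f z)"
    using nonneg by (intro integrableI_nonneg) auto
  then show ?thesis using \<delta> by blast
qed

end

section \<open>Analyticity and conclusion\<close>

text \<open>\<open>real_analytic_on\<close> asks for unordered summation over pairs of exponents, so
  the product of the two series is shown absolutely summable before it is summed
  iteratively.\<close>

lemma exp_exp_has_sum:
  fixes u v :: "'a::{real_normed_field, banach}"
  shows "((\<lambda>(j, k). (u ^ j /\<^sub>R fact j) * (v ^ k /\<^sub>R fact k)) has_sum exp u * exp v) UNIV"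
proof -
  let ?t = "\<lambda>x n. x ^ n /\<^sub>R fact n"
  have e: "(?t x has_sum exp x) UNIV" for x :: 'a
    by (rule norm_summable_imp_has_sum[OF summable_norm_exp exp_converges])
  have n: "((\<lambda>n. norm (?t x n)) has_sum exp (norm x)) UNIV" for x :: 'a
  proof -
    have "(\<lambda>n. norm x ^ n /\<^sub>R fact n) sums exp (norm x)" by (rule exp_converges)
    then have "(\<lambda>n. norm (?t x n)) sums exp (norm x)" by (simp add: norm_power)
    then show ?thesis by (rule sums_nonneg_imp_has_sum) simp
  qed
  have h: "((\<lambda>k. norm (?t u j * ?t v k)) has_sum norm (?t u j) * exp (norm v)) UNIV" for j
    unfolding norm_mult by (rule has_sum_cmult_right[OF n])
  have "(\<lambda>p. norm (?t u (fst p) * ?t v (snd p))) summable_on (UNIV \<times> UNIV)"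
  proof (rule Infinite_Sum.abs_summable_on_Sigma_iff[THEN iffD2], intro conjI ballI; unfold fst_conv snd_conv)
    show "(\<lambda>k. norm (?t u j * ?t v k)) summable_on UNIV" for j
      using h has_sum_imp_summable by blast
    have "((\<lambda>j. norm (?t u j) * exp (norm v)) has_sum exp (norm u) * exp (norm v)) UNIV"
      by (rule has_sum_cmult_left[OF n])
    then show "(\<lambda>j. norm (infsum (\<lambda>k. norm (?t u j * ?t v k)) UNIV)) summable_on UNIV"
      unfolding infsumI[OF h] by (auto dest: has_sum_imp_summable simp: norm_mult)
  qed
  then have "(\<lambda>p. ?t u (fst p) * ?t v (snd p)) summable_on (UNIV \<times> UNIV)"
    by (rule Infinite_Sum.abs_summable_summable)
  then have s: "(\<lambda>(j, k). ?t u j * ?t v k) summable_on (UNIV \<times> UNIV)" by (simp add: case_prod_unfold)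
  have "((\<lambda>(j, k). ?t u j * ?t v k) has_sum exp u * exp v) (UNIV \<times> UNIV)"
  proof (rule has_sum_SigmaI[OF _ _ s])
    show "((\<lambda>k. case (j, k) of (j, k) \<Rightarrow> ?t u j * ?t v k) has_sum ?t u j * exp v) UNIV" for j
      unfolding prod.case by (rule has_sum_cmult_right[OF e])
    show "((\<lambda>j. ?t u j * exp v) has_sum exp u * exp v) UNIV" by (rule has_sum_cmult_left[OF e])
  qed
  then show ?thesis by simp
qed

text \<open>The same double series enumerated along one index, the form in which series and integral
  can be exchanged.\<close>

lemma exp_exp_sums:
  fixes u v :: "'a::{real_normed_field, banach}"
  shows "(\<lambda>m. (u ^ fst (prod_decode m) /\<^sub>R fact (fst (prod_decode m))) * (v ^ snd (prod_decode m) /\<^sub>R fact (snd (prod_decode m))))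
    sums (exp u * exp v)"
proof -
  have "((\<lambda>m. case prod_decode m of (j, k) \<Rightarrow> (u ^ j /\<^sub>R fact j) * (v ^ k /\<^sub>R fact k)) has_sum exp u * exp v) UNIV"
    using exp_exp_has_sum[of u v] has_sum_reindex_bij_betw[OF bij_prod_decode] by blast
  then show ?thesis by (auto simp: case_prod_unfold dest: has_sum_imp_sums)
qed

lemma Re_of_real_times: "Re (complex_of_real a * w) = a * Re w"
  by simp

text \<open>Expand the exponential of i \<zeta> . (z - p) in powers of both coordinates and
  integrate termwise. The absolute values of all terms add up to at most exp (|\<xi> x| + |\<eta>
  y|) |F|, which is dominated when both increments are at most \<delta> / 2.\<close>

lemma real_analytic_inv_ft:
  assumes [measurable]: "F \<in> borel_measurable borel" and \<delta>: "\<delta> > 0"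
    and F: "integrable lborel (\<lambda>\<zeta>. exp (\<delta> * norm \<zeta>) * cmod (F \<zeta>))"
  shows "real_analytic_on UNIV (\<lambda>z. Re (inv_ft F z))"
  unfolding real_analytic_on_def
proof
  fix p :: "real \<times> real"
  let ?T = "\<lambda>j k \<zeta>. F \<zeta> * iexp (\<zeta> \<bullet> p) * ((\<i> * of_real (fst \<zeta>)) ^ j /\<^sub>R fact j * ((\<i> * of_real (snd \<zeta>)) ^ k /\<^sub>R fact k))"
  \<comment> \<open>The Taylor coefficients at p, found by differentiating j and k times under the
    integral and dividing by the factorials.\<close>
  define a where "a j k = Re (LINT \<zeta>|lborel. ?T j k \<zeta>)" for j k
  have "((\<lambda>(j, k). a j k * (fst z - fst p) ^ j * (snd z - snd p) ^ k) has_sum Re (inv_ft F z)) UNIV"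
    if z: "z \<in> ball p (\<delta> / 2)" for z
  proof -
    define x y where "x = fst z - fst p" and "y = snd z - snd p"
    have xy: "\<bar>x\<bar> \<le> \<delta> / 2" "\<bar>y\<bar> \<le> \<delta> / 2"
      using z dist_fst_le[of z p] dist_snd_le[of z p] by (auto simp: x_def y_def dist_real_def dist_commute)
    let ?e = "\<lambda>u m. u ^ m /\<^sub>R fact m"
    define S where "S m \<zeta> = F \<zeta> * iexp (\<zeta> \<bullet> p) * (?e (\<i> * of_real (fst \<zeta> * x)) (fst (prod_decode m)) * ?e (\<i> * of_real (snd \<zeta> * y)) (snd (prod_decode m)))" for m \<zeta>
    have [measurable]: "(fst :: real \<times> real \<Rightarrow> real) \<in> borel_measurable borel" "(snd :: real \<times> real \<Rightarrow> real) \<in> borel_measurable borel"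
      by (intro borel_measurable_continuous_onI continuous_intros)+
    have Sm [measurable]: "S m \<in> borel_measurable borel" for m unfolding S_def by measurable
    have ne: "cmod (?e (\<i> * of_real t) j) = ?e \<bar>t\<bar> j" for t j
      by (simp add: norm_mult norm_power)
    have norms: "(\<lambda>m. cmod (S m \<zeta>)) sums (cmod (F \<zeta>) * (exp \<bar>fst \<zeta> * x\<bar> * exp \<bar>snd \<zeta> * y\<bar>))" for \<zeta>
    proof -
      have "(\<lambda>m. cmod (F \<zeta>) * (?e \<bar>fst \<zeta> * x\<bar> (fst (prod_decode m)) * ?e \<bar>snd \<zeta> * y\<bar> (snd (prod_decode m))))
        sums (cmod (F \<zeta>) * (exp \<bar>fst \<zeta> * x\<bar> * exp \<bar>snd \<zeta> * y\<bar>))"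
        by (rule sums_mult[OF exp_exp_sums])
      then show ?thesis by (simp only: S_def norm_mult norm_exp_i_times ne mult_1_right)
    qed
    have dom: "cmod (F \<zeta>) * (exp \<bar>fst \<zeta> * x\<bar> * exp \<bar>snd \<zeta> * y\<bar>) \<le> exp (\<delta> * norm \<zeta>) * cmod (F \<zeta>)" for \<zeta>
    proof -
      have "\<bar>fst \<zeta>\<bar> \<le> norm \<zeta>" "\<bar>snd \<zeta>\<bar> \<le> norm \<zeta>"
        using norm_fst_le[of "fst \<zeta>" "snd \<zeta>"] norm_snd_le[of "snd \<zeta>" "fst \<zeta>"] by auto
      then have "\<bar>fst \<zeta> * x\<bar> \<le> norm \<zeta> * (\<delta> / 2)" "\<bar>snd \<zeta> * y\<bar> \<le> norm \<zeta> * (\<delta> / 2)"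
        unfolding abs_mult using xy by (intro mult_mono; simp)+
      then have "\<bar>fst \<zeta> * x\<bar> + \<bar>snd \<zeta> * y\<bar> \<le> \<delta> * norm \<zeta>" by (simp add: mult.commute)
      then have "exp \<bar>fst \<zeta> * x\<bar> * exp \<bar>snd \<zeta> * y\<bar> \<le> exp (\<delta> * norm \<zeta>)" unfolding exp_add[symmetric] by simp
      then show ?thesis by (simp add: mult.commute mult_left_mono)
    qed
    have Sle: "cmod (S m \<zeta>) \<le> exp (\<delta> * norm \<zeta>) * cmod (F \<zeta>)" for m \<zeta>
    proof -
      have "(\<Sum>i\<in>{m}. cmod (S i \<zeta>)) \<le> (\<Sum>i. cmod (S i \<zeta>))"
        using norms[of \<zeta>] by (intro sum_le_suminf) (auto simp: sums_iff)
      then show ?thesis using norms[of \<zeta>] dom[of \<zeta>] by (simp add: sums_iff)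
    qed
    have iS: "integrable lborel (S m)" for m
      by (rule integrable_dominated[OF F _ Sle]) measurable
    have sumS: "summable (\<lambda>m. LINT \<zeta>|lborel. cmod (S m \<zeta>))"
    proof (rule summableI_nonneg_bounded)
      fix n
      have "(\<Sum>m<n. (LINT \<zeta>|lborel. cmod (S m \<zeta>))) = (LINT \<zeta>|lborel. (\<Sum>m<n. cmod (S m \<zeta>)))"
        using iS by (subst Bochner_Integration.integral_sum) auto
      also have "\<dots> \<le> (LINT \<zeta>|lborel. exp (\<delta> * norm \<zeta>) * cmod (F \<zeta>))"
      proof (rule integral_mono[OF _ F])
        show "integrable lborel (\<lambda>\<zeta>. \<Sum>m<n. cmod (S m \<zeta>))" using iS by auto
        fix \<zeta>
        have "(\<Sum>m<n. cmod (S m \<zeta>)) \<le> (\<Sum>m. cmod (S m \<zeta>))"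
          using norms[of \<zeta>] by (intro sum_le_suminf) (auto simp: sums_iff)
        then show "(\<Sum>m<n. cmod (S m \<zeta>)) \<le> exp (\<delta> * norm \<zeta>) * cmod (F \<zeta>)"
          using norms[of \<zeta>] dom[of \<zeta>] by (simp add: sums_iff)
      qed
      finally show "(\<Sum>m<n. (LINT \<zeta>|lborel. cmod (S m \<zeta>))) \<le> (LINT \<zeta>|lborel. exp (\<delta> * norm \<zeta>) * cmod (F \<zeta>))" .
    qed simp
    have S_sum: "(\<lambda>m. S m \<zeta>) sums (F \<zeta> * iexp (\<zeta> \<bullet> z))" for \<zeta>
    proof -
      have "(\<lambda>m. S m \<zeta>) sums (F \<zeta> * iexp (\<zeta> \<bullet> p) * (iexp (fst \<zeta> * x) * iexp (snd \<zeta> * y)))"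
        unfolding S_def by (rule sums_mult[OF exp_exp_sums])
      moreover have "\<zeta> \<bullet> z = \<zeta> \<bullet> p + (fst \<zeta> * x + snd \<zeta> * y)"
        by (simp add: inner_real2 x_def y_def algebra_simps)
      then have "iexp (\<zeta> \<bullet> z) = iexp (\<zeta> \<bullet> p) * (iexp (fst \<zeta> * x) * iexp (snd \<zeta> * y))"
        by (simp only: of_real_add distrib_left exp_add)
      ultimately show ?thesis by (simp only: mult.assoc)
    qed
    have ae: "AE \<zeta> in lborel. summable (\<lambda>m. norm (S m \<zeta>))" using norms by (auto simp: sums_iff)
    have "(\<lambda>m. LINT \<zeta>|lborel. S m \<zeta>) sums (LINT \<zeta>|lborel. (\<Sum>m. S m \<zeta>))"
      by (rule sums_integral[OF iS ae sumS])
    also have "(LINT \<zeta>|lborel. (\<Sum>m. S m \<zeta>)) = inv_ft F z"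
      using S_sum by (simp add: inv_ft_def sums_iff)
    finally have sums: "(\<lambda>m. LINT \<zeta>|lborel. S m \<zeta>) sums inv_ft F z" .
    have "summable (\<lambda>m. norm (LINT \<zeta>|lborel. S m \<zeta>))"
      by (rule summable_comparison_test'[OF sumS, of 0]) (simp add: integral_norm_bound)
    then have "((\<lambda>m. LINT \<zeta>|lborel. S m \<zeta>) has_sum inv_ft F z) UNIV"
      using sums by (rule norm_summable_imp_has_sum)
    then have hs: "((\<lambda>m. Re (LINT \<zeta>|lborel. S m \<zeta>)) has_sum Re (inv_ft F z)) UNIV" by (rule has_sum_Re)
    \<comment> \<open>The increments are real, so their powers leave the real part, and the
      enumeration by \<open>prod_decode\<close> is undone.\<close>
    have S_eq: "Re (LINT \<zeta>|lborel. S m \<zeta>) = (case prod_decode m of (j, k) \<Rightarrow> a j k * x ^ j * y ^ k)" for m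
    proof -
      obtain j k where jk: "prod_decode m = (j, k)" by (cases "prod_decode m")
      have "S m \<zeta> = of_real (x ^ j * y ^ k) * ?T j k \<zeta>" for \<zeta>
        by (simp add: S_def jk power_mult_distrib scaleR_conv_of_real mult_ac)
      then have "(LINT \<zeta>|lborel. S m \<zeta>) = of_real (x ^ j * y ^ k) * (LINT \<zeta>|lborel. ?T j k \<zeta>)"
        by (simp only: integral_mult_right_zero)
      then show ?thesis by (simp only: jk prod.case a_def Re_of_real_times mult_ac)
    qed
    have "((\<lambda>(j, k). a j k * x ^ j * y ^ k) has_sum Re (inv_ft F z)) UNIV"
      using hs unfolding S_eq has_sum_reindex_bij_betw[OF bij_prod_decode] .
    then show ?thesis by (simp only: x_def y_def)
  qed
  then show "\<exists>r>0. \<exists>a. \<forall>z\<in>ball p r. ((\<lambda>(j, k). a j k * (fst z - fst p) ^ j * (snd z - snd p) ^ k) has_sum Re (inv_ft F z)) UNIV"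
    using \<delta> by (intro exI[of _ "\<delta> / 2"] conjI exI[of _ a]) auto
qed

lemma real_analytic_on_cmult:
  assumes "real_analytic_on S f" shows "real_analytic_on S (\<lambda>z. c * f z)"
  unfolding real_analytic_on_def
proof
  fix p assume "p \<in> S"
  then obtain r a where r: "r > 0" and a: "\<And>z. z \<in> ball p r \<Longrightarrow> ((\<lambda>(j, k). a j k * (fst z - fst p) ^ j * (snd z - snd p) ^ k) has_sum f z) UNIV"
    using assms unfolding real_analytic_on_def by blast
  have "((\<lambda>(j, k). (c * a j k) * (fst z - fst p) ^ j * (snd z - snd p) ^ k) has_sum c * f z) UNIV" if "z \<in> ball p r" for z
    using has_sum_cmult_right[OF a[OF that], of c] by (simp add: case_prod_unfold mult.assoc)
  then show "\<exists>r>0. \<exists>a. \<forall>z\<in>ball p r. ((\<lambda>(j, k). a j k * (fst z - fst p) ^ j * (snd z - snd p) ^ k) has_sum c * f z) UNIV"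
    using r by (intro exI[of _ r] conjI exI[of _ "\<lambda>j k. c * a j k"]) auto
qed

text \<open>The mollifications converge to f in L^2 and, F being integrable, everywhere to the
  inversion integral. Fatou's lemma shows that the two limits agree.\<close>

lemma fourier_inversion_AE:
  assumes F: "fourier_L2 f F" and F1: "integrable lborel F"
  shows "AE z in lborel. f z = 1 / (4 * pi\<^sup>2) * Re (inv_ft F z)"
proof -
  have f: "L2 f" "L2c F" using F by (auto simp: fourier_L2_def)
  note [measurable] = L2_of_real(1)[OF f(1)] L2c_D(1)[OF f(2)] chi_props(1)
  have [measurable]: "f \<in> borel_measurable borel" using f(1) by (auto simp: L2_def)
  have [measurable]: "moll F n \<in> borel_measurable borel" for n
    unfolding moll_def inv_ft_def by measurable
  have [measurable]: "inv_ft F \<in> borel_measurable borel" unfolding inv_ft_def by measurable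
  obtain B where B: "\<And>z. cmod (chi z) \<le> B" using chi_props(6) by blast
  have lim: "(\<lambda>n. moll F n w) \<longlonglongrightarrow> inv_ft F w / of_real (4 * pi\<^sup>2)" for w
    unfolding moll_def inv_ft_def
  proof (intro tendsto_divide tendsto_const integral_dominated_convergence[where w = "\<lambda>\<zeta>. cmod (F \<zeta>) * B"])
    show "AE \<zeta> in lborel. (\<lambda>n. F \<zeta> * chi (eps n *\<^sub>R \<zeta>) * iexp (\<zeta> \<bullet> w)) \<longlonglongrightarrow> F \<zeta> * iexp (\<zeta> \<bullet> w)"
    proof (rule AE_I2)
      fix \<zeta> :: "real \<times> real"
      have "(\<lambda>n. F \<zeta> * chi (eps n *\<^sub>R \<zeta>) * iexp (\<zeta> \<bullet> w)) \<longlonglongrightarrow> F \<zeta> * chi 0 * iexp (\<zeta> \<bullet> w)"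
        by (rule tendsto_mult_right[OF tendsto_mult_left[OF tendsto_eps_scaled[OF isCont_chi]]])
      then show "(\<lambda>n. F \<zeta> * chi (eps n *\<^sub>R \<zeta>) * iexp (\<zeta> \<bullet> w)) \<longlonglongrightarrow> F \<zeta> * iexp (\<zeta> \<bullet> w)"
        by (simp add: chi_props)
    qed
    show "AE \<zeta> in lborel. norm (F \<zeta> * chi (eps n *\<^sub>R \<zeta>) * iexp (\<zeta> \<bullet> w)) \<le> cmod (F \<zeta>) * B" for n
      using B by (intro AE_I2) (simp add: norm_mult mult_left_mono)
  qed (use F1 in auto)
  let ?d = "\<lambda>n w. ennreal ((cmod (moll F n w - f w))\<^sup>2)"
  have "(\<integral>\<^sup>+w. ennreal ((cmod (inv_ft F w / of_real (4 * pi\<^sup>2) - f w))\<^sup>2) \<partial>lborel) = (\<integral>\<^sup>+w. liminf (\<lambda>n. ?d n w) \<partial>lborel)"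
    by (intro nn_integral_cong lim_imp_Liminf[symmetric] tendsto_ennrealI tendsto_intros lim) auto
  also have "\<dots> \<le> liminf (\<lambda>n. \<integral>\<^sup>+w. ?d n w \<partial>lborel)" by (rule nn_integral_liminf) measurable
  also have "\<dots> = 0" by (rule lim_imp_Liminf[OF _ moll_tendsto[OF F]]) simp
  finally have "(\<integral>\<^sup>+w. ennreal ((cmod (inv_ft F w / of_real (4 * pi\<^sup>2) - f w))\<^sup>2) \<partial>lborel) = 0" by simp
  then have "AE w in lborel. inv_ft F w / of_real (4 * pi\<^sup>2) - f w = 0"
    by (subst (asm) nn_integral_0_iff_AE) (auto simp: ennreal_eq_0_iff)
  then show ?thesis
  proof eventually_elim
    case (elim z)
    then have "complex_of_real (f z) = of_real (1 / (4 * pi\<^sup>2)) * inv_ft F z" by simp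
    from arg_cong[OF this, of Re] show ?case by (simp only: Re_of_real_times Re_complex_of_real)
  qed
qed

text \<open>For lam > 0 the cubic term alone is at least a multiple of \<xi>^2 |z|. For lam = 0 the
  cases are split at |\<xi>| = r = |z|^(2/3): above it |\<xi>|^3 suffices, below it \<eta>^2 is at
  least r^3 / 2 and mu \<eta>^2 takes over.\<close>

lemma high_frequency_symbol:
  fixes lam mu c :: real
  assumes "lam \<ge> 0" "mu \<ge> 0" "\<not> (lam = 0 \<and> mu = 0)" "c > 0"
  obtains k R where "k > 0" "R \<ge> 1"
    "\<And>z. norm z \<ge> R \<Longrightarrow> - disp_symbol c lam mu z \<ge> k * (fst z)\<^sup>2 * norm z powr (2 / 3)"
proof (cases "lam > 0")
  case True
  define m where "m = min 1 lam"
  have m: "m > 0" "m \<le> 1" "m \<le> lam" using True by (auto simp: m_def)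
  \<comment> \<open>Beyond this radius c \<xi>^2 is at most half of the cubic lower bound; adding 1
    ensures R >= 1.\<close>
  define R where "R = 2 * c / m + 1"
  have "- disp_symbol c lam mu z \<ge> m / 2 * (fst z)\<^sup>2 * norm z powr (2 / 3)" if z: "norm z \<ge> R" for z
  proof -
    obtain x y where xy: "z = (x, y)" by (cases z)
    define n where "n = norm z"
    have n2: "n\<^sup>2 = x\<^sup>2 + y\<^sup>2" by (simp add: n_def xy norm_Pair)
    have xn: "\<bar>x\<bar> \<le> n" using norm_fst_le[of x y] by (simp add: n_def xy)
    have "2 * c / m \<ge> 0" using assms(4) m by simp
    then have nR: "n \<ge> 2 * c / m" "n \<ge> 1" using z unfolding R_def n_def by linarith+
    have "x\<^sup>2 * n \<le> \<bar>x\<bar> * n\<^sup>2"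
      using mult_left_mono[OF xn, of "\<bar>x\<bar> * n"] nR by (simp add: power2_eq_square mult_ac)
    then have "m * (x\<^sup>2 * n) \<le> m * (\<bar>x\<bar> * n\<^sup>2)" using m by (intro mult_left_mono) auto
    also have "\<dots> = \<bar>x\<bar> * (m * x\<^sup>2 + m * y\<^sup>2)" by (simp add: n2 algebra_simps)
    also have "\<dots> \<le> \<bar>x\<bar> * (1 * x\<^sup>2 + lam * y\<^sup>2)"
      using m by (intro mult_left_mono add_mono mult_right_mono) auto
    finally have 1: "m * (x\<^sup>2 * n) \<le> \<bar>x\<bar> * (x\<^sup>2 + lam * y\<^sup>2)" by simp
    have "2 * c \<le> m * n" using nR(1) m by (simp add: field_simps)
    then have 2: "2 * c * x\<^sup>2 \<le> m * n * x\<^sup>2" by (intro mult_right_mono) auto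
    have 3: "mu * y\<^sup>2 \<ge> 0" using assms by simp
    have "m / 2 * x\<^sup>2 * n powr (2 / 3) \<le> m / 2 * x\<^sup>2 * n"
      using nR m powr_mono[of "2/3" 1 n] by (intro mult_left_mono) auto
    also have "m / 2 * x\<^sup>2 * n = m * (x\<^sup>2 * n) / 2" by simp
    also have "\<dots> \<le> - disp_symbol c lam mu z"
    proof -
      have "- disp_symbol c lam mu z = mu * y\<^sup>2 + \<bar>x\<bar> * (x\<^sup>2 + lam * y\<^sup>2) - c * x\<^sup>2" by (simp add: disp_symbol_def xy)
      moreover have "m * n * x\<^sup>2 = m * (x\<^sup>2 * n)" by simp
      ultimately show ?thesis using 1 2 3 by linarith
    qed
    finally show ?thesis by (simp add: n_def xy)
  qed
  moreover have "m / 2 > 0" "R \<ge> 1" using m assms by (auto simp: R_def)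
  ultimately show ?thesis using that by blast
next
  case False
  then have mu: "mu > 0" and lam: "lam = 0" using assms by auto
  \<comment> \<open>A lower bound for r. The three summands give r^2 <= r^3 / 2, the absorption of c
    \<xi>^2 into |\<xi>|^3 / 2, and its absorption into mu r \<xi>^2 / 4.\<close>
  define M where "M = 2 + 2 * c + 4 * c / mu"
  have M: "M \<ge> 2" "M \<ge> 2 * c" "M \<ge> 4 * c / mu" using assms mu by (auto simp: M_def)
  define R where "R = M powr (3 / 2)"
  define k where "k = min (1 / 2) (mu / 4)"
  have k: "k > 0" "k \<le> 1 / 2" "k \<le> mu / 4" using mu by (auto simp: k_def)
  have "- disp_symbol c lam mu z \<ge> k * (fst z)\<^sup>2 * norm z powr (2 / 3)" if z: "norm z \<ge> R" for z
  proof -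
    obtain x y where xy: "z = (x, y)" by (cases z)
    define n where "n = norm z"
    define r where "r = n powr (2 / 3)"
    have n2: "n\<^sup>2 = x\<^sup>2 + y\<^sup>2" by (simp add: n_def xy norm_Pair)
    have "R powr (2 / 3) \<le> r" unfolding r_def n_def by (intro powr_mono2 z) (auto simp: R_def)
    then have rM: "r \<ge> M" using M by (simp add: R_def powr_powr)
    then have r0: "r > 0" using M by linarith
    then have n0: "n > 0" by (auto simp: r_def powr_eq_0_iff less_le n_def)
    have r3: "r ^ 3 = n\<^sup>2"
      using n0 by (simp add: r_def powr_power powr_numeral)
    have "k * x\<^sup>2 * r \<le> \<bar>x\<bar> * x\<^sup>2 + mu * y\<^sup>2 - c * x\<^sup>2"
    proof (cases "\<bar>x\<bar> \<ge> r")
      case True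
      have "k * x\<^sup>2 * r \<le> 1 / 2 * x\<^sup>2 * \<bar>x\<bar>"
        using True k r0 by (intro mult_mono) auto
      moreover have "c * x\<^sup>2 \<le> \<bar>x\<bar> / 2 * x\<^sup>2" using True rM M by (intro mult_right_mono) auto
      moreover have "mu * y\<^sup>2 \<ge> 0" using mu by simp
      ultimately show ?thesis by (simp add: mult_ac)
    next
      case False
      have x2: "x\<^sup>2 \<le> r\<^sup>2" using power_mono[of "\<bar>x\<bar>" r 2] False by simp
      have "2 * r\<^sup>2 \<le> r * r\<^sup>2" using rM M by (intro mult_right_mono) auto
      then have "r\<^sup>2 \<le> r ^ 3 / 2" by (simp add: power3_eq_cube power2_eq_square)
      then have "y\<^sup>2 \<ge> r ^ 3 / 2" using x2 n2 r3 by linarith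
      then have "mu * y\<^sup>2 \<ge> mu * (r ^ 3 / 2)" using mu by (intro mult_left_mono) auto
      moreover have "x\<^sup>2 * r \<le> r ^ 3"
        using mult_right_mono[OF x2, of r] r0 by (simp add: power3_eq_cube power2_eq_square)
      then have "mu / 2 * (x\<^sup>2 * r) \<le> mu / 2 * r ^ 3" using mu by (intro mult_left_mono) auto
      moreover have "4 * c \<le> mu * r"
      proof -
        have "4 * c / mu \<le> r" using rM M by linarith
        then show ?thesis using mu by (simp add: field_simps)
      qed
      then have "4 * c * x\<^sup>2 \<le> mu * r * x\<^sup>2" by (intro mult_right_mono) auto
      moreover have "k * x\<^sup>2 * r \<le> mu / 4 * x\<^sup>2 * r" using k r0 by (intro mult_right_mono) auto
      moreover have "\<bar>x\<bar> * x\<^sup>2 \<ge> 0" by simp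
      \<comment> \<open>With the nonlinear products named, the estimate is linear: k \<xi>^2 r and w
        are each at most u/4, and u/2 <= q/2 <= mu \<eta>^2.\<close>
      moreover define q u w v where "q = mu * r ^ 3" and "u = mu * (x\<^sup>2 * r)" and "w = c * x\<^sup>2" and "v = \<bar>x\<bar> * x\<^sup>2"
      ultimately have "q / 2 \<le> mu * y\<^sup>2" "u / 2 \<le> q / 2" "4 * w \<le> u" "k * x\<^sup>2 * r \<le> u / 4" "0 \<le> v"
        by (simp_all add: mult_ac)
      then have "k * x\<^sup>2 * r \<le> v + mu * y\<^sup>2 - w" by linarith
      then show ?thesis by (simp only: v_def w_def)
    qed
    then show ?thesis by (simp add: disp_symbol_def xy lam r_def n_def)
  qed
  moreover have "R \<ge> 1" unfolding R_def using M by (intro ge_one_powr_ge_zero) auto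
  ultimately show ?thesis using that k by blast
qed

text \<open>A single term of the exponential series, of degree 2 n at \<delta> (1 + x), is below its
  sum. The shift by 1 costs exp \<delta> and allows 1 + x^2 <= (1 + x)^2.\<close>

lemma power_le_exp:
  assumes "\<delta> > 0"
  obtains K where "K \<ge> 0" "\<And>x::real. x \<ge> 0 \<Longrightarrow> (1 + x\<^sup>2) ^ n \<le> K * exp (\<delta> * x)"
proof -
  define K where "K = fact (2 * n) / \<delta> ^ (2 * n) * exp \<delta>"
  have "(1 + x\<^sup>2) ^ n \<le> K * exp (\<delta> * x)" if "x \<ge> 0" for x :: real
  proof -
    have "(\<delta> * (1 + x)) ^ (2 * n) /\<^sub>R fact (2 * n) \<le> exp (\<delta> * (1 + x))"
    proof -
      have "(\<Sum>i\<in>{2 * n}. (\<delta> * (1 + x)) ^ i /\<^sub>R fact i) \<le> (\<Sum>i. (\<delta> * (1 + x)) ^ i /\<^sub>R fact i)"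
        using that assms by (intro sum_le_suminf summable_exp_generic) auto
      then show ?thesis by (simp add: exp_def)
    qed
    then have "\<delta> ^ (2 * n) * (1 + x) ^ (2 * n) \<le> fact (2 * n) * exp (\<delta> * (1 + x))"
      unfolding power_mult_distrib by (simp add: field_simps)
    then have "(1 + x) ^ (2 * n) \<le> fact (2 * n) * exp (\<delta> * (1 + x)) / \<delta> ^ (2 * n)"
      using assms by (subst pos_le_divide_eq) (simp_all add: mult.commute)
    also have "\<dots> = K * exp (\<delta> * x)" by (simp add: K_def distrib_left exp_add)
    finally have "(1 + x) ^ (2 * n) \<le> K * exp (\<delta> * x)" .
    moreover have "(1 + x\<^sup>2) ^ n \<le> ((1 + x)\<^sup>2) ^ n"
      using that by (intro power_mono) (auto simp: power2_sum)
    ultimately show ?thesis by (simp add: power_mult)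
  qed
  moreover have "K \<ge> 0" using assms by (simp add: K_def)
  ultimately show ?thesis using that by blast
qed

text \<open>Since |\<xi>| <= |\<zeta>|, the product |\<zeta>| |\<xi>| is at most \<xi>^2 + \<eta>^2;
  dividing by |\<xi>| gives |\<zeta>| <= |\<xi>| + \<eta>^2 / |\<xi>|, the sum of the two squared
  multipliers of the energy space.\<close>

lemma X_half_weighted:
  assumes X: "X_half phi" and F: "fourier_L2 phi F"
  shows "integrable lborel (\<lambda>z. br z * (cmod (F z))\<^sup>2)"
proof -
  obtain G where G: "fourier_L2 phi G"
    and G1: "L2c (\<lambda>(\<xi>,\<eta>). complex_of_real (sqrt \<bar>\<xi>\<bar>) * G (\<xi>,\<eta>))"
    and G2: "L2c (\<lambda>(\<xi>,\<eta>). complex_of_real (\<eta> / sqrt \<bar>\<xi>\<bar>) * G (\<xi>,\<eta>))"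
    using X unfolding X_half_def by blast
  have L: "L2c F" "L2c G" using F G by (auto simp: fourier_L2_def)
  note [measurable] = L2c_D(1)[OF L(1)] L2c_D(1)[OF L(2)]
  let ?g = "\<lambda>z. (cmod (G z))\<^sup>2"
  have i1: "integrable lborel (\<lambda>z. \<bar>fst z\<bar> * ?g z)"
    using L2c_D(2)[OF G1] by (simp add: case_prod_unfold norm_mult power_mult_distrib)
  have i2: "integrable lborel (\<lambda>z. (snd z)\<^sup>2 / \<bar>fst z\<bar> * ?g z)"
    using L2c_D(2)[OF G2] by (simp add: case_prod_unfold norm_mult norm_divide power_mult_distrib power_divide)
  show ?thesis
  proof (rule Bochner_Integration.integrable_bound)
    show "integrable lborel (\<lambda>z. ?g z + (\<bar>fst z\<bar> * ?g z + (snd z)\<^sup>2 / \<bar>fst z\<bar> * ?g z))"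
      using L2c_D(2)[OF L(2)] i1 i2 by simp
    show "AE z in lborel. norm (br z * (cmod (F z))\<^sup>2) \<le> norm (?g z + (\<bar>fst z\<bar> * ?g z + (snd z)\<^sup>2 / \<bar>fst z\<bar> * ?g z))"
      using fourier_L2_unique[OF F G] AE_lborel_fst_nonzero
    proof eventually_elim
      case (elim z)
      obtain x y where xy: "z = (x, y)" by (cases z)
      define n where "n = norm z"
      have n2: "n\<^sup>2 = x\<^sup>2 + y\<^sup>2" by (simp add: n_def xy norm_Pair)
      have x0: "\<bar>x\<bar> > 0" using elim by (simp add: xy)
      have xn: "\<bar>x\<bar> \<le> n" using norm_fst_le[of x y] by (simp add: n_def xy)
      have "n * \<bar>x\<bar> \<le> n\<^sup>2" using mult_left_mono[OF xn, of n] by (simp add: power2_eq_square n_def)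
      also have "\<dots> = (\<bar>x\<bar> + y\<^sup>2 / \<bar>x\<bar>) * \<bar>x\<bar>" unfolding n2 using x0 by (simp add: distrib_right power2_eq_square)
      finally have "n \<le> \<bar>x\<bar> + y\<^sup>2 / \<bar>x\<bar>" using x0 by (simp only: mult_le_cancel_right_pos)
      then have "br z \<le> 1 + (\<bar>x\<bar> + y\<^sup>2 / \<bar>x\<bar>)" by (simp add: br_def n_def)
      then have "br z * ?g z \<le> (1 + (\<bar>x\<bar> + y\<^sup>2 / \<bar>x\<bar>)) * ?g z" by (intro mult_right_mono) auto
      then show ?case using elim(1) br_ge1[of z] by (simp add: xy distrib_right)
    qed
  qed measurable
qed

text \<open>Analyticity concerns a representative, since the L^2 data determine phi only up to null
  sets.\<close>

theorem theorem4p1: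
  fixes lam mu c :: real and phi :: "real \<times> real \<Rightarrow> real"
  assumes "lam \<ge> 0" and "mu \<ge> 0" and "\<not> (lam = 0 \<and> mu = 0)" and "c > 0"
    and "X_half phi"
    and "weak_solution c lam mu phi"
  shows "H_infty phi \<and> (\<exists>g. real_analytic_on UNIV g \<and> (AE z in lborel. phi z = g z))"
proof -
  obtain F where F: "fourier_L2 phi F" and eq: "AE \<zeta> in lborel. defect c lam mu F \<zeta> = 0"
    using weak_solution_symbol[OF assms(6)] by blast
  have L: "L2 phi" "L2c F" using F by (auto simp: fourier_L2_def)
  note [measurable] = L2c_D(1)[OF L(2)]
  obtain k R where k: "k > 0" and R: "R \<ge> 1"
    and sym: "\<And>z. norm z \<ge> R \<Longrightarrow> - disp_symbol c lam mu z \<ge> k * (fst z)\<^sup>2 * norm z powr (2 / 3)"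
    using high_frequency_symbol[OF assms(1-4)] by blast
  define f where "f z = cmod (F z)" for z
  \<comment> \<open>1 / (8 pi^2) from the equation, 1 / k from the symbol, and a factor 2 for
    passing from |z| to 1 + |z|.\<close>
  define A where "A = 1 / (4 * pi\<^sup>2 * k)"
  interpret high_frequency_inequality f A R
  proof
    show "f \<in> borel_measurable borel" unfolding f_def by measurable
    show "f z \<ge> 0" for z by (simp add: f_def)
    show "integrable lborel (\<lambda>z. br z * (f z)\<^sup>2)" unfolding f_def by (rule X_half_weighted[OF assms(5) F])
    show "A \<ge> 0" "R \<ge> 0" using k R by (auto simp: A_def)
    show "AE z in lborel. norm z \<ge> R \<longrightarrow> f z \<le> A * br z powr (- 2 / 3) * (LINT w|lborel. f w * f (z - w))"
      using eq AE_lborel_fst_nonzero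
    proof eventually_elim
      case (elim z)
      show ?case
      proof
        assume z: "norm z \<ge> R"
        define x2 where "x2 = (fst z)\<^sup>2"
        define Cv where "Cv = (LINT w|lborel. f w * f (z - w))"
        have x2: "x2 > 0" using elim(2) by (simp add: x2_def)
        have n1: "norm z \<ge> 1" using z R by linarith
        have C0: "Cv \<ge> 0" by (auto simp: Cv_def f_def intro!: integral_nonneg_AE)
        have "F z * of_real (disp_symbol c lam mu z) = conv F z * of_real (x2 / (8 * pi\<^sup>2))"
          using elim(1) by (simp add: defect_def x2_def eq_neg_iff_add_eq_0)
        then have "cmod (F z * of_real (disp_symbol c lam mu z)) = cmod (conv F z * of_real (x2 / (8 * pi\<^sup>2)))" by simp
        then have e: "f z * \<bar>disp_symbol c lam mu z\<bar> = cmod (conv F z) * (x2 / (8 * pi\<^sup>2))"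
          using x2 by (simp add: norm_mult norm_divide norm_power f_def)
        \<comment> \<open>Phases are discarded here: from now on only |F| matters.\<close>
        have "cmod (conv F z) \<le> Cv"
          unfolding conv_def Cv_def f_def norm_mult[symmetric] by (rule integral_norm_bound)
        then have le: "f z * \<bar>disp_symbol c lam mu z\<bar> \<le> Cv * (x2 / (8 * pi\<^sup>2))"
          unfolding e using x2 by (intro mult_right_mono) auto
        have "br z powr (2 / 3) \<le> (2 * norm z) powr (2 / 3)" using n1 by (intro powr_mono2) (auto simp: br_def)
        also have "\<dots> = 2 powr (2 / 3) * norm z powr (2 / 3)" by (simp add: powr_mult)
        also have "\<dots> \<le> 2 powr 1 * norm z powr (2 / 3)" by (intro mult_right_mono powr_mono) auto
        finally have b: "br z powr (2 / 3) \<le> 2 * norm z powr (2 / 3)" by simp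
        have "f z * (k * x2 * (br z powr (2 / 3) / 2)) \<le> f z * (k * x2 * norm z powr (2 / 3))"
          using b k x2 by (intro mult_left_mono) (auto simp: f_def)
        also have "\<dots> \<le> f z * \<bar>disp_symbol c lam mu z\<bar>"
          using sym[OF z] by (intro mult_left_mono) (auto simp: f_def x2_def)
        also note le
        finally have "x2 * (f z * (k * (br z powr (2 / 3) / 2))) \<le> x2 * (Cv / (8 * pi\<^sup>2))" by (simp add: mult_ac)
        \<comment> \<open>Off the line \<xi> = 0 the common factor \<xi>^2 cancels.\<close>
        then have *: "f z * (k * (br z powr (2 / 3) / 2)) \<le> Cv / (8 * pi\<^sup>2)"
          using x2 by (simp only: mult_le_cancel_left_pos)
        have "br z powr (2 / 3) > 0" using br_ge1[of z] by simp
        then have "f z \<le> Cv / (8 * pi\<^sup>2) / (k * (br z powr (2 / 3) / 2))"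
          using * k by (subst pos_le_divide_eq) auto
        also have "\<dots> = A * br z powr (- 2 / 3) * Cv"
          using k by (simp add: A_def powr_minus_divide)
        finally show "f z \<le> A * br z powr (- 2 / 3) * (LINT w|lborel. f w * f (z - w))"
          by (simp only: Cv_def)
      qed
    qed
  qed
  obtain \<delta> where \<delta>: "\<delta> > 0" and e: "integrable lborel (\<lambda>z. exp (\<delta> * norm z) * f z)"
    using exponential_decay by blast
  obtain B where B: "B \<ge> 0" "AE z in lborel. norm z \<ge> R \<longrightarrow> f z \<le> B" using high_frequency_bounded by blast
  have "H_infty phi"
    unfolding H_infty_def sobolev_H_def
  proof (intro allI conjI exI)
    fix n
    show "L2 phi" "fourier_L2 phi F" by fact+
    obtain K where K: "K \<ge> 0" "\<And>x::real. x \<ge> 0 \<Longrightarrow> (1 + x\<^sup>2) ^ n \<le> K * exp (\<delta> * x)"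
      using power_le_exp[OF \<delta>] by blast
    have nrm: "(cmod (complex_of_real ((1 + (norm \<zeta>)\<^sup>2) powr (real n / 2)) * F \<zeta>))\<^sup>2 = (1 + (norm \<zeta>)\<^sup>2) ^ n * (f \<zeta>)\<^sup>2" for \<zeta>
    proof -
      have p: "1 + (norm \<zeta>)\<^sup>2 > 0" by (simp add: add_pos_nonneg)
      then have "((1 + (norm \<zeta>)\<^sup>2) powr (real n / 2))\<^sup>2 = (1 + (norm \<zeta>)\<^sup>2) ^ n"
        by (simp add: powr_power powr_realpow)
      then show ?thesis by (simp add: norm_mult power_mult_distrib f_def)
    qed
    have "integrable lborel (\<lambda>\<zeta>. (1 + (norm \<zeta>)\<^sup>2) ^ n * (f \<zeta>)\<^sup>2)"
    proof (rule Bochner_Integration.integrable_bound)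
      \<comment> \<open>Below R the polynomial weight is bounded. Beyond R one factor f is bounded
        by B, and the exponential moment of the other absorbs the polynomial.\<close>
      show "integrable lborel (\<lambda>\<zeta>. (1 + R\<^sup>2) ^ n * (f \<zeta>)\<^sup>2 + K * B * (exp (\<delta> * norm \<zeta>) * f \<zeta>))"
        using square_integrable e by simp
      show "AE \<zeta> in lborel. norm ((1 + (norm \<zeta>)\<^sup>2) ^ n * (f \<zeta>)\<^sup>2) \<le> norm ((1 + R\<^sup>2) ^ n * (f \<zeta>)\<^sup>2 + K * B * (exp (\<delta> * norm \<zeta>) * f \<zeta>))"
        using B(2)
      proof (rule eventually_mono)
        fix \<zeta> assume *: "norm \<zeta> \<ge> R \<longrightarrow> f \<zeta> \<le> B"
        have nn: "(1 + R\<^sup>2) ^ n * (f \<zeta>)\<^sup>2 \<ge> 0" "K * B * (exp (\<delta> * norm \<zeta>) * f \<zeta>) \<ge> 0"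
          using K B nonneg[of \<zeta>] by auto
        have "(1 + (norm \<zeta>)\<^sup>2) ^ n * (f \<zeta>)\<^sup>2 \<le> (1 + R\<^sup>2) ^ n * (f \<zeta>)\<^sup>2 + K * B * (exp (\<delta> * norm \<zeta>) * f \<zeta>)"
        proof (cases "norm \<zeta> \<ge> R")
          case True
          have "(1 + (norm \<zeta>)\<^sup>2) ^ n * (f \<zeta> * f \<zeta>) \<le> (K * exp (\<delta> * norm \<zeta>)) * (B * f \<zeta>)"
            using True * K nonneg[of \<zeta>] B(1) by (intro mult_mono) auto
          then show ?thesis using nn by (simp add: power2_eq_square mult_ac)
        next
          case False
          have "(1 + (norm \<zeta>)\<^sup>2) ^ n * (f \<zeta>)\<^sup>2 \<le> (1 + R\<^sup>2) ^ n * (f \<zeta>)\<^sup>2"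
            using False by (intro mult_right_mono power_mono add_left_mono) auto
          then show ?thesis using nn by linarith
        qed
        then show "norm ((1 + (norm \<zeta>)\<^sup>2) ^ n * (f \<zeta>)\<^sup>2) \<le> norm ((1 + R\<^sup>2) ^ n * (f \<zeta>)\<^sup>2 + K * B * (exp (\<delta> * norm \<zeta>) * f \<zeta>))"
          using nn by (simp add: abs_mult)
      qed
    qed measurable
    then show "L2c (\<lambda>\<zeta>. complex_of_real ((1 + (norm \<zeta>)\<^sup>2) powr (real n / 2)) * F \<zeta>)"
      unfolding L2c_def nrm by simp
  qed
  moreover have "integrable lborel F"
    using integrable_f by (simp add: f_def[abs_def] integrable_norm_iff)
  then have "AE z in lborel. phi z = 1 / (4 * pi\<^sup>2) * Re (inv_ft F z)" by (rule fourier_inversion_AE[OF F])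
  moreover have "real_analytic_on UNIV (\<lambda>z. 1 / (4 * pi\<^sup>2) * Re (inv_ft F z))"
    using real_analytic_inv_ft[OF _ \<delta>, of F] e by (intro real_analytic_on_cmult) (simp add: f_def)
  ultimately show ?thesis by blast
qed

end
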